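(* Let $(\mathbb{M}^n,g,f,\varphi,\lambda)$, $n\geq 3$, be a Ricci-Hessian type manifold, with associated positive integer $m$; that is, $(\mathbb{M}^n,g)$ is an $n$-dimensional Riemannian manifold, $\varphi,f,\lambda$ are real smooth functions on $\mathbb{M}$ with $f>0$, and $$Ric+\nabla^2\varphi=\lambda g+\frac{m}{f}\nabla^2 f .$$ Assume that the set of zeroes of $\nabla\varphi$ is at most a discrete subset of $\mathbb{M}$ and that $(\mathbb{M}^n,g)$ has harmonic Weyl tensor. Then $$\big[(m+n-2)\,Ric(\nabla f,\cdot)-f\,Ric(\nabla\varphi,\cdot)+(n-2)\,\nabla^2\varphi(\nabla f,\cdot)\big]\wedge df=(n-1)\,f\,\Omega(\nabla\varphi,\nabla f).$$ In particular, the vector field $\nabla f$ is an eigenvector of the Ricci tensor provided that the vector field $\nabla\varphi$ is normal on $f$-hypersurfaces.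
   Context: $Ric$ is the Ricci tensor of $g$ (also viewed as a $(1,1)$-tensor via $g(Ric(X),Y)=Ric(X,Y)$); $\nabla u$, $\nabla^2u$ denote gradient and Hessian. The curvature tensor is $Rm(X,Y)Z=[\nabla_X,\nabla_Y]Z-\nabla_{[X,Y]}Z$. The curvature form is $\Omega(X,Y)(\cdot,\cdot)=g(Rm(\cdot,\cdot)X,Y)$. The wedge product of $1$-forms is $\alpha\wedge\beta=\alpha\otimes\beta-\beta\otimes\alpha$. Harmonic Weyl tensor: the divergence of the Weyl tensor $W$ vanishes; when $n=3$ the condition is understood as local conformal flatness. In all dimensions $n\ge3$ the condition thus means that the Schouten tensor $S=\frac{1}{n-2}\big(Ric-\frac{R}{2(n-1)}g\big)$ ($R$ the scalar curvature) is Codazzi: $(\nabla_XS)(Y,Z)=(\nabla_YS)(X,Z)$ for all vector fields $X,Y,Z$. An $f$-hypersurface is the inverse image under $f$ of a regular value of $f$, as a submanifold of $\mathbb{M}$. "$\nabla\varphi$ is normal on $f$-hypersurfaces" means that $\nabla\varphi$ is orthogonal to the $f$-hypersurfaces, i.e. is a multiple of $\nabla f$. *)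

theory Defs
  imports "HOL-Analysis.Analysis"
begin

fun Ck_on :: "nat \<Rightarrow> ('a::real_normed_vector \<Rightarrow> 'b::real_normed_vector) \<Rightarrow> 'a set \<Rightarrow> bool" where
  "Ck_on 0 f S \<longleftrightarrow> continuous_on S f"
| "Ck_on (Suc k) f S \<longleftrightarrow>
     (\<forall>x\<in>S. f differentiable (at x)) \<and> (\<forall>v. Ck_on k (\<lambda>x. frechet_derivative f (at x) v) S)"

text \<open>Only used for open sets \<open>S\<close>.\<close>

definition smooth_on :: "('a::real_normed_vector \<Rightarrow> 'b::real_normed_vector) \<Rightarrow> 'a set \<Rightarrow> bool" where
  "smooth_on f S \<longleftrightarrow> (\<forall>k. Ck_on k f S)"

text \<open>A chart is a pair of its domain and the coordinate map. A tangent vector is represented by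
  the operator ``directional derivative'' on real functions. Vector fields and functions are total
  HOL functions; their values outside the open set under consideration are irrelevant.\<close>

type_synonym ('a, 'n) chart = "'a set \<times> ('a \<Rightarrow> real ^ 'n)"
type_synonym 'a tvec = "('a \<Rightarrow> real) \<Rightarrow> real"
type_synonym 'a vfield = "'a \<Rightarrow> 'a tvec"

text \<open>The last component is the Levi-Civita connection: it is not an additional choice, since
  \<open>riemannian_manifold\<close> below requires the properties that determine it from the metric.\<close>

record ('a, 'n) riem =
  topol :: "'a topology"
  atlas :: "('a, 'n) chart set"
  met :: "'a \<Rightarrow> 'a tvec \<Rightarrow> 'a tvec \<Rightarrow> real"
  nabla :: "'a vfield \<Rightarrow> 'a vfield \<Rightarrow> 'a vfield"

abbreviation points :: "('a, 'n) riem \<Rightarrow> 'a set" where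
  "points G \<equiv> topspace (topol G)"

definition chart_inv :: "('a, 'n) chart \<Rightarrow> real ^ 'n \<Rightarrow> 'a" where
  "chart_inv c = inv_into (fst c) (snd c)"

definition smooth_manifold :: "('a, 'n::finite) riem \<Rightarrow> bool" where
  "smooth_manifold G \<longleftrightarrow>
     Hausdorff_space (topol G) \<and> second_countable (topol G) \<and>
     (\<Union>c\<in>atlas G. fst c) = points G \<and>
     (\<forall>c\<in>atlas G. openin (topol G) (fst c) \<and> open (snd c ` fst c) \<and>
        homeomorphic_map (subtopology (topol G) (fst c)) (top_of_set (snd c ` fst c)) (snd c)) \<and>
     (\<forall>c\<in>atlas G. \<forall>d\<in>atlas G. smooth_on (snd d \<circ> chart_inv c) (snd c ` (fst c \<inter> fst d)))"

definition smooth_fun :: "('a, 'n::finite) riem \<Rightarrow> 'a set \<Rightarrow> ('a \<Rightarrow> real) \<Rightarrow> bool" where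
  "smooth_fun G U u \<longleftrightarrow> openin (topol G) U \<and>
     (\<forall>c\<in>atlas G. smooth_on (u \<circ> chart_inv c) (snd c ` (U \<inter> fst c)))"

definition smooth_near :: "('a, 'n::finite) riem \<Rightarrow> 'a \<Rightarrow> ('a \<Rightarrow> real) \<Rightarrow> bool" where
  "smooth_near G p u \<longleftrightarrow> (\<exists>U. p \<in> U \<and> smooth_fun G U u)"

text \<open>The derivative at \<open>p\<close> along the curve with coordinates \<open>c(p) + t a\<close>. The value \<open>0\<close> on
  functions that are not smooth near \<open>p\<close> makes equality of tangent vectors extensional.\<close>

definition chart_deriv ::
    "('a, 'n::finite) riem \<Rightarrow> ('a, 'n) chart \<Rightarrow> real ^ 'n \<Rightarrow> 'a vfield" where
  "chart_deriv G c a = (\<lambda>p u. if smooth_near G p u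
      then frechet_derivative (u \<circ> chart_inv c) (at (snd c p)) a else 0)"

definition tangent :: "('a, 'n::finite) riem \<Rightarrow> 'a \<Rightarrow> 'a tvec set" where
  "tangent G p = {chart_deriv G c a p | c a. c \<in> atlas G \<and> p \<in> fst c}"

definition tzero :: "'a tvec" where
  "tzero = (\<lambda>u. 0)"

definition tplus :: "'a tvec \<Rightarrow> 'a tvec \<Rightarrow> 'a tvec" where
  "tplus v w = (\<lambda>u. v u + w u)"

definition tscale :: "real \<Rightarrow> 'a tvec \<Rightarrow> 'a tvec" where
  "tscale a v = (\<lambda>u. a * v u)"

definition tminus :: "'a tvec \<Rightarrow> 'a tvec \<Rightarrow> 'a tvec" where
  "tminus v w = (\<lambda>u. v u - w u)"

definition smooth_vfield :: "('a, 'n::finite) riem \<Rightarrow> 'a set \<Rightarrow> 'a vfield \<Rightarrow> bool" where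
  "smooth_vfield G U X \<longleftrightarrow> openin (topol G) U \<and> (\<forall>p\<in>U. X p \<in> tangent G p) \<and>
     (\<forall>V u. V \<subseteq> U \<and> smooth_fun G V u \<longrightarrow> smooth_fun G V (\<lambda>p. X p u))"

definition lie_bracket ::
    "('a, 'n::finite) riem \<Rightarrow> 'a vfield \<Rightarrow> 'a vfield \<Rightarrow> 'a vfield" where
  "lie_bracket G X Y = (\<lambda>p u. if smooth_near G p u
      then X p (\<lambda>q. Y q u) - Y p (\<lambda>q. X q u) else 0)"

definition riemannian_metric :: "('a, 'n::finite) riem \<Rightarrow> bool" where
  "riemannian_metric G \<longleftrightarrow>
     (\<forall>p\<in>points G. \<forall>v\<in>tangent G p. \<forall>w\<in>tangent G p.
        met G p v w = met G p w v \<and> (v \<noteq> tzero \<longrightarrow> met G p v v > 0) \<and>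
        (\<forall>z\<in>tangent G p. \<forall>a b.
           met G p (tplus (tscale a v) (tscale b w)) z = a * met G p v z + b * met G p w z)) \<and>
     (\<forall>U X Y. smooth_vfield G U X \<and> smooth_vfield G U Y \<longrightarrow>
        smooth_fun G U (\<lambda>p. met G p (X p) (Y p)))"

text \<open>The connection acts on vector fields over arbitrary open sets \<open>U\<close>. The conditions are, in
  this order: \<open>\<nabla>\<close> is a connection, it is torsion-free, it is compatible with the metric.\<close>

definition levi_civita :: "('a, 'n::finite) riem \<Rightarrow> bool" where
  "levi_civita G \<longleftrightarrow>
     (\<forall>U X Y Z. smooth_vfield G U X \<and> smooth_vfield G U Y \<and> smooth_vfield G U Z \<longrightarrow>
        smooth_vfield G U (nabla G X Y) \<and>
        (\<forall>h k. smooth_fun G U h \<and> smooth_fun G U k \<longrightarrow>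
           (\<forall>p\<in>U. nabla G (\<lambda>q. tplus (tscale (h q) (X q)) (tscale (k q) (Y q))) Z p =
              tplus (tscale (h p) (nabla G X Z p)) (tscale (k p) (nabla G Y Z p)))) \<and>
        (\<forall>p\<in>U. nabla G X (\<lambda>q. tplus (Y q) (Z q)) p = tplus (nabla G X Y p) (nabla G X Z p)) \<and>
        (\<forall>h. smooth_fun G U h \<longrightarrow>
           (\<forall>p\<in>U. nabla G X (\<lambda>q. tscale (h q) (Y q)) p =
              tplus (tscale (X p h) (Y p)) (tscale (h p) (nabla G X Y p)))) \<and>
        (\<forall>p\<in>U. tminus (nabla G X Y p) (nabla G Y X p) = lie_bracket G X Y p) \<and>
        (\<forall>p\<in>U. X p (\<lambda>q. met G q (Y q) (Z q)) =
           met G p (nabla G X Y p) (Z p) + met G p (Y p) (nabla G X Z p)))"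

definition riemannian_manifold :: "('a, 'n::finite) riem \<Rightarrow> bool" where
  "riemannian_manifold G \<longleftrightarrow> smooth_manifold G \<and> riemannian_metric G \<and> levi_civita G"

definition sharp :: "('a, 'n::finite) riem \<Rightarrow> 'a \<Rightarrow> ('a tvec \<Rightarrow> real) \<Rightarrow> 'a tvec" where
  "sharp G p \<alpha> = (THE z. z \<in> tangent G p \<and> (\<forall>w\<in>tangent G p. met G p z w = \<alpha> w))"

definition differential :: "('a \<Rightarrow> real) \<Rightarrow> 'a \<Rightarrow> 'a tvec \<Rightarrow> real" where
  "differential u p v = v u"

definition grad :: "('a, 'n::finite) riem \<Rightarrow> ('a \<Rightarrow> real) \<Rightarrow> 'a vfield" where
  "grad G u p = sharp G p (differential u p)"

text \<open>Tensors are evaluated on tangent vectors at \<open>p\<close> through arbitrary smooth extensions of these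
  vectors to vector fields near \<open>p\<close>.\<close>

definition extend :: "('a, 'n::finite) riem \<Rightarrow> 'a \<Rightarrow> 'a tvec \<Rightarrow> 'a vfield" where
  "extend G p v = (SOME X. (\<exists>U. p \<in> U \<and> smooth_vfield G U X) \<and> X p = v)"

definition hessian ::
    "('a, 'n::finite) riem \<Rightarrow> ('a \<Rightarrow> real) \<Rightarrow> 'a \<Rightarrow> 'a tvec \<Rightarrow> 'a tvec \<Rightarrow> real" where
  "hessian G u p v w = met G p (nabla G (extend G p v) (grad G u) p) w"

definition Rm_field ::
    "('a, 'n::finite) riem \<Rightarrow> 'a vfield \<Rightarrow> 'a vfield \<Rightarrow> 'a vfield \<Rightarrow> 'a vfield" where
  "Rm_field G X Y Z = (\<lambda>p. tminus
     (tminus (nabla G X (nabla G Y Z) p) (nabla G Y (nabla G X Z) p))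
     (nabla G (lie_bracket G X Y) Z p))"

definition Rm ::
    "('a, 'n::finite) riem \<Rightarrow> 'a \<Rightarrow> 'a tvec \<Rightarrow> 'a tvec \<Rightarrow> 'a tvec \<Rightarrow> 'a tvec" where
  "Rm G p x y z = Rm_field G (extend G p x) (extend G p y) (extend G p z) p"

definition curvature_form :: "('a, 'n::finite) riem \<Rightarrow> 'a \<Rightarrow> 'a tvec \<Rightarrow> 'a tvec \<Rightarrow>
    'a tvec \<Rightarrow> 'a tvec \<Rightarrow> real" where
  "curvature_form G p x y v w = met G p (Rm G p v w x) y"

text \<open>Trace of an endomorphism \<open>L\<close> of the tangent space at \<open>p\<close>, computed in the coordinate basis of
  some chart around \<open>p\<close>: the \<open>i\<close>-th component of a tangent vector is its value on the \<open>i\<close>-th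
  coordinate function.\<close>

definition tangent_trace :: "('a, 'n::finite) riem \<Rightarrow> 'a \<Rightarrow> ('a tvec \<Rightarrow> 'a tvec) \<Rightarrow> real" where
  "tangent_trace G p L = (let c = (SOME c. c \<in> atlas G \<and> p \<in> fst c) in
     \<Sum>i\<in>UNIV. L (chart_deriv G c (axis i 1) p) (\<lambda>q. snd c q $ i))"

text \<open>With the sign convention of \<open>Rm\<close>, this trace makes \<open>ricci\<close> positive on round spheres.\<close>

definition ricci :: "('a, 'n::finite) riem \<Rightarrow> 'a \<Rightarrow> 'a tvec \<Rightarrow> 'a tvec \<Rightarrow> real" where
  "ricci G p y z = tangent_trace G p (\<lambda>x. Rm G p x y z)"

definition ricci_endo :: "('a, 'n::finite) riem \<Rightarrow> 'a \<Rightarrow> 'a tvec \<Rightarrow> 'a tvec" where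
  "ricci_endo G p v = sharp G p (ricci G p v)"

definition scalar_curvature :: "('a, 'n::finite) riem \<Rightarrow> 'a \<Rightarrow> real" where
  "scalar_curvature G p = tangent_trace G p (ricci_endo G p)"

definition schouten :: "('a, 'n::finite) riem \<Rightarrow> 'a \<Rightarrow> 'a tvec \<Rightarrow> 'a tvec \<Rightarrow> real" where
  "schouten (G :: ('a, 'n::finite) riem) p v w = 1 / (real CARD('n) - 2) *
     (ricci G p v w - scalar_curvature G p / (2 * (real CARD('n) - 1)) * met G p v w)"

definition cov_deriv2 :: "('a, 'n::finite) riem \<Rightarrow> ('a \<Rightarrow> 'a tvec \<Rightarrow> 'a tvec \<Rightarrow> real) \<Rightarrow>
    'a vfield \<Rightarrow> 'a vfield \<Rightarrow> 'a vfield \<Rightarrow> 'a \<Rightarrow> real" where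
  "cov_deriv2 G T X Y Z p = X p (\<lambda>q. T q (Y q) (Z q)) -
     T p (nabla G X Y p) (Z p) - T p (Y p) (nabla G X Z p)"

definition codazzi :: "('a, 'n::finite) riem \<Rightarrow> ('a \<Rightarrow> 'a tvec \<Rightarrow> 'a tvec \<Rightarrow> real) \<Rightarrow> bool" where
  "codazzi G T \<longleftrightarrow>
     (\<forall>U X Y Z. smooth_vfield G U X \<and> smooth_vfield G U Y \<and> smooth_vfield G U Z \<longrightarrow>
        (\<forall>p\<in>U. cov_deriv2 G T X Y Z p = cov_deriv2 G T Y X Z p))"

text \<open>For \<open>n = 3\<close>, where the Weyl tensor vanishes identically, this is local conformal flatness;
  for \<open>n \<ge> 4\<close> it is the vanishing of the divergence of the Weyl tensor.\<close>

definition harmonic_weyl :: "('a, 'n::finite) riem \<Rightarrow> bool" where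
  "harmonic_weyl G \<longleftrightarrow> codazzi G (schouten G)"

definition wedge :: "('v \<Rightarrow> real) \<Rightarrow> ('v \<Rightarrow> real) \<Rightarrow> 'v \<Rightarrow> 'v \<Rightarrow> real" where
  "wedge \<alpha> \<beta> v w = \<alpha> v * \<beta> w - \<beta> v * \<alpha> w"

definition ricci_hessian_type :: "('a, 'n::finite) riem \<Rightarrow> ('a \<Rightarrow> real) \<Rightarrow> ('a \<Rightarrow> real) \<Rightarrow>
    ('a \<Rightarrow> real) \<Rightarrow> nat \<Rightarrow> bool" where
  "ricci_hessian_type G f \<phi> lam m \<longleftrightarrow>
     riemannian_manifold G \<and> m > 0 \<and>
     smooth_fun G (points G) f \<and> smooth_fun G (points G) \<phi> \<and> smooth_fun G (points G) lam \<and>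
     (\<forall>p\<in>points G. f p > 0) \<and>
     (\<forall>p\<in>points G. \<forall>v\<in>tangent G p. \<forall>w\<in>tangent G p.
        ricci G p v w + hessian G \<phi> p v w = lam p * met G p v w + real m / f p * hessian G f p v w)"

definition level_set :: "('a, 'n::finite) riem \<Rightarrow> ('a \<Rightarrow> real) \<Rightarrow> real \<Rightarrow> 'a set" where
  "level_set G f c = {p \<in> points G. f p = c}"

definition regular_value :: "('a, 'n::finite) riem \<Rightarrow> ('a \<Rightarrow> real) \<Rightarrow> real \<Rightarrow> bool" where
  "regular_value G f c \<longleftrightarrow> (\<forall>p\<in>level_set G f c. \<exists>v\<in>tangent G p. differential f p v \<noteq> 0)"

text \<open>At a point of a regular level set, the tangent space of the level set is the kernel of the
  differential of \<open>f\<close>.\<close>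

definition normal_on_hypersurfaces ::
    "('a, 'n::finite) riem \<Rightarrow> ('a \<Rightarrow> real) \<Rightarrow> 'a vfield \<Rightarrow> bool" where
  "normal_on_hypersurfaces G f X \<longleftrightarrow>
     (\<forall>c. regular_value G f c \<longrightarrow>
        (\<forall>p\<in>level_set G f c. \<forall>v\<in>tangent G p. differential f p v = 0 \<longrightarrow> met G p (X p) v = 0))"

end

(*
  For u smooth, Hess u (X, Z) = X (Z u) - (nabla_X Z) u is symmetric because the connection is
  torsion-free, and the skew part of its covariant derivative is g (Rm (X, Y) grad u, Z). Hence the
  Codazzi equation for the Schouten tensor, with Ric eliminated through the Ricci-Hessian equation,
  expresses Rm (X, Y) grad phi - (m/f) Rm (X, Y) grad f through the differentials of f and of
  sigma = lam - R / (2 (n - 1)). Pairing this identity with grad f yields Omega (grad phi, grad f), its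
  trace yields Ric (grad phi) - (m/f) Ric (grad f), and sigma drops out of the combination.

  For the eigenvector statement, normality is only known on level sets of regular values. By Sard's
  theorem the points of such level sets are dense in {df <> 0}, so grad phi = h grad f there. For
  w in the kernel of df put A = Ric (grad f, w) and B = Hess f (grad f, w), so that
  Hess phi (grad f, w) = h B. The Ricci-Hessian equation gives A = (m/f - h) B and the wedge identity
  gives (m + n - 2 - f h) A + (n - 2) h B = 0. Together ((m - f h)^2 + (n - 2) m) B = 0, so B = A = 0.
*)
theory Submission
  imports Defs
begin

section \<open>Calculus of smooth maps between normed spaces\<close>


text \<open>A tensor at a point is computed from chosen extensions of its arguments, and a trace
  from a chosen chart, so independence of these choices has to be earned. Symmetry of the Hessian
  settles both of its slots; for \<open>Rm\<close> only the third slot is settled, by skew-symmetry.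
  Linearity of \<open>Rm\<close> in its first two slots and the Bianchi identity are avoided: the
  Ricci-Hessian equation presents \<open>ricci\<close> as a combination of the metric and two
  Hessians, from which it inherits symmetry, bilinearity and smoothness, and the trace identity is
  computed in the very chart that \<open>tangent_trace\<close> picks. The trace also produces the
  Laplacian of f; it multiplies df, so the wedge product with df removes it, just as it removes lam.
  Sard's theorem enters because the level set through a noncritical point may contain a critical
  point elsewhere, and then normality says nothing on it. Its induction on the dimension runs over
  subspaces of one fixed Euclidean space, since a hyperplane is not itself a type.\<close>

lemma Ck_on_subset: "Ck_on k f S \<Longrightarrow> T \<subseteq> S \<Longrightarrow> Ck_on k f T"
  by (induction k arbitrary: f) (auto intro: continuous_on_subset)

lemma Ck_on_cong:
  assumes "open S" "\<And>x. x \<in> S \<Longrightarrow> f x = g x" "Ck_on k f S"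
  shows "Ck_on k g S"
  using assms
proof (induction k arbitrary: f g)
  case 0
  then show ?case by (metis Ck_on.simps(1) continuous_on_cong)
next
  case (Suc k)
  have d: "g differentiable (at x)" if "x \<in> S" for x
    using Suc.prems that unfolding differentiable_def
    by (metis Ck_on.simps(2) differentiable_def has_derivative_transform_within_open)
  have "frechet_derivative f (at x) = frechet_derivative g (at x)" if "x \<in> S" for x
    using frechet_derivative_transform_within_open[of f x S g] Suc.prems that by auto
  then have "Ck_on k (\<lambda>x. frechet_derivative g (at x) v) S" for v
    using Suc.IH[of "\<lambda>x. frechet_derivative f (at x) v"] Suc.prems by auto
  with d show ?case by auto
qed

lemma Ck_on_SucD: "Ck_on (Suc k) f S \<Longrightarrow> Ck_on k f S"
  by (induction k arbitrary: f) (auto intro: continuous_at_imp_continuous_on differentiable_imp_continuous_within)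

text \<open>\<open>Ck_on\<close> is phrased with \<open>frechet_derivative\<close>; this rule lets
  the later inductions work with explicit derivative formulas instead.\<close>

lemma Ck_on_SucI:
  assumes "open S" "\<And>x. x \<in> S \<Longrightarrow> (f has_derivative f' x) (at x)" "\<And>v. Ck_on k (\<lambda>x. f' x v) S"
  shows "Ck_on (Suc k) f S"
proof -
  have "frechet_derivative f (at x) = f' x" if "x \<in> S" for x
    using frechet_derivative_at assms(2) that by metis
  then have "Ck_on k (\<lambda>x. frechet_derivative f (at x) v) S" for v
    using Ck_on_cong[OF assms(1) _ assms(3)[of v]] by auto
  then show ?thesis
    using assms(2) by (auto simp: differentiable_def)
qed

lemma Ck_on_Suc_derivative:
  "Ck_on (Suc k) f S \<Longrightarrow> x \<in> S \<Longrightarrow> (f has_derivative frechet_derivative f (at x)) (at x)"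
  using frechet_derivative_works by auto

lemma Ck_on_const [simp]: "Ck_on k (\<lambda>x. c) S"
  by (induction k arbitrary: c) (auto simp: continuous_on_const)

lemma Ck_on_bounded_linear:
  assumes "open S" "bounded_linear L" "Ck_on k f S"
  shows "Ck_on k (\<lambda>x. L (f x)) S"
  using assms(3)
proof (induction k arbitrary: f)
  case 0
  then show ?case using bounded_linear.continuous_on assms(2) by auto
next
  case (Suc k)
  show ?case
    by (rule Ck_on_SucI[OF assms(1) bounded_linear.has_derivative[OF assms(2) Ck_on_Suc_derivative[OF Suc.prems]]])
       (use Suc in auto)
qed

lemma Ck_on_linear:
  assumes "open S" "bounded_linear L"
  shows "Ck_on k L S"
proof (cases k)
  case 0
  then show ?thesis using assms(2) by (simp add: linear_continuous_on)
next
  case (Suc n)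
  then show ?thesis
    using Ck_on_SucI[OF assms(1) bounded_linear_imp_has_derivative[OF assms(2)]] by auto
qed

lemma Ck_on_add:
  assumes "open S" "Ck_on k f S" "Ck_on k g S"
  shows "Ck_on k (\<lambda>x. f x + g x) S"
  using assms(2,3)
proof (induction k arbitrary: f g)
  case 0
  then show ?case by (auto intro: continuous_on_add)
next
  case (Suc k)
  show ?case
    by (rule Ck_on_SucI[OF assms(1) has_derivative_add[OF Ck_on_Suc_derivative[OF Suc.prems(1)] Ck_on_Suc_derivative[OF Suc.prems(2)]]])
       (use Suc in auto)
qed

lemma Ck_on_scaleR:
  assumes "open S" "Ck_on k f S" "Ck_on k g S"
  shows "Ck_on k (\<lambda>x. f x *\<^sub>R g x) S"
  using assms(2,3)
proof (induction k arbitrary: f g)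
  case 0
  then show ?case by (auto intro: continuous_on_scaleR)
next
  case (Suc k)
  show ?case
    by (rule Ck_on_SucI[OF assms(1) has_derivative_scaleR[OF Ck_on_Suc_derivative[OF Suc.prems(1)] Ck_on_Suc_derivative[OF Suc.prems(2)]]])
       (use Suc.prems Suc.prems[THEN Ck_on_SucD] in \<open>auto intro!: Ck_on_add[OF assms(1)] Suc.IH\<close>)
qed

lemma Ck_on_sum:
  assumes "open S" "\<And>i. i \<in> I \<Longrightarrow> Ck_on k (f i) S"
  shows "Ck_on k (\<lambda>x. \<Sum>i\<in>I. f i x) S"
  using assms(2) by (induction I rule: infinite_finite_induct) (auto intro: Ck_on_add[OF assms(1)])

text \<open>In the chain rule the direction fed to the derivative of \<open>g\<close> moves with
  \<open>x\<close>, whereas \<open>Ck_on\<close> speaks of fixed directions. Expanding that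
  direction in \<open>Basis\<close> separates the two, hence the Euclidean middle space.\<close>

lemma Ck_on_compose:
  fixes f :: "'a::real_normed_vector \<Rightarrow> 'b::euclidean_space" and g :: "'b \<Rightarrow> 'c::real_normed_vector"
  assumes "open S" "open T" "f ` S \<subseteq> T" "Ck_on k f S" "Ck_on k g T"
  shows "Ck_on k (\<lambda>x. g (f x)) S"
  using assms(4,5)
proof (induction k arbitrary: g)
  case 0
  then show ?case using assms(3) by (auto intro: continuous_on_compose2)
next
  case (Suc k)
  let ?f' = "\<lambda>x. frechet_derivative f (at x)" and ?g' = "\<lambda>x. frechet_derivative g (at x)"
  have *: "((\<lambda>x. g (f x)) has_derivative (\<lambda>v. ?g' (f x) (?f' x v))) (at x)" if "x \<in> S" for x
    using has_derivative_compose[OF Ck_on_Suc_derivative[OF Suc.prems(1) that] Ck_on_Suc_derivative[OF Suc.prems(2)]] that assms(3)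
    by auto
  have eq: "?g' (f x) (?f' x v) = (\<Sum>b\<in>Basis. (?f' x v \<bullet> b) *\<^sub>R ?g' (f x) b)" if "x \<in> S" for x v
  proof -
    have "linear (?g' (f x))"
      using Suc.prems(2) that assms(3) by (auto intro!: linear_frechet_derivative)
    then have "?g' (f x) (\<Sum>b\<in>Basis. (?f' x v \<bullet> b) *\<^sub>R b) = (\<Sum>b\<in>Basis. (?f' x v \<bullet> b) *\<^sub>R ?g' (f x) b)"
      by (simp add: linear_sum linear_cmul)
    then show ?thesis by (simp add: euclidean_representation)
  qed
  have "Ck_on k (\<lambda>x. \<Sum>b\<in>Basis. (?f' x v \<bullet> b) *\<^sub>R ?g' (f x) b) S" for v
  proof (intro Ck_on_sum Ck_on_scaleR assms(1))
    fix b
    show "Ck_on k (\<lambda>x. ?f' x v \<bullet> b) S"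
      using Suc.prems(1) by (intro Ck_on_bounded_linear[OF assms(1) bounded_linear_inner_left]) auto
    show "Ck_on k (\<lambda>x. ?g' (f x) b) S"
      using Suc.IH[of "\<lambda>x. ?g' x b"] Suc.prems Ck_on_SucD by auto
  qed
  then have "Ck_on k (\<lambda>x. ?g' (f x) (?f' x v)) S" for v
    using Ck_on_cong[OF assms(1)] eq by (metis (no_types, lifting))
  with * show ?case
    by (rule Ck_on_SucI[OF assms(1)])
qed

text \<open>The derivative of a reciprocal contains the reciprocal again, but at one order less, so
  the induction closes.\<close>

lemma Ck_on_inverse:
  fixes f :: "'a::real_normed_vector \<Rightarrow> real"
  assumes "open S" "Ck_on k f S" "\<And>x. x \<in> S \<Longrightarrow> f x \<noteq> 0"
  shows "Ck_on k (\<lambda>x. inverse (f x)) S"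
  using assms(2)
proof (induction k)
  case 0
  then show ?case using assms(3) by (auto intro: continuous_on_inverse)
next
  case (Suc k)
  show ?case
  proof (rule Ck_on_SucI[OF assms(1) Deriv.has_derivative_inverse[OF _ Ck_on_Suc_derivative[OF Suc.prems]]])
    fix v
    have "Ck_on k (\<lambda>x. (- 1) *\<^sub>R (inverse (f x) *\<^sub>R (frechet_derivative f (at x) v *\<^sub>R inverse (f x)))) S"
      using Suc.prems Suc.IH[OF Ck_on_SucD[OF Suc.prems]]
      by (intro Ck_on_scaleR[OF assms(1)]) auto
    then show "Ck_on k (\<lambda>x. - (inverse (f x) * frechet_derivative f (at x) v * inverse (f x))) S"
      by (simp add: mult.assoc)
  qed (use assms in auto)
qed

lemma Ck_on_local:
  assumes "\<And>x. x \<in> S \<Longrightarrow> \<exists>T. open T \<and> x \<in> T \<and> Ck_on k f T"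
  shows "Ck_on k f S"
  using assms
proof (induction k arbitrary: f)
  case 0
  then show ?case
    by (metis Ck_on.simps(1) at_within_open continuous_at_imp_continuous_on continuous_on_eq_continuous_within)
next
  case (Suc k)
  have "\<exists>T. open T \<and> x \<in> T \<and> Ck_on k (\<lambda>x. frechet_derivative f (at x) v) T" if "x \<in> S" for x v
    using Suc.prems[OF that] by auto
  then show ?case using Suc by (metis Ck_on.simps(2))
qed

section \<open>The same rules for smooth maps\<close>

lemma smooth_on_subset: "smooth_on f S \<Longrightarrow> T \<subseteq> S \<Longrightarrow> smooth_on f T"
  unfolding smooth_on_def using Ck_on_subset by blast

lemma smooth_on_cong:
  "open S \<Longrightarrow> (\<And>x. x \<in> S \<Longrightarrow> f x = g x) \<Longrightarrow> smooth_on f S \<Longrightarrow> smooth_on g S"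
  unfolding smooth_on_def using Ck_on_cong by blast

lemma smooth_on_const: "smooth_on (\<lambda>x. c) S"
  unfolding smooth_on_def by simp

lemma smooth_on_add:
  "open S \<Longrightarrow> smooth_on f S \<Longrightarrow> smooth_on g S \<Longrightarrow> smooth_on (\<lambda>x. f x + g x) S"
  unfolding smooth_on_def using Ck_on_add by blast

lemma smooth_on_scaleR:
  "open S \<Longrightarrow> smooth_on f S \<Longrightarrow> smooth_on g S \<Longrightarrow> smooth_on (\<lambda>x. f x *\<^sub>R g x) S"
  unfolding smooth_on_def using Ck_on_scaleR by blast

lemma smooth_on_mult:
  fixes f g :: "'a::real_normed_vector \<Rightarrow> real"
  shows "open S \<Longrightarrow> smooth_on f S \<Longrightarrow> smooth_on g S \<Longrightarrow> smooth_on (\<lambda>x. f x * g x) S"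
  using smooth_on_scaleR[of S f g] by simp

lemma smooth_on_inverse:
  fixes f :: "'a::real_normed_vector \<Rightarrow> real"
  shows "open S \<Longrightarrow> smooth_on f S \<Longrightarrow> (\<And>x. x \<in> S \<Longrightarrow> f x \<noteq> 0) \<Longrightarrow> smooth_on (\<lambda>x. inverse (f x)) S"
  unfolding smooth_on_def using Ck_on_inverse by blast

lemma smooth_on_linear: "open S \<Longrightarrow> bounded_linear L \<Longrightarrow> smooth_on L S"
  unfolding smooth_on_def using Ck_on_linear by blast

lemma smooth_on_compose:
  fixes f :: "'a::real_normed_vector \<Rightarrow> 'b::euclidean_space" and g :: "'b \<Rightarrow> 'c::real_normed_vector"
  shows "open S \<Longrightarrow> open T \<Longrightarrow> f ` S \<subseteq> T \<Longrightarrow> smooth_on f S \<Longrightarrow> smooth_on g T \<Longrightarrow>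
    smooth_on (\<lambda>x. g (f x)) S"
  unfolding smooth_on_def using Ck_on_compose by blast

lemma smooth_on_local:
  assumes "\<And>x. x \<in> S \<Longrightarrow> \<exists>T. open T \<and> x \<in> T \<and> smooth_on f T"
  shows "smooth_on f S"
  using assms Ck_on_local unfolding smooth_on_def by metis

lemma smooth_on_differentiable: "smooth_on f S \<Longrightarrow> x \<in> S \<Longrightarrow> f differentiable (at x)"
  unfolding smooth_on_def by (metis Ck_on.simps(2))

lemma smooth_on_has_derivative:
  "smooth_on f S \<Longrightarrow> x \<in> S \<Longrightarrow> (f has_derivative frechet_derivative f (at x)) (at x)"
  using smooth_on_differentiable frechet_derivative_works by blast

lemma smooth_on_derivative: "smooth_on f S \<Longrightarrow> smooth_on (\<lambda>x. frechet_derivative f (at x) v) S"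
  unfolding smooth_on_def by (metis Ck_on.simps(2))

lemma smooth_on_imp_continuous_on: "smooth_on f S \<Longrightarrow> continuous_on S f"
  unfolding smooth_on_def by (metis Ck_on.simps(1))

section \<open>Sard's theorem for real-valued functions\<close>


text \<open>The head of the list is the direction differentiated last. Consing serves the search for
  a derivative with nonzero differential; appending (\<open>iter_deriv_snoc\<close>) turns
  derivatives of a partial derivative into derivatives of \<open>f\<close>.\<close>

fun iter_deriv :: "'a::real_normed_vector list \<Rightarrow> ('a \<Rightarrow> real) \<Rightarrow> 'a \<Rightarrow> real" where
  "iter_deriv [] f = f"
| "iter_deriv (v # vs) f = (\<lambda>x. frechet_derivative (iter_deriv vs f) (at x) v)"

lemma iter_deriv_snoc: "iter_deriv (vs @ [v]) f = iter_deriv vs (\<lambda>x. frechet_derivative f (at x) v)"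
  by (induction vs) auto

lemma smooth_on_iter_deriv: "smooth_on f S \<Longrightarrow> smooth_on (iter_deriv vs f) S"
  by (induction vs) (auto intro: smooth_on_derivative)

text \<open>One step of a Taylor estimate: a bound of order \<open>N\<close> on the partial
  derivatives integrates to order \<open>N + 1\<close>. The segment stays in
  \<open>x + span B\<close>, so only derivatives along \<open>B\<close> enter.\<close>

lemma mvt_span_bound:
  fixes f :: "'a::euclidean_space \<Rightarrow> real"
  assumes B: "finite B" "pairwise orthogonal B" "\<And>b. b \<in> B \<Longrightarrow> norm b = 1"
    and K: "convex K" "K \<subseteq> V" and f: "smooth_on f V"
    and xy: "x \<in> K" "y \<in> K" "y - x \<in> span B"
    and C: "\<And>b. b \<in> B \<Longrightarrow> C b \<ge> 0"
    and bound: "\<And>b z. b \<in> B \<Longrightarrow> z \<in> K \<Longrightarrow> z - x \<in> span B \<Longrightarrow>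
      \<bar>frechet_derivative f (at z) b\<bar> \<le> C b * norm (z - x) ^ N"
  shows "\<bar>f y - f x\<bar> \<le> (\<Sum>b\<in>B. C b) * norm (y - x) ^ Suc N"
proof -
  let ?h = "y - x"
  have K': "x + t *\<^sub>R ?h \<in> K" if "0 \<le> t" "t \<le> 1" for t
  proof -
    have "(1 - t) *\<^sub>R x + t *\<^sub>R y \<in> K"
      using K(1) xy that by (intro convexD_alt) auto
    then show ?thesis by (simp add: algebra_simps)
  qed
  have "\<exists>t\<in>{0..1}. f (x + 1 *\<^sub>R ?h) - f (x + 0 *\<^sub>R ?h) =
      (\<lambda>s. frechet_derivative f (at (x + t *\<^sub>R ?h)) (s *\<^sub>R ?h)) (1 - 0)"
  proof (rule mvt_very_simple)
    fix t :: real assume t: "0 \<le> t" "t \<le> 1"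
    have "((\<lambda>t. x + t *\<^sub>R ?h) has_derivative (\<lambda>s. s *\<^sub>R ?h)) (at t within {0..1})"
      by (auto intro!: derivative_eq_intros)
    moreover have "(f has_derivative frechet_derivative f (at (x + t *\<^sub>R ?h))) (at (x + t *\<^sub>R ?h))"
      using smooth_on_has_derivative[OF f] K'[OF t] K(2) by blast
    ultimately show "((\<lambda>t. f (x + t *\<^sub>R ?h)) has_derivative
        (\<lambda>s. frechet_derivative f (at (x + t *\<^sub>R ?h)) (s *\<^sub>R ?h))) (at t within {0..1})"
      by (rule has_derivative_compose)
  qed auto
  then obtain t where t: "0 \<le> t" "t \<le> 1" "f y - f x = frechet_derivative f (at (x + t *\<^sub>R ?h)) ?h"
    by auto
  define z where "z = x + t *\<^sub>R ?h"
  have zK: "z \<in> K" and zx: "z - x \<in> span B"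
    using K'[OF t(1,2)] xy(3) by (auto simp: z_def intro: span_scale)
  have zn: "norm (z - x) \<le> norm ?h"
    using t by (simp add: z_def mult_left_le_one_le)
  have lin: "linear (frechet_derivative f (at z))"
    using smooth_on_differentiable[OF f] zK K(2) by (intro linear_frechet_derivative) auto
  have "f y - f x = frechet_derivative f (at z) (\<Sum>b\<in>B. (?h \<bullet> b) *\<^sub>R b)"
    using orthonormal_basis_expand[OF B(2,3) xy(3) B(1)] t(3) by (simp add: z_def)
  also have "\<dots> = (\<Sum>b\<in>B. (?h \<bullet> b) * frechet_derivative f (at z) b)"
    using lin by (simp add: linear_sum linear_cmul)
  finally have "\<bar>f y - f x\<bar> \<le> (\<Sum>b\<in>B. \<bar>(?h \<bullet> b) * frechet_derivative f (at z) b\<bar>)"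
    by (metis sum_abs)
  also have "\<dots> \<le> (\<Sum>b\<in>B. C b * norm ?h ^ Suc N)"
  proof (rule sum_mono)
    fix b assume b: "b \<in> B"
    have "\<bar>?h \<bullet> b\<bar> \<le> norm ?h"
      using Cauchy_Schwarz_ineq2[of ?h b] B(3)[OF b] by simp
    moreover have "\<bar>frechet_derivative f (at z) b\<bar> \<le> C b * norm ?h ^ N"
      using bound[OF b zK zx] C[OF b] zn
      by (meson mult_left_mono norm_ge_zero order_trans power_mono)
    ultimately have "\<bar>?h \<bullet> b\<bar> * \<bar>frechet_derivative f (at z) b\<bar> \<le> norm ?h * (C b * norm ?h ^ N)"
      by (intro mult_mono) auto
    then show "\<bar>(?h \<bullet> b) * frechet_derivative f (at z) b\<bar> \<le> C b * norm ?h ^ Suc N"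
      by (simp add: abs_mult mult_ac)
  qed
  finally show ?thesis by (simp add: sum_distrib_right)
qed

text \<open>Induction on the order: flatness of order \<open>N + 1\<close> passes to flatness of
  order \<open>N\<close> of each partial derivative, and the mean value theorem restores the lost
  order. Compactness of \<open>K\<close> makes the constant independent of the base point
  \<open>x\<close>.\<close>

lemma flat_function_bound:
  fixes f :: "'a::euclidean_space \<Rightarrow> real"
  assumes B: "finite B" "pairwise orthogonal B" "\<And>b. b \<in> B \<Longrightarrow> norm b = 1"
    and K: "compact K" "convex K" "K \<subseteq> V" and f: "smooth_on f V"
  shows "\<exists>C\<ge>0. \<forall>x\<in>K. \<forall>y\<in>K. y - x \<in> span B \<longrightarrow>
    (\<forall>vs\<in>lists B. length vs < N \<longrightarrow> iter_deriv vs f x = 0) \<longrightarrow> \<bar>f y\<bar> \<le> C * norm (y - x) ^ N"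
  using f
proof (induction N arbitrary: f)
  case 0
  have "bounded (f ` K)"
    using smooth_on_imp_continuous_on[OF 0] K
    by (meson compact_continuous_image compact_imp_bounded continuous_on_subset)
  then obtain C where "\<forall>y\<in>K. \<bar>f y\<bar> \<le> C" "C > 0"
    by (auto simp: bounded_pos)
  then show ?case by (intro exI[of _ C]) auto
next
  case (Suc N)
  have "\<exists>C\<ge>0. \<forall>x\<in>K. \<forall>y\<in>K. y - x \<in> span B \<longrightarrow>
    (\<forall>vs\<in>lists B. length vs < N \<longrightarrow> iter_deriv (vs @ [b]) f x = 0) \<longrightarrow>
     \<bar>frechet_derivative f (at y) b\<bar> \<le> C * norm (y - x) ^ N" for b
    using Suc.IH[OF smooth_on_derivative[OF Suc.prems]] by (simp add: iter_deriv_snoc)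
  then obtain C where C0: "\<And>b. C b \<ge> 0" and C: "\<And>b x y. x \<in> K \<Longrightarrow> y \<in> K \<Longrightarrow> y - x \<in> span B \<Longrightarrow>
    (\<forall>vs\<in>lists B. length vs < N \<longrightarrow> iter_deriv (vs @ [b]) f x = 0) \<Longrightarrow>
     \<bar>frechet_derivative f (at y) b\<bar> \<le> C b * norm (y - x) ^ N"
    by metis
  have "\<bar>f y\<bar> \<le> (\<Sum>b\<in>B. C b) * norm (y - x) ^ Suc N"
    if xy: "x \<in> K" "y \<in> K" "y - x \<in> span B"
      and flat: "\<forall>vs\<in>lists B. length vs < Suc N \<longrightarrow> iter_deriv vs f x = 0" for x y
  proof -
    have "\<bar>f y - f x\<bar> \<le> (\<Sum>b\<in>B. C b) * norm (y - x) ^ Suc N"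
    proof (rule mvt_span_bound[OF B K(2,3) Suc.prems xy C0])
      fix b z assume "b \<in> B" "z \<in> K" "z - x \<in> span B"
      then show "\<bar>frechet_derivative f (at z) b\<bar> \<le> C b * norm (z - x) ^ N"
        using flat xy by (intro C) auto
    qed auto
    moreover have "f x = 0" using bspec[OF flat, of "[]"] by simp
    ultimately show ?thesis by simp
  qed
  then show ?case using C0 by (intro exI[of _ "\<Sum>b\<in>B. C b"]) (auto intro: sum_nonneg)
qed

text \<open>Cut \<open>A\<close> into about \<open>k ^ DIM('a)\<close> cubes of side \<open>1 / k\<close>; each image has diameter
  \<open>O(k ^ -(DIM('a) + 1))\<close>.\<close>

lemma negligible_holder_image:
  fixes f :: "'a::euclidean_space \<Rightarrow> real"
  assumes A: "bounded A"
    and hol: "\<And>x y. x \<in> A \<Longrightarrow> y \<in> A \<Longrightarrow> \<bar>f y - f x\<bar> \<le> C * norm (y - x) ^ Suc DIM('a)"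
  shows "negligible (f ` A)"
proof -
  let ?D = "DIM('a)"
  obtain M where M: "\<And>x. x \<in> A \<Longrightarrow> norm x \<le> M" using A by (auto simp: bounded_iff)
  \<comment> \<open>\<open>R\<close> is also at least 1, so that \<open>2 k R + 1\<close> is bounded
    by \<open>3 R k\<close> in the cell count.\<close>
  obtain R :: nat where R: "max M 1 \<le> real R" using real_arch_simple by blast
  define C' where "C' = max C 0"
  have hol': "\<bar>f y - f x\<bar> \<le> C' * norm (y - x) ^ Suc ?D" if "x \<in> A" "y \<in> A" for x y
    using hol[OF that] by (smt (verit) C'_def max_def mult_right_mono norm_ge_zero zero_le_power)
  have "C' \<ge> 0" by (simp add: C'_def)
  show ?thesis
  proof (clarsimp simp: negligible_outer_le)
    fix e :: real assume e: "e > 0"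
    \<comment> \<open>At most \<open>(3 R k) ^ D\<close> cells, \<open>D\<close> the dimension, each
      with an image interval of length \<open>2 r\<close>, have total length
      \<open>Q / k\<close>.\<close>
    define Q where "Q = (3 * real R) ^ ?D * (2 * C' * real ?D ^ Suc ?D)"
    obtain k :: nat where "max (Q / e) 1 \<le> real k" using real_arch_simple by blast
    then have k: "Q / e \<le> real k" "real k \<ge> 1" "k > 0" by auto
    \<comment> \<open>The integer index of the cube of side \<open>1 / k\<close> containing
      \<open>x\<close>, as an extensional function so that indices can be counted by
      \<open>PiE\<close>. Below, \<open>a\<close> picks a point of \<open>A\<close> in each occupied
      cube.\<close>
    define \<kappa> where "\<kappa> x = (\<lambda>b\<in>(Basis::'a set). \<lfloor>real k * (x \<bullet> b)\<rfloor>)" for x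
    define r where "r = C' * (real ?D / real k) ^ Suc ?D"
    have r0: "r \<ge> 0" using \<open>C' \<ge> 0\<close> by (simp add: r_def)
    have "\<kappa> ` A \<subseteq> Basis \<rightarrow>\<^sub>E {- int (k * R)..int (k * R)}"
    proof (clarsimp simp: \<kappa>_def PiE_iff, intro conjI)
      fix x and b :: 'a assume "x \<in> A" "b \<in> Basis"
      then have "\<bar>x \<bullet> b\<bar> \<le> real R"
        using M[of x] Basis_le_norm[of b x] R by linarith
      then have "\<bar>real k * (x \<bullet> b)\<bar> \<le> real k * real R"
        by (simp add: abs_mult mult_left_mono)
      then have "- (real k * real R) \<le> real k * (x \<bullet> b)" "real k * (x \<bullet> b) \<le> real k * real R"
        by linarith+
      then show "- (int k * int R) \<le> \<lfloor>real k * (x \<bullet> b)\<rfloor>" "\<lfloor>real k * (x \<bullet> b)\<rfloor> \<le> int k * int R"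
        by (simp_all add: le_floor_iff floor_le_iff)
    qed
    moreover have fin: "finite ((Basis::'a set) \<rightarrow>\<^sub>E {- int (k * R)..int (k * R)})"
      by (intro finite_PiE) auto
    ultimately have fink: "finite (\<kappa> ` A)"
      and "card (\<kappa> ` A) \<le> card ((Basis::'a set) \<rightarrow>\<^sub>E {- int (k * R)..int (k * R)})"
      by (auto intro: finite_subset card_mono)
    then have "card (\<kappa> ` A) \<le> (2 * k * R + 1) ^ ?D"
      by (simp add: card_PiE nat_add_distrib nat_mult_distrib algebra_simps)
    then have "real (card (\<kappa> ` A)) \<le> real ((2 * k * R + 1) ^ ?D)" by (simp only: of_nat_le_iff)
    also have "\<dots> = (2 * real k * real R + 1) ^ ?D" by (simp add: add.commute)
    also have "\<dots> \<le> (3 * real R * real k) ^ ?D"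
    proof (rule power_mono)
      have "1 \<le> real k * real R" using mult_mono[of 1 "real k" 1 "real R"] k R by auto
      then show "2 * real k * real R + 1 \<le> 3 * real R * real k" by (simp add: algebra_simps)
    qed auto
    finally have card: "real (card (\<kappa> ` A)) \<le> (3 * real R * real k) ^ ?D" .
    define a where "a I = (SOME x. x \<in> A \<and> \<kappa> x = I)" for I
    have a: "a (\<kappa> x) \<in> A \<and> \<kappa> (a (\<kappa> x)) = \<kappa> x" if "x \<in> A" for x
      unfolding a_def by (rule someI[of _ x]) (use that in auto)
    define T where "T = (\<Union>I\<in>\<kappa> ` A. {f (a I) - r..f (a I) + r})"
    have "f x \<in> T" if x: "x \<in> A" for x
    proof -
      define y where "y = a (\<kappa> x)"
      have y: "y \<in> A" "\<kappa> y = \<kappa> x" using a[OF x] by (auto simp: y_def)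
      have "norm (x - y) \<le> (\<Sum>b\<in>Basis. \<bar>(x - y) \<bullet> b\<bar>)" by (rule norm_le_l1)
      also have "\<dots> \<le> (\<Sum>b\<in>(Basis::'a set). 1 / real k)"
      proof (rule sum_mono)
        fix b :: 'a assume "b \<in> Basis"
        then have "\<lfloor>real k * (y \<bullet> b)\<rfloor> = \<lfloor>real k * (x \<bullet> b)\<rfloor>"
          using y(2) by (metis \<kappa>_def restrict_apply')
        then have "\<bar>real k * (x \<bullet> b) - real k * (y \<bullet> b)\<bar> \<le> 1" by linarith
        then have "real k * \<bar>(x - y) \<bullet> b\<bar> \<le> 1"
          by (metis abs_mult abs_of_nat inner_diff_left right_diff_distrib)
        then show "\<bar>(x - y) \<bullet> b\<bar> \<le> 1 / real k" using k by (simp add: field_simps)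
      qed
      finally have "norm (x - y) \<le> real ?D / real k" by simp
      then have "C' * norm (x - y) ^ Suc ?D \<le> r"
        unfolding r_def using \<open>C' \<ge> 0\<close> by (intro mult_left_mono power_mono) auto
      then have "\<bar>f x - f y\<bar> \<le> r" using hol'[OF y(1) x] by linarith
      then show ?thesis using x unfolding T_def by (intro UN_I[of "\<kappa> x"]) (auto simp: y_def)
    qed
    then have "f ` A \<subseteq> T" by blast
    moreover have "T \<in> lmeasurable"
      unfolding T_def by (intro fmeasurable.finite_UN fink) auto
    moreover have "measure lebesgue T \<le> e"
    proof -
      have "measure lebesgue T \<le> (\<Sum>I\<in>\<kappa> ` A. measure lebesgue {f (a I) - r..f (a I) + r})"
        unfolding T_def by (rule measure_UNION_le[OF fink]) auto
      also have "\<dots> = real (card (\<kappa> ` A)) * (2 * r)" using r0 by simp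
      also have "\<dots> \<le> (3 * real R * real k) ^ ?D * (2 * r)"
        using card r0 by (intro mult_right_mono) auto
      also have "\<dots> = Q / real k"
        using k by (simp add: Q_def r_def power_mult_distrib power_divide field_simps)
      also have "\<dots> \<le> e" using k e by (simp add: field_simps)
      finally show ?thesis .
    qed
    ultimately show "\<exists>T. f ` A \<subseteq> T \<and> T \<in> lmeasurable \<and> measure lebesgue T \<le> e" by blast
  qed
qed

text \<open>By Lindelof countably many of the neighbourhoods cover \<open>A\<close>, and countable
  unions preserve negligibility.\<close>

lemma negligible_image_local:
  fixes f :: "'a::second_countable_topology \<Rightarrow> 'b::euclidean_space"
  assumes "\<And>x. x \<in> A \<Longrightarrow> \<exists>T. open T \<and> x \<in> T \<and> negligible (f ` (A \<inter> T))"
  shows "negligible (f ` A)"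
proof -
  let ?F = "{T. open T \<and> negligible (f ` (A \<inter> T))}"
  obtain F' where F': "F' \<subseteq> ?F" "countable F'" "\<Union>F' = \<Union>?F"
    using Lindelof[of ?F] by auto
  have "negligible (\<Union>T\<in>F'. f ` (A \<inter> T))"
    using F' by (intro negligible_countable_Union) auto
  moreover have "f ` A \<subseteq> (\<Union>T\<in>F'. f ` (A \<inter> T))"
  proof
    fix y assume "y \<in> f ` A"
    then obtain x where x: "x \<in> A" "y = f x" by blast
    then have "x \<in> \<Union>F'" using assms[OF x(1)] F'(3) by blast
    then show "y \<in> (\<Union>T\<in>F'. f ` (A \<inter> T))" using x by blast
  qed
  ultimately show ?thesis by (rule negligible_subset)
qed


text \<open>The inverse function theorem for \<open>y \<mapsto> y - (y \<bullet> v) v + w y v\<close>, which carries the zero set of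
  \<open>w\<close> into the hyperplane orthogonal to \<open>v\<close> and preserves every subspace that contains \<open>v\<close>.\<close>

lemma straighten_zero_set:
  fixes w :: "'a::euclidean_space \<Rightarrow> real"
  assumes V: "open V" and w: "smooth_on w V" and x0: "x0 \<in> V" and v: "norm v = 1"
    and dw: "frechet_derivative w (at x0) v \<noteq> 0"
  obtains T T' \<Psi> where "open T" "x0 \<in> T" "T \<subseteq> V" "open T'" "smooth_on \<Psi> T'" "\<Psi> ` T' \<subseteq> T"
    "\<And>y. y \<in> T \<Longrightarrow> y - (y \<bullet> v) *\<^sub>R v + w y *\<^sub>R v \<in> T' \<and> \<Psi> (y - (y \<bullet> v) *\<^sub>R v + w y *\<^sub>R v) = y"
    "\<And>z h. z \<in> T' \<Longrightarrow> \<exists>c. frechet_derivative \<Psi> (at z) h = h + c *\<^sub>R v"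
proof -
  have vv: "v \<bullet> v = 1" using v by (simp add: norm_eq_1)
  let ?d = "\<lambda>x. frechet_derivative w (at x)"
  \<comment> \<open>On \<open>U\<close> the derivative along \<open>v\<close> stays nonzero, so the
    differential of the straightening map is invertible at every point and not just at
    \<open>x0\<close>; smoothness of the inverse rests on this.\<close>
  define U where "U = V \<inter> {x \<in> V. ?d x v \<in> - {0}}"
  have U: "open U" "x0 \<in> U" "U \<subseteq> V" and dU: "\<And>x. x \<in> U \<Longrightarrow> ?d x v \<noteq> 0"
    using continuous_open_preimage[OF smooth_on_imp_continuous_on[OF smooth_on_derivative[OF w]] V, of "- {0}" v]
      x0 dw V by (auto simp: U_def Int_def vimage_def)
  have bl: "bounded_linear (?d x)" if "x \<in> U" for x
    using smooth_on_has_derivative[OF w] U(3) that by (meson has_derivative_bounded_linear subsetD)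
  define f where "f y = y - (y \<bullet> v) *\<^sub>R v + w y *\<^sub>R v" for y
  define f' where "f' x = Blinfun (\<lambda>h. h - (h \<bullet> v) *\<^sub>R v + ?d x h *\<^sub>R v)" for x
  \<comment> \<open>\<open>L x\<close> inverts \<open>f' x\<close> explicitly: that differential
    keeps the part orthogonal to \<open>v\<close> and has \<open>v\<close>-component
    \<open>?d x h\<close>, which leaves one scalar equation with coefficient
    \<open>?d x v\<close>.\<close>
  define L where "L x k = (k - (k \<bullet> v) *\<^sub>R v) + ((k \<bullet> v - ?d x (k - (k \<bullet> v) *\<^sub>R v)) / ?d x v) *\<^sub>R v" for x k
  have f'_apply: "blinfun_apply (f' x) = (\<lambda>h. h - (h \<bullet> v) *\<^sub>R v + ?d x h *\<^sub>R v)" if "x \<in> U" for x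
    unfolding f'_def using bl[OF that]
    by (intro bounded_linear_Blinfun_apply bounded_linear_add bounded_linear_sub
        bounded_linear_ident bounded_linear_scaleR_const bounded_linear_inner_left)
  have fL: "blinfun_apply (f' x) (L x k) = k" if "x \<in> U" for x k
  proof -
    interpret d: bounded_linear "?d x" by (rule bl[OF that])
    show ?thesis using dU[OF that]
      by (simp add: f'_apply[OF that] L_def inner_add_left inner_diff_left vv d.add d.scaleR)
  qed
  have Lf: "L x (blinfun_apply (f' x) h) = h" if "x \<in> U" for x h
  proof -
    interpret d: bounded_linear "?d x" by (rule bl[OF that])
    show ?thesis using dU[OF that]
      by (simp add: f'_apply[OF that] L_def inner_add_left inner_diff_left vv d.add d.diff d.scaleR divide_simps)
  qed
  have blL: "bounded_linear (L x0)"
  proof -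
    interpret d: bounded_linear "?d x0" by (rule bl[OF U(2)])
    show ?thesis
      unfolding L_def divide_inverse
      by (intro bounded_linear_add bounded_linear_sub bounded_linear_ident bounded_linear_scaleR_const
          bounded_linear_inner_left bounded_linear_mult_const bounded_linear_compose[OF d.bounded_linear_axioms])
  qed
  have der: "(f has_derivative blinfun_apply (f' x)) (at x)" if "x \<in> U" for x
    unfolding f'_apply[OF that] f_def
    using smooth_on_has_derivative[OF w, of x] U(3) that
    by (auto intro!: derivative_eq_intros)
  have cont: "continuous_on U f'"
  proof (rule continuous_on_blinfun_componentwise)
    fix i :: 'a
    have "continuous_on U (\<lambda>x. i - (i \<bullet> v) *\<^sub>R v + ?d x i *\<^sub>R v)"
      using continuous_on_subset[OF smooth_on_imp_continuous_on[OF smooth_on_derivative[OF w]] U(3)]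
      by (intro continuous_intros)
    then show "continuous_on U (\<lambda>x. blinfun_apply (f' x) i)"
      using f'_apply by (simp cong: continuous_on_cong)
  qed
  have inv: "Blinfun (L x0) o\<^sub>L f' x0 = id_blinfun"
    by (rule blinfun_eqI) (simp add: bounded_linear_Blinfun_apply[OF blL] Lf[OF U(2)])
  obtain T T' \<Psi> g' where T: "open T" "T \<subseteq> U" "x0 \<in> T" "open T'" "homeomorphism T T' f \<Psi>"
    and g': "\<And>y. y \<in> T' \<Longrightarrow> (\<Psi> has_derivative (g' y)) (at y)"
      "\<And>y. y \<in> T' \<Longrightarrow> g' y = inv (blinfun_apply (f' (\<Psi> y)))"
    using inverse_function_theorem[OF U(1) der cont U(2) inv] by metis
  have \<Psi>U: "\<Psi> y \<in> U" if "y \<in> T'" for y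
    using T(2,5) that by (auto simp: homeomorphism_def)
  have g'L: "g' y = L (\<Psi> y)" if "y \<in> T'" for y
    using g'(2)[OF that] inv_unique_comp[of "blinfun_apply (f' (\<Psi> y))" "L (\<Psi> y)"]
    by (auto simp: fun_eq_iff fL Lf \<Psi>U that)
  \<comment> \<open>Bootstrapping: the derivative of \<open>\<Psi>\<close> at \<open>y\<close> is
    \<open>L (\<Psi> y)\<close>, so order \<open>k\<close> of \<open>\<Psi>\<close> gives order
    \<open>k + 1\<close>.\<close>
  have "Ck_on k \<Psi> T'" for k
  proof (induction k)
    case 0
    then show ?case using T(5) by (auto simp: homeomorphism_def)
  next
    case (Suc k)
    have comp: "Ck_on k (\<lambda>y. ?d (\<Psi> y) h) T'" for h
      using smooth_on_derivative[OF w, of h] \<Psi>U U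
      by (intro Ck_on_compose[OF T(4) U(1) _ Suc]) (auto simp: smooth_on_def intro: Ck_on_subset)
    have "Ck_on k (\<lambda>y. L (\<Psi> y) h) T'" for h
    proof -
      have "Ck_on k (\<lambda>y. (h - (h \<bullet> v) *\<^sub>R v) + ((h \<bullet> v + (- 1) *\<^sub>R ?d (\<Psi> y) (h - (h \<bullet> v) *\<^sub>R v)) *\<^sub>R inverse (?d (\<Psi> y) v)) *\<^sub>R v) T'"
        using dU \<Psi>U by (intro Ck_on_add[OF T(4)] Ck_on_scaleR[OF T(4)] Ck_on_const comp Ck_on_inverse[OF T(4)]) auto
      then show ?thesis by (simp add: L_def divide_inverse)
    qed
    then show ?case
      using g'(1) g'L by (intro Ck_on_SucI[OF T(4), of _ "\<lambda>y. L (\<Psi> y)"]) auto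
  qed
  then have smooth: "smooth_on \<Psi> T'" by (simp add: smooth_on_def)
  have "\<exists>c. frechet_derivative \<Psi> (at z) h = h + c *\<^sub>R v" if "z \<in> T'" for z h
  proof -
    have "frechet_derivative \<Psi> (at z) = L (\<Psi> z)"
      using g'(1) g'L that frechet_derivative_at by metis
    then have "frechet_derivative \<Psi> (at z) h =
        h + ((h \<bullet> v - ?d (\<Psi> z) (h - (h \<bullet> v) *\<^sub>R v)) / ?d (\<Psi> z) v - h \<bullet> v) *\<^sub>R v"
      by (simp add: L_def algebra_simps)
    then show ?thesis by blast
  qed
  moreover have "y - (y \<bullet> v) *\<^sub>R v + w y *\<^sub>R v \<in> T' \<and> \<Psi> (y - (y \<bullet> v) *\<^sub>R v + w y *\<^sub>R v) = y" if "y \<in> T" for y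
    using T(5) that by (auto simp: homeomorphism_def f_def)
  moreover have "\<Psi> ` T' \<subseteq> T" using T(5) by (auto simp: homeomorphism_def)
  ultimately show ?thesis
    using that[OF T(1,3) _ T(4) smooth] T(2) U(3) by (metis subset_trans)
qed

text \<open>Induction on \<open>dim S\<close>. Where all iterated derivatives along \<open>S\<close> vanish, a Taylor estimate and
  \<open>negligible_holder_image\<close> apply. Any other critical point is a zero of some iterated derivative
  whose differential does not vanish on \<open>S\<close>; straightening its zero set lowers the dimension.\<close>

lemma sard_subspace:
  fixes f :: "'a::euclidean_space \<Rightarrow> real"
  assumes "subspace S" "open V" "smooth_on f V"
  shows "negligible (f ` {x \<in> V \<inter> S. \<forall>h\<in>S. frechet_derivative f (at x) h = 0})"
  using assms
proof (induction "dim S" arbitrary: S V f rule: less_induct)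
  case less
  note S = less.prems(1) and V = less.prems(2) and f = less.prems(3)
  obtain B where B: "B \<subseteq> S" "pairwise orthogonal B" "\<And>b. b \<in> B \<Longrightarrow> norm b = 1"
    "independent B" "span B = S"
    using orthonormal_basis_subspace[OF S] by metis
  have finB: "finite B" using B(4) by (rule independent_imp_finite)
  define A where "A = {x \<in> V \<inter> S. \<forall>h\<in>S. frechet_derivative f (at x) h = 0}"
  \<comment> \<open>The empty word is left out, since the critical value itself need not be
    0.\<close>
  define F where "F = {x \<in> A. \<forall>vs\<in>lists B. vs \<noteq> [] \<longrightarrow> iter_deriv vs f x = 0}"
  define P where "P vs v = {x \<in> A. iter_deriv vs f x = 0 \<and> iter_deriv (v # vs) f x \<noteq> 0}" for vs v
  have F: "negligible (f ` F)"
  proof (rule negligible_image_local)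
    fix x assume "x \<in> F"
    then have "x \<in> V" by (simp add: F_def A_def)
    then obtain r where r: "r > 0" "cball x r \<subseteq> V" using V open_contains_cball by blast
    \<comment> \<open>Flatness is applied to the partial derivatives because \<open>f\<close> need
      not vanish on \<open>F\<close>; one more mean value step raises the order to the exponent
      \<open>Suc DIM('a)\<close> required by \<open>negligible_holder_image\<close>.\<close>
    let ?N = "DIM('a)"
    have "\<exists>C\<ge>0. \<forall>y\<in>cball x r. \<forall>z\<in>cball x r. z - y \<in> span B \<longrightarrow>
      (\<forall>vs\<in>lists B. length vs < ?N \<longrightarrow> iter_deriv (vs @ [b]) f y = 0) \<longrightarrow>
       \<bar>frechet_derivative f (at z) b\<bar> \<le> C * norm (z - y) ^ ?N" for b
      unfolding iter_deriv_snoc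
      by (rule flat_function_bound[OF finB B(2,3) compact_cball convex_cball r(2) smooth_on_derivative[OF f]])
    then obtain C where C0: "\<And>b. C b \<ge> 0" and C: "\<And>b y z. y \<in> cball x r \<Longrightarrow> z \<in> cball x r \<Longrightarrow> z - y \<in> span B \<Longrightarrow>
      (\<forall>vs\<in>lists B. length vs < ?N \<longrightarrow> iter_deriv (vs @ [b]) f y = 0) \<Longrightarrow>
       \<bar>frechet_derivative f (at z) b\<bar> \<le> C b * norm (z - y) ^ ?N"
      by metis
    have "negligible (f ` (F \<inter> ball x r))"
    proof (rule negligible_holder_image)
      show "bounded (F \<inter> ball x r)" using bounded_ball bounded_subset by blast
      fix y z assume yz: "y \<in> F \<inter> ball x r" "z \<in> F \<inter> ball x r"
      show "\<bar>f z - f y\<bar> \<le> sum C B * norm (z - y) ^ Suc ?N"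
      proof (rule mvt_span_bound[OF finB B(2,3) convex_cball r(2) f])
        show "z - y \<in> span B" using yz S unfolding B(5) by (auto simp: F_def A_def intro: subspace_diff)
        fix b u assume "b \<in> B" "u \<in> cball x r" "u - y \<in> span B"
        then show "\<bar>frechet_derivative f (at u) b\<bar> \<le> C b * norm (u - y) ^ ?N"
          using yz by (intro C) (auto simp: F_def)
      qed (use yz C0 in auto)
    qed
    then show "\<exists>T. open T \<and> x \<in> T \<and> negligible (f ` (F \<inter> T))"
      using r(1) by (intro exI[of _ "ball x r"]) auto
  qed
  have P: "negligible (f ` P vs v)" if vB: "v \<in> B" for vs v
  proof (rule negligible_image_local)
    fix x0 assume x0: "x0 \<in> P vs v"
    let ?w = "iter_deriv vs f"
    have x0V: "x0 \<in> V" and dw: "frechet_derivative ?w (at x0) v \<noteq> 0"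
      using x0 by (auto simp: P_def A_def)
    obtain T T' \<Psi> where T: "open T" "x0 \<in> T" "T \<subseteq> V" "open T'" "smooth_on \<Psi> T'" "\<Psi> ` T' \<subseteq> T"
      and \<Psi>: "\<And>y. y \<in> T \<Longrightarrow> y - (y \<bullet> v) *\<^sub>R v + ?w y *\<^sub>R v \<in> T' \<and> \<Psi> (y - (y \<bullet> v) *\<^sub>R v + ?w y *\<^sub>R v) = y"
      and d\<Psi>: "\<And>z h. z \<in> T' \<Longrightarrow> \<exists>c. frechet_derivative \<Psi> (at z) h = h + c *\<^sub>R v"
      using straighten_zero_set[OF V smooth_on_iter_deriv[OF f] x0V B(3)[OF vB] dw] by metis
    define S' where "S' = S \<inter> {y. v \<bullet> y = 0}"
    have vS: "v \<in> S" using vB B(1) by blast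
    have vv: "v \<bullet> v = 1" using B(3)[OF vB] by (simp add: norm_eq_1)
    have S': "subspace S'" unfolding S'_def by (intro subspace_inter S subspace_hyperplane)
    have "S' \<subset> S" using vS vv unfolding S'_def by (metis (mono_tags, lifting) Int_iff inf.cobounded1 mem_Collect_eq psubsetI zero_neq_one)
    then have dim: "dim S' < dim S" using S S' by (intro dim_psubset) (metis span_eq_iff)
    have fs: "smooth_on (\<lambda>z. f (\<Psi> z)) T'"
      using T f by (intro smooth_on_compose[OF T(4) V _ T(5) f]) auto
    have neg: "negligible ((\<lambda>z. f (\<Psi> z)) ` {z \<in> T' \<inter> S'. \<forall>h\<in>S'. frechet_derivative (\<lambda>z. f (\<Psi> z)) (at z) h = 0})"
      by (rule less.hyps[OF dim S' T(4) fs])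
    have "f ` (P vs v \<inter> T) \<subseteq> (\<lambda>z. f (\<Psi> z)) ` {z \<in> T' \<inter> S'. \<forall>h\<in>S'. frechet_derivative (\<lambda>z. f (\<Psi> z)) (at z) h = 0}"
    proof clarify
      fix y assume y: "y \<in> P vs v" "y \<in> T"
      \<comment> \<open>At a zero of \<open>?w\<close> the straightening map is the orthogonal
        projection along \<open>v\<close>, so it sends \<open>y\<close> into
        \<open>S'\<close>.\<close>
      define z where "z = y - (y \<bullet> v) *\<^sub>R v"
      have z: "z \<in> T'" "\<Psi> z = y" using \<Psi>[OF y(2)] y(1) by (auto simp: z_def P_def)
      have yS: "y \<in> S" and crit: "\<And>h. h \<in> S \<Longrightarrow> frechet_derivative f (at y) h = 0"
        using y(1) by (auto simp: P_def A_def)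
      have "z \<in> S'" using yS vS S
        by (auto simp: S'_def z_def inner_diff_right vv inner_commute intro: subspace_diff subspace_scale)
      \<comment> \<open>The differential of \<open>\<Psi>\<close> changes \<open>h\<close> only by a
        multiple of \<open>v\<close>, hence keeps it in \<open>S\<close>, which the differential of
        \<open>f\<close> at \<open>y\<close> annihilates.\<close>
      moreover have "frechet_derivative (\<lambda>z. f (\<Psi> z)) (at z) h = 0" if "h \<in> S'" for h
      proof -
        have "((\<lambda>z. f (\<Psi> z)) has_derivative (\<lambda>h. frechet_derivative f (at (\<Psi> z)) (frechet_derivative \<Psi> (at z) h))) (at z)"
          using smooth_on_has_derivative[OF T(5) z(1)] smooth_on_has_derivative[OF f, of "\<Psi> z"] z y(2) T(3)
          by (intro has_derivative_compose[of \<Psi> _ z UNIV f]) auto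
        then have "frechet_derivative (\<lambda>z. f (\<Psi> z)) (at z) h = frechet_derivative f (at y) (frechet_derivative \<Psi> (at z) h)"
          using frechet_derivative_at z(2) by metis
        moreover obtain c where "frechet_derivative \<Psi> (at z) h = h + c *\<^sub>R v"
          using d\<Psi>[OF z(1)] by blast
        moreover have "h + c *\<^sub>R v \<in> S"
          using that vS S by (auto simp: S'_def intro: subspace_add subspace_scale)
        ultimately show ?thesis using crit by simp
      qed
      ultimately show "f y \<in> (\<lambda>z. f (\<Psi> z)) ` {z \<in> T' \<inter> S'. \<forall>h\<in>S'. frechet_derivative (\<lambda>z. f (\<Psi> z)) (at z) h = 0}"
        using z by (intro image_eqI[of _ _ z]) auto
    qed
    then have "negligible (f ` (P vs v \<inter> T))" by (rule negligible_subset[OF neg])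
    then show "\<exists>T. open T \<and> x0 \<in> T \<and> negligible (f ` (P vs v \<inter> T))" using T by blast
  qed
  have "A \<subseteq> F \<union> (\<Union>vs\<in>lists B. \<Union>v\<in>B. P vs v)"
  proof
    fix x assume x: "x \<in> A"
    show "x \<in> F \<union> (\<Union>vs\<in>lists B. \<Union>v\<in>B. P vs v)"
    proof (rule ccontr)
      assume *: "x \<notin> F \<union> (\<Union>vs\<in>lists B. \<Union>v\<in>B. P vs v)"
      \<comment> \<open>Words grow by one letter at a time: those of length 1 vanish by criticality,
        and a first nonvanishing word \<open>v # vs\<close> would put \<open>x\<close> into
        \<open>P vs v\<close>.\<close>
      have "iter_deriv ws f x = 0" if "ws \<in> lists B" "ws \<noteq> []" for ws
        using that
      proof (induction ws rule: list.induct)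
        case (Cons v vs)
        show ?case
        proof (cases "vs = []")
          case True
          have "v \<in> S" using Cons.prems(1) B(1) by auto
          then show ?thesis using x True by (simp add: A_def)
        next
          case False
          then have "iter_deriv vs f x = 0" using Cons by auto
          moreover have "x \<notin> P vs v" using * Cons.prems by auto
          ultimately show ?thesis using x by (auto simp: P_def)
        qed
      qed auto
      then show False using * x by (auto simp: F_def)
    qed
  qed
  then have "f ` A \<subseteq> f ` (F \<union> (\<Union>vs\<in>lists B. \<Union>v\<in>B. P vs v))"
    by (rule image_mono)
  then have "f ` A \<subseteq> f ` F \<union> (\<Union>vs\<in>lists B. \<Union>v\<in>B. f ` P vs v)"
    by (simp only: image_Un image_UN)
  moreover have "negligible (\<Union>vs\<in>lists B. \<Union>v\<in>B. f ` P vs v)"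
  proof (rule negligible_countable_Union)
    show "countable ((\<lambda>vs. \<Union>v\<in>B. f ` P vs v) ` lists B)"
      by (intro countable_image countable_lists countable_finite finB)
    fix N assume "N \<in> (\<lambda>vs. \<Union>v\<in>B. f ` P vs v) ` lists B"
    then obtain vs where N: "N = (\<Union>v\<in>B. f ` P vs v)" by blast
    show "negligible N" unfolding N
      by (rule negligible_Union) (use finB P in auto)
  qed
  then have "negligible (f ` F \<union> (\<Union>vs\<in>lists B. \<Union>v\<in>B. f ` P vs v))"
    by (rule negligible_Un[OF F])
  ultimately show ?case unfolding A_def by (rule negligible_subset[rotated])
qed

lemma sard_real:
  fixes f :: "'a::euclidean_space \<Rightarrow> real"
  assumes "open V" "smooth_on f V"
  shows "negligible (f ` {x \<in> V. \<forall>h. frechet_derivative f (at x) h = 0})"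
  using sard_subspace[OF subspace_UNIV assms] by simp

section \<open>Smooth functions, tangent vectors and vector fields\<close>


locale smooth_mfd =
  fixes G :: "('a, 'n::finite) riem"
  assumes smooth_mfd: "smooth_manifold G"
begin

section \<open>Charts and their topology\<close>

abbreviation "op U \<equiv> openin (topol G) U"

lemma op_chart: "c \<in> atlas G \<Longrightarrow> op (fst c)"
  using smooth_mfd by (auto simp: smooth_manifold_def)

lemma ex_chart: "p \<in> points G \<Longrightarrow> \<exists>c\<in>atlas G. p \<in> fst c"
  using smooth_mfd by (auto simp: smooth_manifold_def)

lemma chart_points: "c \<in> atlas G \<Longrightarrow> p \<in> fst c \<Longrightarrow> p \<in> points G"
  using openin_subset[OF op_chart] by blast

lemma chart_homeo: "c \<in> atlas G \<Longrightarrow>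
    homeomorphic_map (subtopology (topol G) (fst c)) (top_of_set (snd c ` fst c)) (snd c)"
  using smooth_mfd by (auto simp: smooth_manifold_def)

lemma topspace_chart: "c \<in> atlas G \<Longrightarrow> topspace (subtopology (topol G) (fst c)) = fst c"
  by (metis inf.absorb2 op_chart openin_subset topspace_subtopology)

lemma chart_inj: "c \<in> atlas G \<Longrightarrow> inj_on (snd c) (fst c)"
  using chart_homeo topspace_chart homeomorphic_imp_injective_map by metis

lemma chart_inv_chart [simp]: "c \<in> atlas G \<Longrightarrow> p \<in> fst c \<Longrightarrow> chart_inv c (snd c p) = p"
  by (simp add: chart_inv_def chart_inj)

lemma open_chart_image:
  assumes "c \<in> atlas G" "op U"
  shows "open (snd c ` (U \<inter> fst c))"
proof -
  have "openin (subtopology (topol G) (fst c)) (U \<inter> fst c)"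
    using assms(2) openin_subtopology by blast
  then have "openin (top_of_set (snd c ` fst c)) (snd c ` (U \<inter> fst c))"
    using homeomorphic_imp_open_map[OF chart_homeo[OF assms(1)]] by (auto simp: open_map_def)
  moreover have "open (snd c ` fst c)"
    using smooth_mfd assms(1) by (auto simp: smooth_manifold_def)
  ultimately show ?thesis using openin_open_trans by blast
qed

lemma open_chart_image': "c \<in> atlas G \<Longrightarrow> op U \<Longrightarrow> U \<subseteq> fst c \<Longrightarrow> open (snd c ` U)"
  using open_chart_image[of c U] by (simp add: Int_absorb2)

lemma op_chart_preimage:
  assumes "c \<in> atlas G" "open W"
  shows "op {p \<in> fst c. snd c p \<in> W}"
proof -
  have "continuous_map (subtopology (topol G) (fst c)) (top_of_set (snd c ` fst c)) (snd c)"
    using chart_homeo[OF assms(1)] homeomorphic_imp_continuous_map by blast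
  moreover have "openin (top_of_set (snd c ` fst c)) (snd c ` fst c \<inter> W)"
    using assms(2) by (simp add: openin_open_Int)
  ultimately have "openin (subtopology (topol G) (fst c))
      {p \<in> topspace (subtopology (topol G) (fst c)). snd c p \<in> snd c ` fst c \<inter> W}"
    by (rule openin_continuous_map_preimage)
  moreover have "{p \<in> fst c. snd c p \<in> snd c ` fst c \<inter> W} = {p \<in> fst c. snd c p \<in> W}" by auto
  ultimately have "openin (subtopology (topol G) (fst c)) {p \<in> fst c. snd c p \<in> W}"
    unfolding topspace_chart[OF assms(1)] by simp
  then show ?thesis using op_chart[OF assms(1)] by (rule openin_trans_full)
qed

lemma transition_smooth:
  "c \<in> atlas G \<Longrightarrow> d \<in> atlas G \<Longrightarrow> smooth_on (snd d \<circ> chart_inv c) (snd c ` (fst c \<inter> fst d))"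
  using smooth_mfd by (auto simp: smooth_manifold_def)

section \<open>Smooth functions on open subsets\<close>

lemma smooth_fun_op: "smooth_fun G U u \<Longrightarrow> op U"
  by (simp add: smooth_fun_def)

lemma smooth_fun_chart:
  "smooth_fun G U u \<Longrightarrow> c \<in> atlas G \<Longrightarrow> smooth_on (u \<circ> chart_inv c) (snd c ` (U \<inter> fst c))"
  by (simp add: smooth_fun_def)

text \<open>Any other chart representation differs from the one in \<open>c\<close> by a smooth
  transition map.\<close>

lemma smooth_fun_chartI:
  assumes c: "c \<in> atlas G" and U: "op U" "U \<subseteq> fst c"
    and u: "smooth_on (u \<circ> chart_inv c) (snd c ` U)"
  shows "smooth_fun G U u"
  unfolding smooth_fun_def
proof (intro conjI ballI U)
  fix d assume d: "d \<in> atlas G"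
  have S: "open (snd d ` (U \<inter> fst d))" by (rule open_chart_image[OF d U(1)])
  have "smooth_on (\<lambda>x. (u \<circ> chart_inv c) ((snd c \<circ> chart_inv d) x)) (snd d ` (U \<inter> fst d))"
  proof (rule smooth_on_compose[OF S open_chart_image'[OF c U] _ _ u])
    show "(snd c \<circ> chart_inv d) ` snd d ` (U \<inter> fst d) \<subseteq> snd c ` U"
      using d by auto
    show "smooth_on (snd c \<circ> chart_inv d) (snd d ` (U \<inter> fst d))"
      using transition_smooth[OF d c] U(2) by (elim smooth_on_subset) auto
  qed
  then show "smooth_on (u \<circ> chart_inv d) (snd d ` (U \<inter> fst d))"
    by (rule smooth_on_cong[OF S, rotated]) (use U(2) c d in auto)
qed

lemma smooth_fun_subset: "smooth_fun G U u \<Longrightarrow> op V \<Longrightarrow> V \<subseteq> U \<Longrightarrow> smooth_fun G V u"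
  unfolding smooth_fun_def by (meson Int_mono image_mono order_refl smooth_on_subset)

lemma smooth_fun_cong:
  assumes "smooth_fun G U u" "\<And>p. p \<in> U \<Longrightarrow> u p = w p"
  shows "smooth_fun G U w"
  unfolding smooth_fun_def
proof (intro conjI ballI)
  show U: "op U" using assms(1) by (rule smooth_fun_op)
  fix c assume c: "c \<in> atlas G"
  show "smooth_on (w \<circ> chart_inv c) (snd c ` (U \<inter> fst c))"
    by (rule smooth_on_cong[OF open_chart_image[OF c U] _ smooth_fun_chart[OF assms(1) c]])
       (use c assms(2) in auto)
qed

lemma smooth_fun_local:
  assumes "op U" "\<And>p. p \<in> U \<Longrightarrow> \<exists>V. p \<in> V \<and> smooth_fun G V u"
  shows "smooth_fun G U u"
  unfolding smooth_fun_def
proof (intro conjI ballI assms(1))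
  fix c assume c: "c \<in> atlas G"
  show "smooth_on (u \<circ> chart_inv c) (snd c ` (U \<inter> fst c))"
  proof (rule smooth_on_local)
    fix x assume "x \<in> snd c ` (U \<inter> fst c)"
    then obtain p where p: "p \<in> U" "p \<in> fst c" "x = snd c p" by auto
    obtain V where V: "p \<in> V" "smooth_fun G V u" using assms(2) p(1) by blast
    then show "\<exists>T. open T \<and> x \<in> T \<and> smooth_on (u \<circ> chart_inv c) T"
      using open_chart_image[OF c smooth_fun_op[OF V(2)]] smooth_fun_chart[OF V(2) c] p
      by (intro exI[of _ "snd c ` (V \<inter> fst c)"]) auto
  qed
qed

lemma smooth_fun_const: "op U \<Longrightarrow> smooth_fun G U (\<lambda>p. k)"
  by (simp add: smooth_fun_def comp_def smooth_on_const)

lemma smooth_fun_add: "smooth_fun G U u \<Longrightarrow> smooth_fun G U w \<Longrightarrow> smooth_fun G U (\<lambda>p. u p + w p)"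
  unfolding smooth_fun_def comp_def using smooth_on_add open_chart_image by blast

lemma smooth_fun_mult: "smooth_fun G U u \<Longrightarrow> smooth_fun G U w \<Longrightarrow> smooth_fun G U (\<lambda>p. u p * w p)"
  unfolding smooth_fun_def comp_def using smooth_on_mult open_chart_image by blast

lemma smooth_fun_diff:
  assumes "smooth_fun G U u" "smooth_fun G U w" shows "smooth_fun G U (\<lambda>p. u p - w p)"
  using smooth_fun_add[OF assms(1) smooth_fun_mult[OF smooth_fun_const[of U "-1"] assms(2)]] assms(1)
  by (simp add: smooth_fun_op)

lemma smooth_fun_inverse:
  assumes "smooth_fun G U u" "\<And>p. p \<in> U \<Longrightarrow> u p \<noteq> 0"
  shows "smooth_fun G U (\<lambda>p. inverse (u p))"
  unfolding smooth_fun_def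
proof (intro conjI ballI)
  show U: "op U" using assms(1) by (rule smooth_fun_op)
  fix c assume c: "c \<in> atlas G"
  have "smooth_on (\<lambda>x. inverse ((u \<circ> chart_inv c) x)) (snd c ` (U \<inter> fst c))"
    by (rule smooth_on_inverse[OF open_chart_image[OF c U] smooth_fun_chart[OF assms(1) c]])
       (use c assms(2) in auto)
  then show "smooth_on ((\<lambda>p. inverse (u p)) \<circ> chart_inv c) (snd c ` (U \<inter> fst c))"
    by (simp add: comp_def)
qed

lemma smooth_fun_divide:
  "smooth_fun G U u \<Longrightarrow> smooth_fun G U w \<Longrightarrow> (\<And>p. p \<in> U \<Longrightarrow> w p \<noteq> 0) \<Longrightarrow> smooth_fun G U (\<lambda>p. u p / w p)"
  unfolding divide_inverse by (intro smooth_fun_mult smooth_fun_inverse)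

lemma smooth_fun_sum:
  "op U \<Longrightarrow> (\<And>i. i \<in> I \<Longrightarrow> smooth_fun G U (u i)) \<Longrightarrow> smooth_fun G U (\<lambda>p. \<Sum>i\<in>I. u i p)"
  by (induction I rule: infinite_finite_induct) (auto intro: smooth_fun_const smooth_fun_add)

lemma smooth_fun_prod:
  "op U \<Longrightarrow> (\<And>i. i \<in> I \<Longrightarrow> smooth_fun G U (u i)) \<Longrightarrow> smooth_fun G U (\<lambda>p. \<Prod>i\<in>I. u i p)"
  by (induction I rule: infinite_finite_induct) (auto intro: smooth_fun_const smooth_fun_mult)

text \<open>Serves the Cramer quotients in \<open>sharp_coords\<close>.\<close>

lemma smooth_fun_det:
  "op U \<Longrightarrow> (\<And>i j. smooth_fun G U (\<lambda>p. A p $ i $ j)) \<Longrightarrow> smooth_fun G U (\<lambda>p. det (A p :: real ^ 'k::finite ^ 'k))"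
  unfolding det_def by (intro smooth_fun_sum smooth_fun_mult smooth_fun_prod smooth_fun_const)

lemma smooth_nearI: "smooth_fun G U u \<Longrightarrow> p \<in> U \<Longrightarrow> smooth_near G p u"
  by (auto simp: smooth_near_def)

lemma smooth_near_subset:
  assumes "smooth_near G p u" "op V" "p \<in> V"
  obtains U where "p \<in> U" "U \<subseteq> V" "smooth_fun G U u"
proof -
  obtain U where U: "p \<in> U" "smooth_fun G U u" using assms(1) by (auto simp: smooth_near_def)
  show ?thesis
    using U assms smooth_fun_op[OF U(2)] smooth_fun_subset[OF U(2), of "U \<inter> V"]
    by (intro that[of "U \<inter> V"]) (auto intro: openin_Int)
qed

lemma smooth_near_cong:
  assumes "smooth_near G p u" "op V" "p \<in> V" "\<And>q. q \<in> V \<Longrightarrow> u q = w q"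
  shows "smooth_near G p w"
proof -
  obtain U where "p \<in> U" "U \<subseteq> V" "smooth_fun G U u"
    using smooth_near_subset[OF assms(1-3)] .
  then show ?thesis using smooth_fun_cong[of U u w] assms(4) smooth_nearI by blast
qed

section \<open>Tangent vectors as derivations\<close>

lemma chart_differentiable:
  assumes "c \<in> atlas G" "p \<in> fst c" "smooth_near G p u"
  shows "(u \<circ> chart_inv c) differentiable (at (snd c p))"
  using assms smooth_fun_chart[OF _ assms(1)] smooth_on_differentiable
  unfolding smooth_near_def by blast

lemma chart_has_derivative:
  assumes "c \<in> atlas G" "p \<in> fst c" "smooth_near G p u"
  shows "(u \<circ> chart_inv c has_derivative frechet_derivative (u \<circ> chart_inv c) (at (snd c p))) (at (snd c p))"
  using chart_differentiable[OF assms] frechet_derivative_works by blast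

lemma chart_deriv_apply:
  "smooth_near G p u \<Longrightarrow> chart_deriv G c a p u = frechet_derivative (u \<circ> chart_inv c) (at (snd c p)) a"
  by (simp add: chart_deriv_def)

lemma tangent_not_smooth: "v \<in> tangent G p \<Longrightarrow> \<not> smooth_near G p u \<Longrightarrow> v u = 0"
  by (auto simp: tangent_def chart_deriv_def)

text \<open>Smoothness near \<open>p\<close> is itself a local property, so either both functions
  receive the default value 0 or both are genuinely differentiated.\<close>

lemma tangent_cong:
  assumes v: "v \<in> tangent G p" and V: "op V" "p \<in> V" "\<And>q. q \<in> V \<Longrightarrow> u q = w q"
  shows "v u = v w"
proof -
  have iff: "smooth_near G p u \<longleftrightarrow> smooth_near G p w"
    using smooth_near_cong V by metis
  obtain c a where c: "c \<in> atlas G" "p \<in> fst c" "v = chart_deriv G c a p"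
    using v by (auto simp: tangent_def)
  show ?thesis
  proof (cases "smooth_near G p u")
    case True
    have "frechet_derivative (u \<circ> chart_inv c) (at (snd c p)) = frechet_derivative (w \<circ> chart_inv c) (at (snd c p))"
      by (rule frechet_derivative_transform_within_open[OF chart_differentiable[OF c(1,2) True] open_chart_image[OF c(1) V(1)]])
         (use c V in auto)
    then show ?thesis using True iff c by (simp add: chart_deriv_apply)
  next
    case False
    then show ?thesis using iff tangent_not_smooth[OF v] by metis
  qed
qed

lemma tangent_const: "v \<in> tangent G p \<Longrightarrow> v (\<lambda>q. k) = 0"
  by (auto simp: tangent_def chart_deriv_def comp_def)

lemma smooth_near_common:
  assumes "smooth_near G p u" "smooth_near G p w"
  obtains U where "p \<in> U" "smooth_fun G U u" "smooth_fun G U w"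
proof -
  obtain U where U: "p \<in> U" "smooth_fun G U u" using assms(1) by (auto simp: smooth_near_def)
  obtain V where V: "p \<in> V" "V \<subseteq> U" "smooth_fun G V w"
    using smooth_near_subset[OF assms(2) smooth_fun_op[OF U(2)] U(1)] .
  show ?thesis
    using that[OF V(1) smooth_fun_subset[OF U(2) smooth_fun_op[OF V(3)] V(2)] V(3)] .
qed

lemma smooth_near_add:
  assumes "smooth_near G p u" "smooth_near G p w" shows "smooth_near G p (\<lambda>q. u q + w q)"
  using smooth_near_common[OF assms] smooth_fun_add smooth_nearI by metis

lemma smooth_near_mult:
  assumes "smooth_near G p u" "smooth_near G p w" shows "smooth_near G p (\<lambda>q. u q * w q)"
  using smooth_near_common[OF assms] smooth_fun_mult smooth_nearI by metis

lemma smooth_near_diff: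
  assumes "smooth_near G p u" "smooth_near G p w" shows "smooth_near G p (\<lambda>q. u q - w q)"
  using smooth_near_common[OF assms] smooth_fun_diff smooth_nearI by metis

lemma tangent_add:
  assumes "v \<in> tangent G p" "smooth_near G p u" "smooth_near G p w"
  shows "v (\<lambda>q. u q + w q) = v u + v w"
proof -
  obtain c a where c: "c \<in> atlas G" "p \<in> fst c" "v = chart_deriv G c a p"
    using assms(1) by (auto simp: tangent_def)
  let ?u' = "frechet_derivative (u \<circ> chart_inv c) (at (snd c p))"
  let ?w' = "frechet_derivative (w \<circ> chart_inv c) (at (snd c p))"
  have "((\<lambda>x. (u \<circ> chart_inv c) x + (w \<circ> chart_inv c) x) has_derivative (\<lambda>h. ?u' h + ?w' h)) (at (snd c p))"
    by (intro has_derivative_add chart_has_derivative c(1,2) assms(2,3))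
  then have "frechet_derivative ((\<lambda>q. u q + w q) \<circ> chart_inv c) (at (snd c p)) = (\<lambda>h. ?u' h + ?w' h)"
    unfolding comp_def by (rule frechet_derivative_at[symmetric])
  then show ?thesis
    using c(3) assms(2,3) smooth_near_add[OF assms(2,3)] by (simp add: chart_deriv_apply)
qed

lemma smooth_near_const: "p \<in> points G \<Longrightarrow> smooth_near G p (\<lambda>q. k)"
  using smooth_fun_const smooth_nearI by blast

lemma tangent_mult:
  assumes "v \<in> tangent G p" "smooth_near G p u" "smooth_near G p w"
  shows "v (\<lambda>q. u q * w q) = v u * w p + u p * v w"
proof -
  obtain c a where c: "c \<in> atlas G" "p \<in> fst c" "v = chart_deriv G c a p"
    using assms(1) by (auto simp: tangent_def)
  let ?u' = "frechet_derivative (u \<circ> chart_inv c) (at (snd c p))"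
  let ?w' = "frechet_derivative (w \<circ> chart_inv c) (at (snd c p))"
  have "((\<lambda>x. (u \<circ> chart_inv c) x * (w \<circ> chart_inv c) x) has_derivative
    (\<lambda>h. (u \<circ> chart_inv c) (snd c p) * ?w' h + ?u' h * (w \<circ> chart_inv c) (snd c p))) (at (snd c p))"
    by (intro has_derivative_mult chart_has_derivative c(1,2) assms(2,3))
  then have "frechet_derivative ((\<lambda>q. u q * w q) \<circ> chart_inv c) (at (snd c p)) =
    (\<lambda>h. (u \<circ> chart_inv c) (snd c p) * ?w' h + ?u' h * (w \<circ> chart_inv c) (snd c p))"
    unfolding comp_def by (rule frechet_derivative_at[symmetric])
  then show ?thesis
    using c assms(2,3) smooth_near_mult[OF assms(2,3)] by (simp add: chart_deriv_apply)
qed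

lemma tangent_points: "v \<in> tangent G p \<Longrightarrow> p \<in> points G"
  using chart_points by (auto simp: tangent_def)

lemma tangent_cmult: "v \<in> tangent G p \<Longrightarrow> smooth_near G p u \<Longrightarrow> v (\<lambda>q. k * u q) = k * v u"
  using tangent_mult[of v p "\<lambda>q. k" u] smooth_near_const tangent_points by (simp add: tangent_const)

lemma tangent_diff:
  assumes "v \<in> tangent G p" "smooth_near G p u" "smooth_near G p w"
  shows "v (\<lambda>q. u q - w q) = v u - v w"
  using tangent_add[OF assms(1) smooth_near_diff[OF assms(2,3)] assms(3)] by simp

text \<open>Chain rule through the transition map. Because of it a single chart around
  \<open>p\<close> yields all of \<open>tangent G p\<close>, although that set is a union over
  charts.\<close>

lemma chart_deriv_change:
  assumes c: "c \<in> atlas G" "p \<in> fst c" and d: "d \<in> atlas G" "p \<in> fst d"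
  shows "chart_deriv G d b p = chart_deriv G c (frechet_derivative (snd c \<circ> chart_inv d) (at (snd d p)) b) p"
proof
  fix u
  let ?t = "snd c \<circ> chart_inv d"
  show "chart_deriv G d b p u = chart_deriv G c (frechet_derivative ?t (at (snd d p)) b) p u"
  proof (cases "smooth_near G p u")
    case True
    let ?S = "snd d ` (fst c \<inter> fst d)"
    have t: "?t differentiable (at (snd d p))"
      using smooth_on_differentiable[OF transition_smooth[OF d(1) c(1)]] c d by auto
    have u: "(u \<circ> chart_inv c) differentiable (at (?t (snd d p)))"
      using chart_differentiable[OF c True] c d by simp
    have S: "open ?S" "snd d p \<in> ?S"
      using open_chart_image[OF d(1) op_chart[OF c(1)]] c d by auto
    have eq: "(u \<circ> chart_inv d) x = ((u \<circ> chart_inv c) \<circ> ?t) x" if "x \<in> ?S" for x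
      using that c d by auto
    have "frechet_derivative (u \<circ> chart_inv d) (at (snd d p)) = frechet_derivative ((u \<circ> chart_inv c) \<circ> ?t) (at (snd d p))"
      using frechet_derivative_transform_within_open[OF chart_differentiable[OF d True] S eq] by blast
    also have "\<dots> = frechet_derivative (u \<circ> chart_inv c) (at (?t (snd d p))) \<circ> frechet_derivative ?t (at (snd d p))"
      by (rule frechet_derivative_compose[OF t u])
    finally show ?thesis using True d by (simp add: chart_deriv_apply)
  qed (simp add: chart_deriv_def)
qed

lemma tangent_chart: "c \<in> atlas G \<Longrightarrow> p \<in> fst c \<Longrightarrow> tangent G p = range (\<lambda>a. chart_deriv G c a p)"
  unfolding tangent_def using chart_deriv_change by blast

lemma chart_deriv_tangent: "c \<in> atlas G \<Longrightarrow> p \<in> fst c \<Longrightarrow> chart_deriv G c a p \<in> tangent G p"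
  unfolding tangent_def by blast

lemma chart_deriv_linear:
  assumes "c \<in> atlas G" "p \<in> fst c"
  shows "linear (\<lambda>a. chart_deriv G c a p u)"
proof (cases "smooth_near G p u")
  case True
  then show ?thesis
    using linear_frechet_derivative[OF chart_differentiable[OF assms True]] by (simp add: chart_deriv_apply)
qed (simp add: chart_deriv_def linear_iff)

lemma chart_deriv_comb:
  assumes "c \<in> atlas G" "p \<in> fst c"
  shows "tplus (tscale s (chart_deriv G c a p)) (tscale t (chart_deriv G c b p)) = chart_deriv G c (s *\<^sub>R a + t *\<^sub>R b) p"
proof
  fix u
  have "linear (\<lambda>a. chart_deriv G c a p u)" by (rule chart_deriv_linear[OF assms])
  then show "tplus (tscale s (chart_deriv G c a p)) (tscale t (chart_deriv G c b p)) u = chart_deriv G c (s *\<^sub>R a + t *\<^sub>R b) p u"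
    by (simp add: tplus_def tscale_def linear_add[where f = "\<lambda>a. chart_deriv G c a p u"] linear_cmul[where f = "\<lambda>a. chart_deriv G c a p u"])
qed

lemma tangent_comb:
  assumes "v \<in> tangent G p" "w \<in> tangent G p"
  shows "tplus (tscale s v) (tscale t w) \<in> tangent G p"
proof -
  obtain c where c: "c \<in> atlas G" "p \<in> fst c" using ex_chart tangent_points[OF assms(1)] by blast
  obtain a b where "v = chart_deriv G c a p" "w = chart_deriv G c b p"
    using assms tangent_chart[OF c] by auto
  then show ?thesis by (simp only: chart_deriv_comb[OF c] chart_deriv_tangent[OF c])
qed

lemma tangent_tplus: "v \<in> tangent G p \<Longrightarrow> w \<in> tangent G p \<Longrightarrow> tplus v w \<in> tangent G p"
  using tangent_comb[of v p w 1 1] by (simp add: tscale_def)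

lemma tangent_tscale: "v \<in> tangent G p \<Longrightarrow> tscale s v \<in> tangent G p"
  using tangent_comb[of v p v s 0] by (simp add: tscale_def tplus_def)

lemma tminus_comb: "tminus v w = tplus (tscale 1 v) (tscale (- 1) w)"
  by (simp add: tminus_def tplus_def tscale_def)

lemma tangent_tminus: "v \<in> tangent G p \<Longrightarrow> w \<in> tangent G p \<Longrightarrow> tminus v w \<in> tangent G p"
  unfolding tminus_comb by (rule tangent_comb)

lemma tangent_tzero: "p \<in> points G \<Longrightarrow> tzero \<in> tangent G p"
proof -
  assume "p \<in> points G"
  then obtain c where c: "c \<in> atlas G" "p \<in> fst c" using ex_chart by blast
  have "tscale 0 (chart_deriv G c 0 p) \<in> tangent G p"
    by (intro tangent_tscale chart_deriv_tangent c)
  then show ?thesis by (simp add: tscale_def tzero_def)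
qed

lemma smooth_fun_coord:
  assumes "c \<in> atlas G" shows "smooth_fun G (fst c) (\<lambda>q. snd c q $ i)"
proof (rule smooth_fun_chartI[OF assms op_chart[OF assms]])
  have S: "open (snd c ` fst c)" using open_chart_image'[OF assms op_chart[OF assms]] by simp
  have "smooth_on (\<lambda>x :: real^'n. x $ i) (snd c ` fst c)"
    by (rule smooth_on_linear[OF S bounded_linear_vec_nth])
  then show "smooth_on ((\<lambda>q. snd c q $ i) \<circ> chart_inv c) (snd c ` fst c)"
    by (rule smooth_on_cong[OF S, rotated]) (use assms in auto)
qed simp

lemma chart_deriv_coord:
  assumes c: "c \<in> atlas G" "p \<in> fst c"
  shows "chart_deriv G c a p (\<lambda>q. snd c q $ i) = a $ i"
proof -
  have S: "open (snd c ` fst c)" using open_chart_image'[OF c(1) op_chart[OF c(1)]] by simp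
  have "((\<lambda>x::real^'n. x $ i) has_derivative (\<lambda>a. a $ i)) (at (snd c p))"
    by (rule bounded_linear_imp_has_derivative[OF bounded_linear_vec_nth])
  then have "(((\<lambda>q. snd c q $ i) \<circ> chart_inv c) has_derivative (\<lambda>a. a $ i)) (at (snd c p))"
    by (rule has_derivative_transform_within_open[OF _ S]) (use c in auto)
  then show ?thesis
    using smooth_nearI[OF smooth_fun_coord[OF c(1)] c(2)] frechet_derivative_at
    by (metis chart_deriv_apply)
qed

lemma tangent_expand:
  assumes c: "c \<in> atlas G" "p \<in> fst c" and v: "v \<in> tangent G p"
  shows "v = chart_deriv G c (\<chi> i. v (\<lambda>q. snd c q $ i)) p"
proof -
  obtain a where "v = chart_deriv G c a p" using v tangent_chart[OF c] by auto
  then show ?thesis by (simp add: chart_deriv_coord[OF c] vec_lambda_eta)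
qed

lemma chart_deriv_sum:
  assumes c: "c \<in> atlas G" "p \<in> fst c"
  shows "chart_deriv G c a p u = (\<Sum>i\<in>UNIV. a $ i * chart_deriv G c (axis i 1) p u)"
proof -
  interpret linear "\<lambda>a. chart_deriv G c a p u" by (rule chart_deriv_linear[OF c])
  have "chart_deriv G c (\<Sum>i\<in>UNIV. a $ i *\<^sub>R axis i 1) p u = (\<Sum>i\<in>UNIV. a $ i *\<^sub>R chart_deriv G c (axis i 1) p u)"
    by (simp add: sum scale)
  moreover have "(\<Sum>i\<in>UNIV. a $ i *\<^sub>R axis i 1) = a"
    using basis_expansion[of a] by (simp add: scalar_mult_eq_scaleR)
  ultimately show ?thesis by simp
qed

section \<open>Smooth vector fields\<close>

lemma smooth_vfield_op: "smooth_vfield G U X \<Longrightarrow> op U"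
  by (simp add: smooth_vfield_def)

lemma smooth_vfield_tangent: "smooth_vfield G U X \<Longrightarrow> p \<in> U \<Longrightarrow> X p \<in> tangent G p"
  by (simp add: smooth_vfield_def)

lemma smooth_vfield_fun: "smooth_vfield G U X \<Longrightarrow> smooth_fun G U u \<Longrightarrow> smooth_fun G U (\<lambda>p. X p u)"
  by (simp add: smooth_vfield_def)

lemma smooth_vfield_subset: "smooth_vfield G U X \<Longrightarrow> op V \<Longrightarrow> V \<subseteq> U \<Longrightarrow> smooth_vfield G V X"
  unfolding smooth_vfield_def by (meson order_trans subsetD)

lemma smooth_vfield_local:
  assumes "op U" "\<And>p. p \<in> U \<Longrightarrow> \<exists>V. p \<in> V \<and> smooth_vfield G V X"
  shows "smooth_vfield G U X"
  unfolding smooth_vfield_def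
proof (intro conjI allI impI assms(1) ballI)
  show "X p \<in> tangent G p" if "p \<in> U" for p using assms(2)[OF that] smooth_vfield_tangent by blast
  fix W u assume W: "W \<subseteq> U \<and> smooth_fun G W u"
  show "smooth_fun G W (\<lambda>p. X p u)"
  proof (rule smooth_fun_local)
    show "op W" using W smooth_fun_op by blast
    fix p assume p: "p \<in> W"
    then obtain V where V: "p \<in> V" "smooth_vfield G V X" using assms(2) W by blast
    have "op (V \<inter> W)" using V W smooth_fun_op smooth_vfield_op by blast
    then have "smooth_fun G (V \<inter> W) (\<lambda>p. X p u)"
      using V W by (intro smooth_vfield_fun[of "V \<inter> W" X]) (auto intro: smooth_fun_subset smooth_vfield_subset)
    then show "\<exists>V. p \<in> V \<and> smooth_fun G V (\<lambda>p. X p u)" using V p by blast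
  qed
qed

lemma smooth_vfield_tminus:
  assumes "smooth_vfield G U X" "smooth_vfield G U Y"
  shows "smooth_vfield G U (\<lambda>p. tminus (X p) (Y p))"
  using assms
  unfolding smooth_vfield_def by (auto simp: tminus_def tangent_tminus[unfolded tminus_def] intro!: smooth_fun_diff)

lemma smooth_vfield_cong:
  assumes "smooth_vfield G U X" "\<And>p. p \<in> U \<Longrightarrow> X p = Y p"
  shows "smooth_vfield G U Y"
  unfolding smooth_vfield_def
proof (intro conjI allI impI ballI)
  show "op U" using assms(1) by (rule smooth_vfield_op)
  show "Y p \<in> tangent G p" if "p \<in> U" for p
    using smooth_vfield_tangent[OF assms(1) that] assms(2)[OF that] by simp
  fix V u assume V: "V \<subseteq> U \<and> smooth_fun G V u"
  then have "smooth_fun G V (\<lambda>p. X p u)" using assms(1) by (simp add: smooth_vfield_def)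
  then show "smooth_fun G V (\<lambda>p. Y p u)"
    by (rule smooth_fun_cong) (use V assms(2) in auto)
qed

lemma smooth_vfield_chart_deriv:
  assumes c: "c \<in> atlas G" shows "smooth_vfield G (fst c) (chart_deriv G c a)"
  unfolding smooth_vfield_def
proof (intro conjI allI impI ballI op_chart[OF c])
  show "chart_deriv G c a p \<in> tangent G p" if "p \<in> fst c" for p by (rule chart_deriv_tangent[OF c that])
  fix V u assume "V \<subseteq> fst c \<and> smooth_fun G V u"
  then have V: "V \<subseteq> fst c" "op V" and u: "smooth_fun G V u" using smooth_fun_op by auto
  have "smooth_on (\<lambda>x. frechet_derivative (u \<circ> chart_inv c) (at x) a) (snd c ` V)"
    using smooth_on_derivative[OF smooth_fun_chart[OF u c]] V by (simp add: Int_absorb2)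
  then have "smooth_on ((\<lambda>p. chart_deriv G c a p u) \<circ> chart_inv c) (snd c ` V)"
    by (rule smooth_on_cong[OF open_chart_image'[OF c V(2,1)], rotated])
       (use V c smooth_nearI[OF u] in \<open>auto simp: chart_deriv_apply subset_iff\<close>)
  then show "smooth_fun G V (\<lambda>p. chart_deriv G c a p u)" by (rule smooth_fun_chartI[OF c V(2,1)])
qed

lemma smooth_vfield_chart_comb:
  assumes c: "c \<in> atlas G" and U: "op U" "U \<subseteq> fst c" and b: "\<And>i. smooth_fun G U (\<lambda>q. b q $ i)"
  shows "smooth_vfield G U (\<lambda>q. chart_deriv G c (b q) q)"
  unfolding smooth_vfield_def
proof (intro conjI allI impI ballI U(1))
  show "chart_deriv G c (b p) p \<in> tangent G p" if "p \<in> U" for p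
    using chart_deriv_tangent[OF c] that U by blast
  fix V u assume "V \<subseteq> U \<and> smooth_fun G V u"
  then have V: "V \<subseteq> U" "op V" "V \<subseteq> fst c" and u: "smooth_fun G V u" using smooth_fun_op U by auto
  have b': "smooth_fun G V (\<lambda>q. b q $ i)" for i
    by (rule smooth_fun_subset[OF b V(2,1)])
  have d: "smooth_fun G V (\<lambda>q. chart_deriv G c (axis i 1) q u)" for i
    by (rule smooth_vfield_fun[OF smooth_vfield_subset[OF smooth_vfield_chart_deriv[OF c] V(2,3)] u])
  have "smooth_fun G V (\<lambda>q. \<Sum>i\<in>UNIV. b q $ i * chart_deriv G c (axis i 1) q u)"
    by (intro smooth_fun_sum[OF V(2)] smooth_fun_mult[OF b' d])
  then show "smooth_fun G V (\<lambda>q. chart_deriv G c (b q) q u)"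
  proof (rule smooth_fun_cong)
    fix q assume "q \<in> V"
    then have "q \<in> fst c" using V(3) by blast
    then show "(\<Sum>i\<in>UNIV. b q $ i * chart_deriv G c (axis i 1) q u) = chart_deriv G c (b q) q u"
      by (rule chart_deriv_sum[OF c, symmetric])
  qed
qed

text \<open>The coordinate field with constant coefficients witnesses the choice in
  \<open>extend\<close>.\<close>

lemma extend_props:
  assumes "v \<in> tangent G p"
  obtains U where "p \<in> U" "smooth_vfield G U (extend G p v)" "extend G p v p = v"
proof -
  obtain c where c: "c \<in> atlas G" "p \<in> fst c" using ex_chart tangent_points[OF assms] by blast
  obtain a where a: "v = chart_deriv G c a p" using assms tangent_chart[OF c] by auto
  have "(\<exists>U. p \<in> U \<and> smooth_vfield G U (extend G p v)) \<and> extend G p v p = v"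
    unfolding extend_def
    by (rule someI[of _ "chart_deriv G c a"]) (use smooth_vfield_chart_deriv[OF c(1)] c a in auto)
  then show ?thesis using that by blast
qed

lemma smooth_lie_bracket_fun:
  assumes "smooth_fun G U u" "smooth_vfield G U X" "smooth_vfield G U Y" "p \<in> U"
  shows "lie_bracket G X Y p u = X p (\<lambda>q. Y q u) - Y p (\<lambda>q. X q u)"
  using assms smooth_nearI by (simp add: lie_bracket_def)

end

section \<open>Metric, gradient, Hessian and curvature\<close>


locale riem_mfd =
  fixes G :: "('a, 'n::finite) riem"
  assumes riem: "riemannian_manifold G"

sublocale riem_mfd \<subseteq> smooth_mfd G
  using riem by unfold_locales (simp add: riemannian_manifold_def)

context smooth_mfd
begin

text \<open>Tangent spaces are subsets of a function type with their own operations, so linearity of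
  a covector is a predicate relative to \<open>tangent G p\<close>; values elsewhere do not
  count.\<close>

definition tlinear :: "'a \<Rightarrow> ('a tvec \<Rightarrow> real) \<Rightarrow> bool" where
  "tlinear p F \<longleftrightarrow> (\<forall>v\<in>tangent G p. \<forall>w\<in>tangent G p. \<forall>a b.
     F (tplus (tscale a v) (tscale b w)) = a * F v + b * F w)"

lemma tlinearD: "tlinear p F \<Longrightarrow> v \<in> tangent G p \<Longrightarrow> w \<in> tangent G p \<Longrightarrow>
    F (tplus (tscale a v) (tscale b w)) = a * F v + b * F w"
  by (simp add: tlinear_def)

lemma tlinear_tplus:
  assumes "tlinear p F" "v \<in> tangent G p" "w \<in> tangent G p"
  shows "F (tplus v w) = F v + F w"
  using tlinearD[OF assms, of 1 1] by (simp add: tscale_def)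

lemma tlinear_tscale:
  assumes "tlinear p F" "v \<in> tangent G p"
  shows "F (tscale a v) = a * F v"
  using tlinearD[OF assms assms(2), of a 0] by (simp add: tscale_def tplus_def)

lemma tlinear_tminus:
  assumes "tlinear p F" "v \<in> tangent G p" "w \<in> tangent G p"
  shows "F (tminus v w) = F v - F w"
  unfolding tminus_comb using tlinearD[OF assms, of 1 "- 1"] by simp

lemma tlinear_tzero:
  assumes "tlinear p F" "p \<in> points G"
  shows "F tzero = 0"
  using tlinear_tscale[OF assms(1) tangent_tzero[OF assms(2)], of 0] by (simp add: tscale_def tzero_def)

lemma tlinear_lincomb: "tlinear p F \<Longrightarrow> tlinear p H \<Longrightarrow> tlinear p (\<lambda>v. a * F v + b * H v)"
  by (simp add: tlinear_def algebra_simps)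

lemma tlinear_apply: "tlinear p (\<lambda>v. v u)"
  by (simp add: tlinear_def tplus_def tscale_def)

lemma tlinear_differential: "tlinear p (differential u p)"
  by (simp add: tlinear_def tplus_def tscale_def differential_def)

lemma tlinear_cong:
  assumes "tlinear p F" "\<And>v. v \<in> tangent G p \<Longrightarrow> F v = H v"
  shows "tlinear p H"
  using assms tangent_comb by (simp add: tlinear_def)

lemma tlinear_chart:
  assumes c: "c \<in> atlas G" "p \<in> fst c" and F: "tlinear p F"
  shows "F (chart_deriv G c a p) = (\<Sum>i\<in>UNIV. a $ i * F (chart_deriv G c (axis i 1) p))"
proof -
  have comb: "F (chart_deriv G c (s *\<^sub>R a + t *\<^sub>R b) p) = s * F (chart_deriv G c a p) + t * F (chart_deriv G c b p)" for s t a b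
    unfolding chart_deriv_comb[OF c, symmetric] by (rule tlinearD[OF F chart_deriv_tangent[OF c] chart_deriv_tangent[OF c]])
  interpret linear "\<lambda>a. F (chart_deriv G c a p)"
  proof (rule linearI)
    show "F (chart_deriv G c (a + b) p) = F (chart_deriv G c a p) + F (chart_deriv G c b p)" for a b
      using comb[of 1 a 1 b] by simp
    show "F (chart_deriv G c (s *\<^sub>R a) p) = s *\<^sub>R F (chart_deriv G c a p)" for s a
      using comb[of s a 0 0] by simp
  qed
  have "F (chart_deriv G c (\<Sum>i\<in>UNIV. a $ i *\<^sub>R axis i 1) p) = (\<Sum>i\<in>UNIV. a $ i *\<^sub>R F (chart_deriv G c (axis i 1) p))"
    by (simp add: sum scale)
  moreover have "(\<Sum>i\<in>UNIV. a $ i *\<^sub>R axis i 1) = a"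
    using basis_expansion[of a] by (simp add: scalar_mult_eq_scaleR)
  ultimately show ?thesis by simp
qed

end

context riem_mfd
begin

section \<open>Metric, connection and the musical isomorphism\<close>

lemma metric: "riemannian_metric G"
  using riem by (simp add: riemannian_manifold_def)

lemma lc: "levi_civita G"
  using riem by (simp add: riemannian_manifold_def)

lemma met_sym:
  assumes "v \<in> tangent G p" "w \<in> tangent G p"
  shows "met G p v w = met G p w v"
  using metric assms tangent_points[OF assms(1)] by (simp add: riemannian_metric_def)

lemma met_pos:
  assumes "v \<in> tangent G p" "v \<noteq> tzero"
  shows "met G p v v > 0"
  using metric assms tangent_points[OF assms(1)] by (simp add: riemannian_metric_def)

lemma met_tlinear_left:
  assumes "z \<in> tangent G p"
  shows "tlinear p (\<lambda>v. met G p v z)"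
  using metric assms tangent_points[OF assms(1)] by (simp add: riemannian_metric_def tlinear_def)

lemma met_tlinear_right:
  assumes z: "z \<in> tangent G p"
  shows "tlinear p (\<lambda>v. met G p z v)"
  by (rule tlinear_cong[OF met_tlinear_left[OF z]]) (rule met_sym[OF _ z])

lemma met_smooth:
  assumes "smooth_vfield G U X" "smooth_vfield G U Y"
  shows "smooth_fun G U (\<lambda>p. met G p (X p) (Y p))"
  using metric assms unfolding riemannian_metric_def by blast

text \<open>Definiteness tested on \<open>tminus v w\<close>. This is how scalar identities become
  vector identities below.\<close>

lemma met_ext:
  assumes v: "v \<in> tangent G p" and w: "w \<in> tangent G p"
    and eq: "\<And>z. z \<in> tangent G p \<Longrightarrow> met G p v z = met G p w z"
  shows "v = w"
proof -
  have t: "tminus v w \<in> tangent G p" by (rule tangent_tminus[OF v w])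
  have "met G p (tminus v w) (tminus v w) = 0"
    using tlinear_tminus[OF met_tlinear_left[OF t] v w] eq[OF t] by simp
  then have "tminus v w = tzero" using met_pos[OF t] by force
  then show ?thesis by (simp add: tminus_def tzero_def fun_eq_iff)
qed

lemma nabla_smooth:
  assumes "smooth_vfield G U X" "smooth_vfield G U Y"
  shows "smooth_vfield G U (nabla G X Y)"
  using lc assms unfolding levi_civita_def by blast

lemma nabla_torsion:
  assumes "smooth_vfield G U X" "smooth_vfield G U Y" "p \<in> U"
  shows "tminus (nabla G X Y p) (nabla G Y X p) = lie_bracket G X Y p"
  using lc assms unfolding levi_civita_def by blast

lemma nabla_metric:
  assumes "smooth_vfield G U X" "smooth_vfield G U Y" "smooth_vfield G U Z" "p \<in> U"
  shows "X p (\<lambda>q. met G q (Y q) (Z q)) =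
     met G p (nabla G X Y p) (Z p) + met G p (Y p) (nabla G X Z p)"
  using lc assms unfolding levi_civita_def by blast

text \<open>Torsion-freeness writes the bracket as a difference of covariant derivatives, so there
  is no need to verify in coordinates that the second-order terms cancel.\<close>

lemma lie_bracket_smooth:
  assumes "smooth_vfield G U X" "smooth_vfield G U Y"
  shows "smooth_vfield G U (lie_bracket G X Y)"
  by (rule smooth_vfield_cong[OF smooth_vfield_tminus[OF nabla_smooth[OF assms] nabla_smooth[OF assms(2,1)]]])
     (rule nabla_torsion[OF assms])

lemma sharp_eqI:
  assumes z: "z \<in> tangent G p" and eq: "\<And>w. w \<in> tangent G p \<Longrightarrow> met G p z w = \<alpha> w"
  shows "sharp G p \<alpha> = z"
  unfolding sharp_def
proof (rule the_equality)
  show "z \<in> tangent G p \<and> (\<forall>w\<in>tangent G p. met G p z w = \<alpha> w)" using z eq by simp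
  fix y assume y: "y \<in> tangent G p \<and> (\<forall>w\<in>tangent G p. met G p y w = \<alpha> w)"
  show "y = z" by (rule met_ext) (use y z eq in auto)
qed

definition gram :: "('a, 'n) chart \<Rightarrow> 'a \<Rightarrow> real ^ 'n ^ 'n" where
  "gram c p = (\<chi> i j. met G p (chart_deriv G c (axis i 1) p) (chart_deriv G c (axis j 1) p))"

text \<open>Cramer's rule for the Gram system. The quotient of determinants displays the smooth
  dependence on the point, which the description operator in \<open>sharp\<close> hides.\<close>

definition sharp_coords :: "('a, 'n) chart \<Rightarrow> 'a \<Rightarrow> ('a tvec \<Rightarrow> real) \<Rightarrow> real ^ 'n" where
  "sharp_coords c p \<alpha> = (\<chi> k. det (\<chi> i j. if j = k then \<alpha> (chart_deriv G c (axis i 1) p) else gram c p $ i $ j)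
     / det (gram c p))"

lemma met_gram:
  assumes c: "c \<in> atlas G" "p \<in> fst c"
  shows "met G p (chart_deriv G c (axis i 1) p) (chart_deriv G c b p) = (gram c p *v b) $ i"
  unfolding tlinear_chart[OF c met_tlinear_right[OF chart_deriv_tangent[OF c]], of _ b]
  by (simp add: matrix_vector_mult_def gram_def mult.commute)

text \<open>A kernel vector of the Gram matrix gives the coordinates of a tangent vector of length
  0.\<close>

lemma gram_det:
  assumes c: "c \<in> atlas G" "p \<in> fst c"
  shows "det (gram c p) \<noteq> 0"
proof -
  have "x = 0" if x: "gram c p *v x = 0" for x
  proof -
    have t: "chart_deriv G c x p \<in> tangent G p" by (rule chart_deriv_tangent[OF c])
    have "met G p (chart_deriv G c x p) (chart_deriv G c x p)
        = (\<Sum>i\<in>UNIV. x $ i * met G p (chart_deriv G c (axis i 1) p) (chart_deriv G c x p))"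
      by (rule tlinear_chart[OF c met_tlinear_left[OF t]])
    also have "\<dots> = 0" unfolding met_gram[OF c] x by simp
    finally have "chart_deriv G c x p = tzero" using met_pos[OF t] by force
    then have "x $ i = 0" for i
      using chart_deriv_coord[OF c, of x i] by (simp add: tzero_def)
    then show "x = 0" by (simp add: vec_eq_iff)
  qed
  then have "\<exists>B. B ** gram c p = mat 1" unfolding matrix_left_invertible_ker by blast
  then show ?thesis unfolding invertible_det_nz[symmetric] invertible_left_inverse .
qed

text \<open>Existence of the vector that \<open>sharp\<close> describes, together with its
  coordinates; uniqueness is \<open>met_ext\<close>.\<close>

lemma sharp_chart:
  assumes c: "c \<in> atlas G" "p \<in> fst c" and \<alpha>: "tlinear p \<alpha>"
  shows "sharp G p \<alpha> = chart_deriv G c (sharp_coords c p \<alpha>) p"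
    and "w \<in> tangent G p \<Longrightarrow> met G p (sharp G p \<alpha>) w = \<alpha> w"
proof -
  let ?z = "chart_deriv G c (sharp_coords c p \<alpha>) p"
  have z: "?z \<in> tangent G p" by (rule chart_deriv_tangent[OF c])
  have "gram c p *v sharp_coords c p \<alpha> = (\<chi> i. \<alpha> (chart_deriv G c (axis i 1) p))"
    unfolding cramer[OF gram_det[OF c]] by (simp add: sharp_coords_def cong: if_cong)
  then have e: "met G p ?z (chart_deriv G c (axis i 1) p) = \<alpha> (chart_deriv G c (axis i 1) p)" for i
    using met_gram[OF c, of i "sharp_coords c p \<alpha>"] met_sym[OF z chart_deriv_tangent[OF c]] by simp
  have eq: "met G p ?z w = \<alpha> w" if w: "w \<in> tangent G p" for w
  proof -
    obtain a where a: "w = chart_deriv G c a p" using w tangent_chart[OF c] by auto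
    show ?thesis
      unfolding a using tlinear_chart[OF c met_tlinear_right[OF z], of a] tlinear_chart[OF c \<alpha>, of a] by (simp only: e)
  qed
  then show s: "sharp G p \<alpha> = ?z" by (rule sharp_eqI[OF z])
  show "met G p (sharp G p \<alpha>) w = \<alpha> w" if "w \<in> tangent G p"
    unfolding s by (rule eq[OF that])
qed

lemma met_sharp:
  assumes "tlinear p \<alpha>" "w \<in> tangent G p"
  shows "met G p (sharp G p \<alpha>) w = \<alpha> w"
  using ex_chart[OF tangent_points[OF assms(2)]] sharp_chart(2)[OF _ _ assms] by blast

lemma sharp_tangent:
  assumes p: "p \<in> points G" and \<alpha>: "tlinear p \<alpha>"
  shows "sharp G p \<alpha> \<in> tangent G p"
proof -
  obtain c where c: "c \<in> atlas G" "p \<in> fst c" using ex_chart[OF p] by blast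
  show ?thesis unfolding sharp_chart(1)[OF c \<alpha>] by (rule chart_deriv_tangent[OF c])
qed

lemma smooth_sharp:
  assumes c: "c \<in> atlas G" and U: "op U" "U \<subseteq> fst c"
    and \<alpha>: "\<And>q. q \<in> U \<Longrightarrow> tlinear q (\<alpha> q)"
    and sm: "\<And>i. smooth_fun G U (\<lambda>q. \<alpha> q (chart_deriv G c (axis i 1) q))"
  shows "smooth_vfield G U (\<lambda>q. sharp G q (\<alpha> q))"
proof -
  have E: "smooth_vfield G U (chart_deriv G c a)" for a
    by (rule smooth_vfield_subset[OF smooth_vfield_chart_deriv[OF c] U])
  have g: "smooth_fun G U (\<lambda>q. gram c q $ i $ j)" for i j
    using met_smooth[OF E E] by (simp add: gram_def)
  have "smooth_fun G U (\<lambda>q. sharp_coords c q (\<alpha> q) $ k)" for k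
  proof -
    have "smooth_fun G U (\<lambda>q. det (\<chi> i j. if j = k then \<alpha> q (chart_deriv G c (axis i 1) q) else gram c q $ i $ j))"
    proof (rule smooth_fun_det[OF U(1)])
      fix i j
      show "smooth_fun G U (\<lambda>q. (\<chi> i j. if j = k then \<alpha> q (chart_deriv G c (axis i 1) q) else gram c q $ i $ j) $ i $ j)"
        using g sm by (cases "j = k") simp_all
    qed
    then have "smooth_fun G U (\<lambda>q. det (\<chi> i j. if j = k then \<alpha> q (chart_deriv G c (axis i 1) q) else gram c q $ i $ j) / det (gram c q))"
      by (rule smooth_fun_divide[OF _ smooth_fun_det[OF U(1) g]]) (rule gram_det[OF c subsetD[OF U(2)]])
    then show ?thesis by (simp add: sharp_coords_def)
  qed
  then have "smooth_vfield G U (\<lambda>q. chart_deriv G c (sharp_coords c q (\<alpha> q)) q)"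
    by (rule smooth_vfield_chart_comb[OF c U])
  then show ?thesis
  proof (rule smooth_vfield_cong)
    fix q assume q: "q \<in> U"
    show "chart_deriv G c (sharp_coords c q (\<alpha> q)) q = sharp G q (\<alpha> q)"
      by (rule sharp_chart(1)[OF c subsetD[OF U(2) q] \<alpha>[OF q], symmetric])
  qed
qed

section \<open>Gradient and Hessian\<close>

lemma grad_tangent: "p \<in> points G \<Longrightarrow> grad G u p \<in> tangent G p"
  unfolding grad_def by (rule sharp_tangent[OF _ tlinear_differential])

lemma met_grad: "w \<in> tangent G p \<Longrightarrow> met G p (grad G u p) w = w u"
  unfolding grad_def using met_sharp[OF tlinear_differential] by (simp add: differential_def)

lemma smooth_grad:
  assumes u: "smooth_fun G U u"
  shows "smooth_vfield G U (grad G u)"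
proof (rule smooth_vfield_local)
  show op: "op U" by (rule smooth_fun_op[OF u])
  fix p assume p: "p \<in> U"
  then have "p \<in> points G" using openin_subset[OF op] by blast
  then obtain c where c: "c \<in> atlas G" "p \<in> fst c" using ex_chart by blast
  let ?V = "U \<inter> fst c"
  have V: "op ?V" "?V \<subseteq> U" "?V \<subseteq> fst c" using openin_Int[OF op op_chart[OF c(1)]] by auto
  have "smooth_vfield G ?V (\<lambda>q. sharp G q (differential u q))"
  proof (rule smooth_sharp[OF c(1) V(1,3)])
    show "tlinear q (differential u q)" for q by (rule tlinear_differential)
    show "smooth_fun G ?V (\<lambda>q. differential u q (chart_deriv G c (axis i 1) q))" for i
      unfolding differential_def
      by (rule smooth_vfield_fun[OF smooth_vfield_subset[OF smooth_vfield_chart_deriv[OF c(1)] V(1,3)]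
            smooth_fun_subset[OF u V(1,2)]])
  qed
  then show "\<exists>V. p \<in> V \<and> smooth_vfield G V (grad G u)"
    unfolding grad_def[abs_def] using p c(2) by (intro exI[of _ ?V]) simp
qed

text \<open>Differentiate \<open>g(grad u, Z) = Z u\<close> along \<open>X\<close> by metric
  compatibility.\<close>

lemma hess_formula:
  assumes u: "smooth_fun G U u" and X: "smooth_vfield G U X" and Z: "smooth_vfield G U Z" and p: "p \<in> U"
  shows "met G p (nabla G X (grad G u) p) (Z p) = X p (\<lambda>q. Z q u) - nabla G X Z p u"
proof -
  have "X p (\<lambda>q. met G q (grad G u q) (Z q)) = X p (\<lambda>q. Z q u)"
    by (rule tangent_cong[OF smooth_vfield_tangent[OF X p] smooth_vfield_op[OF X] p])
       (rule met_grad[OF smooth_vfield_tangent[OF Z]])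
  then show ?thesis
    using nabla_metric[OF X smooth_grad[OF u] Z p] met_grad[OF smooth_vfield_tangent[OF nabla_smooth[OF X Z] p]]
    by simp
qed

lemma hess_sym:
  assumes u: "smooth_fun G U u" and X: "smooth_vfield G U X" and Z: "smooth_vfield G U Z" and p: "p \<in> U"
  shows "met G p (nabla G X (grad G u) p) (Z p) = met G p (nabla G Z (grad G u) p) (X p)"
proof -
  have "nabla G X Z p u - nabla G Z X p u = lie_bracket G X Z p u"
    using fun_cong[OF nabla_torsion[OF X Z p], of u] by (simp add: tminus_def)
  then show ?thesis
    unfolding hess_formula[OF u X Z p] hess_formula[OF u Z X p]
    using smooth_lie_bracket_fun[OF u X Z p] by simp
qed

text \<open>The choice of extensions is immaterial: \<open>met G p (nabla G X (grad G u) p) (Z p)\<close> depends on \<open>Z\<close>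
  only through \<open>Z p\<close>, hence by symmetry on \<open>X\<close> only through \<open>X p\<close>.\<close>

lemma hessian_eq:
  assumes u: "smooth_fun G U u" and X: "smooth_vfield G U X" and p: "p \<in> U" and w: "w \<in> tangent G p"
  shows "hessian G u p (X p) w = met G p (nabla G X (grad G u) p) w"
proof -
  obtain V where V: "p \<in> V" "smooth_vfield G V (extend G p (X p))" "extend G p (X p) p = X p"
    using extend_props[OF smooth_vfield_tangent[OF X p]] .
  obtain W where W: "p \<in> W" "smooth_vfield G W (extend G p w)" "extend G p w p = w"
    using extend_props[OF w] .
  let ?D = "U \<inter> V \<inter> W"
  have D: "op ?D" using smooth_vfield_op[OF X] smooth_vfield_op[OF V(2)] smooth_vfield_op[OF W(2)] by (intro openin_Int)
  have pD: "p \<in> ?D" using p V W by simp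
  have u': "smooth_fun G ?D u" by (rule smooth_fun_subset[OF u D]) auto
  have X1: "smooth_vfield G ?D (extend G p (X p))" by (rule smooth_vfield_subset[OF V(2) D]) auto
  have X2: "smooth_vfield G ?D (extend G p w)" by (rule smooth_vfield_subset[OF W(2) D]) auto
  have X3: "smooth_vfield G ?D X" by (rule smooth_vfield_subset[OF X D]) auto
  show ?thesis
    unfolding hessian_def
    using hess_sym[OF u' X1 X2 pD] hess_sym[OF u' X2 X3 pD] unfolding V(3) W(3) by simp
qed

text \<open>Represents \<open>hessian G u p v\<close> by one tangent vector, whence linearity in the
  second slot; the first slot follows by symmetry.\<close>

lemma hessian_extend:
  assumes u: "smooth_fun G U u" and p: "p \<in> U" and v: "v \<in> tangent G p"
  shows "\<exists>z\<in>tangent G p. \<forall>w. hessian G u p v w = met G p z w"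
proof -
  obtain V where V: "p \<in> V" "smooth_vfield G V (extend G p v)" "extend G p v p = v"
    using extend_props[OF v] .
  let ?D = "U \<inter> V"
  have D: "op ?D" using smooth_fun_op[OF u] smooth_vfield_op[OF V(2)] by (intro openin_Int)
  have u': "smooth_fun G ?D u" by (rule smooth_fun_subset[OF u D]) auto
  have X: "smooth_vfield G ?D (extend G p v)" by (rule smooth_vfield_subset[OF V(2) D]) auto
  show ?thesis
    by (rule bexI[of _ "nabla G (extend G p v) (grad G u) p"])
       (use smooth_vfield_tangent[OF nabla_smooth[OF X smooth_grad[OF u']]] p V in \<open>auto simp: hessian_def\<close>)
qed

lemma hessian_sym:
  assumes u: "smooth_fun G U u" and p: "p \<in> U" and v: "v \<in> tangent G p" and w: "w \<in> tangent G p"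
  shows "hessian G u p v w = hessian G u p w v"
proof -
  obtain V where V: "p \<in> V" "smooth_vfield G V (extend G p v)" "extend G p v p = v"
    using extend_props[OF v] .
  obtain W where W: "p \<in> W" "smooth_vfield G W (extend G p w)" "extend G p w p = w"
    using extend_props[OF w] .
  let ?D = "U \<inter> V \<inter> W"
  have D: "op ?D" using smooth_fun_op[OF u] smooth_vfield_op[OF V(2)] smooth_vfield_op[OF W(2)] by (intro openin_Int)
  have pD: "p \<in> ?D" using p V W by simp
  have u': "smooth_fun G ?D u" by (rule smooth_fun_subset[OF u D]) auto
  have X1: "smooth_vfield G ?D (extend G p v)" by (rule smooth_vfield_subset[OF V(2) D]) auto
  have X2: "smooth_vfield G ?D (extend G p w)" by (rule smooth_vfield_subset[OF W(2) D]) auto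
  show ?thesis
    unfolding hessian_def using hess_sym[OF u' X1 X2 pD] unfolding V(3) W(3) by simp
qed

lemma hessian_tlinear_right:
  assumes u: "smooth_fun G U u" and p: "p \<in> U" and v: "v \<in> tangent G p"
  shows "tlinear p (\<lambda>w. hessian G u p v w)"
proof -
  obtain z where z: "z \<in> tangent G p" "\<forall>w. hessian G u p v w = met G p z w"
    using hessian_extend[OF assms] by blast
  show ?thesis unfolding z(2)[rule_format] by (rule met_tlinear_right[OF z(1)])
qed

lemma hessian_tlinear_left:
  assumes u: "smooth_fun G U u" and p: "p \<in> U" and w: "w \<in> tangent G p"
  shows "tlinear p (\<lambda>v. hessian G u p v w)"
  by (rule tlinear_cong[OF hessian_tlinear_right[OF assms]]) (rule hessian_sym[OF u p w])

lemma hessian_smooth: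
  assumes u: "smooth_fun G U u" and X: "smooth_vfield G U X" and Y: "smooth_vfield G U Y"
  shows "smooth_fun G U (\<lambda>p. hessian G u p (X p) (Y p))"
  by (rule smooth_fun_cong[OF met_smooth[OF nabla_smooth[OF X smooth_grad[OF u]] Y]])
     (rule hessian_eq[OF u X _ smooth_vfield_tangent[OF Y], symmetric])

section \<open>Curvature of fields and of vectors\<close>

lemma Rm_field_smooth:
  assumes "smooth_vfield G U X" "smooth_vfield G U Y" "smooth_vfield G U Z"
  shows "smooth_vfield G U (Rm_field G X Y Z)"
  unfolding Rm_field_def
  by (intro smooth_vfield_tminus nabla_smooth lie_bracket_smooth assms)

lemma met_Rm_field:
  assumes "smooth_vfield G U X" "smooth_vfield G U Y" "smooth_vfield G U Z" "p \<in> U" "w \<in> tangent G p"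
  shows "met G p (Rm_field G X Y Z p) w = met G p (nabla G X (nabla G Y Z) p) w
    - met G p (nabla G Y (nabla G X Z) p) w - met G p (nabla G (lie_bracket G X Y) Z p) w"
proof -
  note S = nabla_smooth[OF assms(1) nabla_smooth[OF assms(2,3)]] nabla_smooth[OF assms(2) nabla_smooth[OF assms(1,3)]]
    nabla_smooth[OF lie_bracket_smooth[OF assms(1,2)] assms(3)]
  note T = S[THEN smooth_vfield_tangent, OF assms(4)]
  note L = met_tlinear_left[OF assms(5)]
  show ?thesis
    unfolding Rm_field_def tlinear_tminus[OF L tangent_tminus[OF T(1,2)] T(3)] tlinear_tminus[OF L T(1,2)] ..
qed

text \<open>Apply \<open>X Y - Y X - [X, Y]\<close>, which annihilates smooth functions, to
  \<open>g(Z, W)\<close>. Metric compatibility leaves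
  \<open>g(Rm(X, Y) Z, W) + g(Z, Rm(X, Y) W) = 0\<close>.\<close>

lemma Rm_field_skew:
  assumes X: "smooth_vfield G U X" and Y: "smooth_vfield G U Y" and Z: "smooth_vfield G U Z"
    and W: "smooth_vfield G U W" and p: "p \<in> U"
  shows "met G p (Rm_field G X Y Z p) (W p) = - met G p (Rm_field G X Y W p) (Z p)"
proof -
  let ?a = "\<lambda>q. met G q (Z q) (W q)"
  have a: "smooth_fun G U ?a" by (rule met_smooth[OF Z W])
  \<comment> \<open>The two middle terms are exchanged when \<open>A\<close> and \<open>B\<close>
    are, so they drop out of the commutator.\<close>
  have second: "A p (\<lambda>q. B q ?a) = met G p (nabla G A (nabla G B Z) p) (W p)
      + met G p (nabla G B Z p) (nabla G A W p)
      + met G p (nabla G A Z p) (nabla G B W p) + met G p (Z p) (nabla G A (nabla G B W) p)"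
    if A: "smooth_vfield G U A" and B: "smooth_vfield G U B" for A B
  proof -
    have Ap: "A p \<in> tangent G p" by (rule smooth_vfield_tangent[OF A p])
    have "A p (\<lambda>q. B q ?a) = A p (\<lambda>q. met G q (nabla G B Z q) (W q) + met G q (Z q) (nabla G B W q))"
      by (rule tangent_cong[OF Ap smooth_vfield_op[OF A] p]) (rule nabla_metric[OF B Z W])
    also have "\<dots> = A p (\<lambda>q. met G q (nabla G B Z q) (W q)) + A p (\<lambda>q. met G q (Z q) (nabla G B W q))"
      by (rule tangent_add[OF Ap smooth_nearI[OF met_smooth[OF nabla_smooth[OF B Z] W] p]
            smooth_nearI[OF met_smooth[OF Z nabla_smooth[OF B W]] p]])
    finally show ?thesis
      unfolding nabla_metric[OF A nabla_smooth[OF B Z] W p] nabla_metric[OF A Z nabla_smooth[OF B W] p] by simp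
  qed
  note Zp = smooth_vfield_tangent[OF Z p] and Wp = smooth_vfield_tangent[OF W p]
  have sym: "met G p (Z p) (A p) = met G p (A p) (Z p)" if "smooth_vfield G U A" for A
    by (rule met_sym[OF Zp smooth_vfield_tangent[OF that p]])
  have "lie_bracket G X Y p ?a = X p (\<lambda>q. Y q ?a) - Y p (\<lambda>q. X q ?a)"
    by (rule smooth_lie_bracket_fun[OF a X Y p])
  moreover have "lie_bracket G X Y p ?a = met G p (nabla G (lie_bracket G X Y) Z p) (W p)
      + met G p (Z p) (nabla G (lie_bracket G X Y) W p)"
    by (rule nabla_metric[OF lie_bracket_smooth[OF X Y] Z W p])
  ultimately show ?thesis
    unfolding met_Rm_field[OF X Y Z p Wp] met_Rm_field[OF X Y W p Zp] second[OF X Y] second[OF Y X]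
      sym[OF nabla_smooth[OF X nabla_smooth[OF Y W]]] sym[OF nabla_smooth[OF Y nabla_smooth[OF X W]]]
      sym[OF nabla_smooth[OF lie_bracket_smooth[OF X Y] W]]
    by linarith
qed

text \<open>The connection axioms speak of fields on one open set, while each chosen extension comes
  with its own neighbourhood.\<close>

lemma extend_common:
  assumes "finite I" "\<And>i. i \<in> I \<Longrightarrow> v i \<in> tangent G p" "op U" "p \<in> U"
  obtains D where "p \<in> D" "op D" "D \<subseteq> U" "\<And>i. i \<in> I \<Longrightarrow> smooth_vfield G D (extend G p (v i))"
proof -
  have "\<exists>D. p \<in> D \<and> op D \<and> D \<subseteq> U \<and> (\<forall>i\<in>I. smooth_vfield G D (extend G p (v i)))"
    using assms(1,2)
  proof (induction I rule: finite_induct)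
    case empty
    then show ?case using assms(3,4) by (intro exI[of _ U]) simp
  next
    case (insert i I)
    then obtain D where D: "p \<in> D" "op D" "D \<subseteq> U" "\<forall>i\<in>I. smooth_vfield G D (extend G p (v i))"
      by auto
    have "v i \<in> tangent G p" using insert.prems by simp
    then obtain V where V: "p \<in> V" "smooth_vfield G V (extend G p (v i))"
      using extend_props by metis
    have op: "op (D \<inter> V)" by (rule openin_Int[OF D(2) smooth_vfield_op[OF V(2)]])
    have "smooth_vfield G (D \<inter> V) (extend G p (v j))" if "j \<in> insert i I" for j
    proof (cases "j = i")
      case True
      then show ?thesis using smooth_vfield_subset[OF V(2) op] by simp
    next
      case False
      then have "smooth_vfield G D (extend G p (v j))" using D(4) that by simp
      then show ?thesis by (rule smooth_vfield_subset[OF _ op]) simp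
    qed
    then show ?case using D V op by (intro exI[of _ "D \<inter> V"]) auto
  qed
  then show ?thesis using that by metis
qed

text \<open>By skew-symmetry \<open>g (Rm(X, Y) Z, W) = - g (Rm(X, Y) W, Z)\<close>, the left-hand side depends on \<open>Z\<close>
  only through its value at the point.\<close>

lemma Rm_eq:
  assumes x: "x \<in> tangent G p" and y: "y \<in> tangent G p" and Z: "smooth_vfield G U Z" and p: "p \<in> U"
  shows "Rm G p x y (Z p) = Rm_field G (extend G p x) (extend G p y) Z p"
proof (rule met_ext)
  have Zp: "Z p \<in> tangent G p" by (rule smooth_vfield_tangent[OF Z p])
  have "\<exists>D. p \<in> D \<and> op D \<and> D \<subseteq> U \<and> smooth_vfield G D (extend G p x) \<and> smooth_vfield G D (extend G p y)
      \<and> smooth_vfield G D (extend G p (Z p)) \<and> smooth_vfield G D (extend G p w)"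
    if w: "w \<in> tangent G p" for w
    using extend_common[of "{x, y, Z p, w}" "\<lambda>v. v" p U] x y Zp w smooth_vfield_op[OF Z] p
    by (metis finite.emptyI finite.insertI insertE insertI1 insertI2 singletonD)
  note D = this
  {
    fix w assume w: "w \<in> tangent G p"
    obtain D where D: "p \<in> D" "op D" "D \<subseteq> U" "smooth_vfield G D (extend G p x)" "smooth_vfield G D (extend G p y)"
      "smooth_vfield G D (extend G p (Z p))" "smooth_vfield G D (extend G p w)"
      using D[OF w] by blast
    have Z': "smooth_vfield G D Z" by (rule smooth_vfield_subset[OF Z D(2,3)])
    have ew: "extend G p w p = w" using extend_props[OF w] .
    have eZ: "extend G p (Z p) p = Z p" using extend_props[OF Zp] .
    have "Rm G p x y (Z p) \<in> tangent G p"
      unfolding Rm_def by (rule smooth_vfield_tangent[OF Rm_field_smooth[OF D(4-6)] D(1)])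
    moreover have "Rm_field G (extend G p x) (extend G p y) Z p \<in> tangent G p"
      by (rule smooth_vfield_tangent[OF Rm_field_smooth[OF D(4,5) Z'] D(1)])
    moreover have "met G p (Rm G p x y (Z p)) w = met G p (Rm_field G (extend G p x) (extend G p y) Z p) w"
      unfolding Rm_def
      using Rm_field_skew[OF D(4,5,6,7,1)] Rm_field_skew[OF D(4,5) Z' D(7,1)] unfolding ew eZ by simp
    ultimately have "Rm G p x y (Z p) \<in> tangent G p \<and> Rm_field G (extend G p x) (extend G p y) Z p \<in> tangent G p
      \<and> met G p (Rm G p x y (Z p)) w = met G p (Rm_field G (extend G p x) (extend G p y) Z p) w" by blast
  }
  note * = this
  show "Rm G p x y (Z p) \<in> tangent G p" "Rm_field G (extend G p x) (extend G p y) Z p \<in> tangent G p"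
    using *[OF x] by auto
  fix z assume "z \<in> tangent G p"
  then show "met G p (Rm G p x y (Z p)) z = met G p (Rm_field G (extend G p x) (extend G p y) Z p) z"
    using * by blast
qed

lemma Rm_skew:
  assumes x: "x \<in> tangent G p" and y: "y \<in> tangent G p" and z: "z \<in> tangent G p" and w: "w \<in> tangent G p"
  shows "Rm G p x y z \<in> tangent G p" "met G p (Rm G p x y z) w = - met G p (Rm G p x y w) z"
proof -
  have p: "p \<in> points G" by (rule tangent_points[OF x])
  have "\<exists>D. p \<in> D \<and> smooth_vfield G D (extend G p x) \<and> smooth_vfield G D (extend G p y)
      \<and> smooth_vfield G D (extend G p z) \<and> smooth_vfield G D (extend G p w)"
    using extend_common[of "{x, y, z, w}" "\<lambda>v. v" p "points G"] x y z w p openin_topspace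
    by (metis finite.emptyI finite.insertI insertE insertI1 insertI2 singletonD)
  then obtain D where D: "p \<in> D" "smooth_vfield G D (extend G p x)" "smooth_vfield G D (extend G p y)"
      "smooth_vfield G D (extend G p z)" "smooth_vfield G D (extend G p w)" by blast
  have ew: "extend G p w p = w" using extend_props[OF w] .
  have ez: "extend G p z p = z" using extend_props[OF z] .
  show "Rm G p x y z \<in> tangent G p"
    unfolding Rm_def by (rule smooth_vfield_tangent[OF Rm_field_smooth[OF D(2-4)] D(1)])
  show "met G p (Rm G p x y z) w = - met G p (Rm G p x y w) z"
    unfolding Rm_def using Rm_field_skew[OF D(2-5,1)] unfolding ew ez .
qed

text \<open>Differentiating \<open>g(nabla_Y grad u, Z)\<close> along \<open>X\<close>, the terms
  with \<open>nabla_X Z\<close> cancel. In the difference the subtracted terms in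
  \<open>nabla_X Y\<close> and \<open>nabla_Y X\<close> combine to
  \<open>nabla_[X, Y] grad u\<close> by torsion-freeness, which completes the curvature
  operator.\<close>

lemma hessian_codazzi_defect:
  assumes u: "smooth_fun G U u" and X: "smooth_vfield G U X" and Y: "smooth_vfield G U Y"
    and Z: "smooth_vfield G U Z" and p: "p \<in> U"
  shows "cov_deriv2 G (hessian G u) X Y Z p - cov_deriv2 G (hessian G u) Y X Z p
    = met G p (Rm_field G X Y (grad G u) p) (Z p)"
proof -
  note gu = smooth_grad[OF u]
  note Zp = smooth_vfield_tangent[OF Z p]
  have d: "A p (\<lambda>q. hessian G u q (B q) (Z q)) = met G p (nabla G A (nabla G B (grad G u)) p) (Z p)
      + hessian G u p (B p) (nabla G A Z p)"
    if A: "smooth_vfield G U A" and B: "smooth_vfield G U B" for A B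
  proof -
    have "A p (\<lambda>q. hessian G u q (B q) (Z q)) = A p (\<lambda>q. met G q (nabla G B (grad G u) q) (Z q))"
      by (rule tangent_cong[OF smooth_vfield_tangent[OF A p] smooth_vfield_op[OF A] p])
         (rule hessian_eq[OF u B _ smooth_vfield_tangent[OF Z]])
    then show ?thesis
      unfolding hessian_eq[OF u B p smooth_vfield_tangent[OF nabla_smooth[OF A Z] p]]
      using nabla_metric[OF A nabla_smooth[OF B gu] Z p] by simp
  qed
  have "hessian G u p (nabla G X Y p) (Z p) - hessian G u p (nabla G Y X p) (Z p)
      = hessian G u p (lie_bracket G X Y p) (Z p)"
    unfolding nabla_torsion[OF X Y p, symmetric]
    by (rule tlinear_tminus[OF hessian_tlinear_left[OF u p Zp] smooth_vfield_tangent[OF nabla_smooth[OF X Y] p]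
          smooth_vfield_tangent[OF nabla_smooth[OF Y X] p], symmetric])
  also have "\<dots> = met G p (nabla G (lie_bracket G X Y) (grad G u) p) (Z p)"
    by (rule hessian_eq[OF u lie_bracket_smooth[OF X Y] p Zp])
  finally show ?thesis
    unfolding cov_deriv2_def d[OF X Y] d[OF Y X] met_Rm_field[OF X Y gu p Zp] by linarith
qed

end

section \<open>The wedge identity\<close>


context smooth_mfd
begin

section \<open>Traces in coordinates\<close>

lemma tlinear_expand:
  assumes c: "c \<in> atlas G" "p \<in> fst c" and F: "tlinear p F" and v: "v \<in> tangent G p"
  shows "F v = (\<Sum>i\<in>UNIV. v (\<lambda>q. snd c q $ i) * F (chart_deriv G c (axis i 1) p))"
proof -
  have "F v = F (chart_deriv G c (\<chi> i. v (\<lambda>q. snd c q $ i)) p)"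
    by (rule arg_cong[OF tangent_expand[OF c v]])
  also have "\<dots> = (\<Sum>i\<in>UNIV. (\<chi> i. v (\<lambda>q. snd c q $ i)) $ i * F (chart_deriv G c (axis i 1) p))"
    by (rule tlinear_chart[OF c F])
  finally show ?thesis by simp
qed

text \<open>A tangent vector expands through its values on the coordinate functions of either chart.
  Hence the two Jacobians are mutually inverse, which is \<open>\<delta>\<close>.\<close>

lemma chart_trace_change:
  assumes c: "c \<in> atlas G" "p \<in> fst c" and d: "d \<in> atlas G" "p \<in> fst d"
    and L: "\<And>v. v \<in> tangent G p \<Longrightarrow> L v \<in> tangent G p" "\<And>u. tlinear p (\<lambda>v. L v u)"
  shows "(\<Sum>j\<in>UNIV. L (chart_deriv G d (axis j 1) p) (\<lambda>q. snd d q $ j))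
    = (\<Sum>i\<in>UNIV. L (chart_deriv G c (axis i 1) p) (\<lambda>q. snd c q $ i))"
proof -
  let ?C = "\<lambda>i. chart_deriv G c (axis i 1) p" and ?x = "\<lambda>i q. snd c q $ i"
  let ?D = "\<lambda>j. chart_deriv G d (axis j 1) p" and ?y = "\<lambda>j q. snd d q $ j"
  have C: "?C i \<in> tangent G p" and D: "?D i \<in> tangent G p" for i
    by (rule chart_deriv_tangent[OF c] chart_deriv_tangent[OF d])+
  have LD: "L (?D j) u = (\<Sum>k\<in>UNIV. ?D j (?x k) * L (?C k) u)" for j u
    by (rule tlinear_expand[OF c L(2) D])
  have LC: "L (?C k) (?y j) = (\<Sum>l\<in>UNIV. L (?C k) (?x l) * ?C l (?y j))" for k j
    by (rule tlinear_expand[OF c tlinear_apply L(1)[OF C]])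
  have \<delta>: "(\<Sum>j\<in>UNIV. ?C l (?y j) * ?D j (?x k)) = (if k = l then 1 else 0)" for k l
  proof -
    have "(\<Sum>j\<in>UNIV. ?C l (?y j) * ?D j (?x k)) = ?C l (?x k)"
      by (rule tlinear_expand[OF d tlinear_apply C, symmetric])
    then show ?thesis by (simp add: chart_deriv_coord[OF c] axis_def)
  qed
  have "(\<Sum>j\<in>UNIV. L (?D j) (?y j))
      = (\<Sum>j\<in>UNIV. \<Sum>k\<in>UNIV. \<Sum>l\<in>UNIV. L (?C k) (?x l) * (?C l (?y j) * ?D j (?x k)))"
    unfolding LD LC by (simp add: sum_distrib_left mult_ac)
  also have "\<dots> = (\<Sum>k\<in>UNIV. \<Sum>j\<in>UNIV. \<Sum>l\<in>UNIV. L (?C k) (?x l) * (?C l (?y j) * ?D j (?x k)))"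
    by (rule sum.swap)
  also have "\<dots> = (\<Sum>k\<in>UNIV. \<Sum>l\<in>UNIV. \<Sum>j\<in>UNIV. L (?C k) (?x l) * (?C l (?y j) * ?D j (?x k)))"
    by (rule sum.cong[OF refl]) (rule sum.swap)
  also have "\<dots> = (\<Sum>k\<in>UNIV. L (?C k) (?x k))"
    unfolding sum_distrib_left[symmetric] \<delta> by (simp add: if_distrib[of "(*) a" for a :: real] cong: if_cong)
  finally show ?thesis .
qed

lemma tangent_trace_chart:
  assumes c: "c \<in> atlas G" "p \<in> fst c"
    and L: "\<And>v. v \<in> tangent G p \<Longrightarrow> L v \<in> tangent G p" "\<And>u. tlinear p (\<lambda>v. L v u)"
  shows "tangent_trace G p L = (\<Sum>i\<in>UNIV. L (chart_deriv G c (axis i 1) p) (\<lambda>q. snd c q $ i))"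
proof -
  define d where "d = (SOME c. c \<in> atlas G \<and> p \<in> fst c)"
  have "d \<in> atlas G \<and> p \<in> fst d" unfolding d_def by (rule someI[of _ c]) (use c in simp)
  then show ?thesis
    unfolding tangent_trace_def Let_def d_def[symmetric]
    by (intro chart_trace_change[OF c _ _ L]) simp_all
qed

end

text \<open>Index 1 and 2 stand for the arguments \<open>v\<close> and \<open>w\<close>;
  \<open>a\<close>, \<open>b\<close> are Ric of grad f and grad phi, \<open>c\<close>,
  \<open>d\<close> are Hess phi and Hess f of grad f, \<open>e\<close> is df, \<open>s\<close> is
  the differential of sigma, \<open>l\<close> is lam and \<open>t\<close> the Laplacian of f. Both
  \<open>l\<close> and \<open>t\<close> multiply \<open>e\<close> and cancel in the
  antisymmetrization.\<close>

lemma wedge_identity_algebra: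
  fixes a1 a2 b1 b2 c1 c2 d1 d2 e1 e2 f l m n s1 s2 t :: real
  assumes f: "f \<noteq> 0"
    and a: "a1 + c1 = l * e1 + m / f * d1" "a2 + c2 = l * e2 + m / f * d2"
    and b: "b1 - m / f * a1 = (1 - n) * s1 - (m / f\<^sup>2) * (d1 - e1 * t)"
      "b2 - m / f * a2 = (1 - n) * s2 - (m / f\<^sup>2) * (d2 - e2 * t)"
  shows "((m + n - 2) * a1 - f * b1 + (n - 2) * c1) * e2 - e1 * ((m + n - 2) * a2 - f * b2 + (n - 2) * c2)
    = (n - 1) * f * (s1 * e2 - s2 * e1 - (m / f\<^sup>2) * (e1 * d2 - e2 * d1))"
proof -
  \<comment> \<open>Writing \<open>m = k f\<close> clears the denominators and leaves a polynomial
    identity.\<close>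
  define k where "k = m / f"
  have m: "m = k * f" and mf: "m / f\<^sup>2 = k / f" using f by (simp_all add: k_def power2_eq_square)
  have c: "c1 = l * e1 + k * d1 - a1" "c2 = l * e2 + k * d2 - a2" using a unfolding k_def by linarith+
  have cancel: "f * (k / f * x) = k * x" for x using f by simp
  have "b1 = k * a1 + (1 - n) * s1 - k / f * (d1 - e1 * t)" "b2 = k * a2 + (1 - n) * s2 - k / f * (d2 - e2 * t)"
    using b unfolding mf k_def[symmetric] by linarith+
  then have fb: "f * b1 = f * (k * a1 + (1 - n) * s1) - k * (d1 - e1 * t)"
    "f * b2 = f * (k * a2 + (1 - n) * s2) - k * (d2 - e2 * t)"
    by (simp_all only: right_diff_distrib[of f] cancel)
  have rhs: "(n - 1) * f * (s1 * e2 - s2 * e1 - k / f * (e1 * d2 - e2 * d1))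
      = (n - 1) * (f * (s1 * e2 - s2 * e1) - k * (e1 * d2 - e2 * d1))"
    by (simp only: mult.assoc right_diff_distrib[of f] cancel)
  show ?thesis
    unfolding mf rhs c fb unfolding m by (simp add: algebra_simps)
qed

section \<open>Ricci and scalar curvature through the Ricci-Hessian equation\<close>

locale ricci_hessian_mfd = riem_mfd G for G :: "('a, 'n::finite) riem" +
  fixes f \<phi> lam :: "'a \<Rightarrow> real" and m :: nat
  assumes dim: "CARD('n) \<ge> 3"
    and type: "ricci_hessian_type G f \<phi> lam m"
begin

lemma smooth_f: "smooth_fun G (points G) f"
  and smooth_\<phi>: "smooth_fun G (points G) \<phi>"
  and smooth_lam: "smooth_fun G (points G) lam"
  and m_pos: "m > 0"
  and f_pos: "p \<in> points G \<Longrightarrow> f p > 0"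
  using type by (simp_all add: ricci_hessian_type_def)

lemma ricci_eq:
  assumes "v \<in> tangent G p" "w \<in> tangent G p"
  shows "ricci G p v w = lam p * met G p v w + (real m / f p) * hessian G f p v w - hessian G \<phi> p v w"
proof -
  have "ricci G p v w + hessian G \<phi> p v w = lam p * met G p v w + real m / f p * hessian G f p v w"
    using type assms tangent_points[OF assms(1)] unfolding ricci_hessian_type_def by blast
  then show ?thesis by linarith
qed

lemma ricci_sym:
  assumes v: "v \<in> tangent G p" and w: "w \<in> tangent G p"
  shows "ricci G p v w = ricci G p w v"
  unfolding ricci_eq[OF v w] ricci_eq[OF w v] met_sym[OF v w]
    hessian_sym[OF smooth_f tangent_points[OF v] v w] hessian_sym[OF smooth_\<phi> tangent_points[OF v] v w] ..

lemma ricci_tlinear_right: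
  assumes v: "v \<in> tangent G p"
  shows "tlinear p (\<lambda>w. ricci G p v w)"
proof (rule tlinear_cong)
  note p = tangent_points[OF v]
  show "tlinear p (\<lambda>w. 1 * (lam p * met G p v w + (real m / f p) * hessian G f p v w) + (- 1) * hessian G \<phi> p v w)"
    by (intro tlinear_lincomb met_tlinear_right[OF v] hessian_tlinear_right[OF smooth_f p v] hessian_tlinear_right[OF smooth_\<phi> p v])
  show "1 * (lam p * met G p v w + (real m / f p) * hessian G f p v w) + (- 1) * hessian G \<phi> p v w = ricci G p v w"
    if "w \<in> tangent G p" for w
    using ricci_eq[OF v that] by simp
qed

lemma ricci_tlinear_left:
  assumes w: "w \<in> tangent G p"
  shows "tlinear p (\<lambda>v. ricci G p v w)"
  by (rule tlinear_cong[OF ricci_tlinear_right[OF w]]) (rule ricci_sym[OF w])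

lemma ricci_smooth:
  assumes X: "smooth_vfield G U X" and Y: "smooth_vfield G U Y"
  shows "smooth_fun G U (\<lambda>p. ricci G p (X p) (Y p))"
proof -
  have U: "op U" "U \<subseteq> points G" using smooth_vfield_op[OF X] openin_subset by auto
  have sf: "smooth_fun G U f" and s\<phi>: "smooth_fun G U \<phi>" and sl: "smooth_fun G U lam"
    by (rule smooth_fun_subset[OF _ U], rule smooth_f smooth_\<phi> smooth_lam)+
  have f0: "f p \<noteq> 0" if "p \<in> U" for p using f_pos[OF subsetD[OF U(2) that]] by simp
  have h: "smooth_fun G U (\<lambda>p. real m / f p)"
    by (rule smooth_fun_divide[OF smooth_fun_const[OF U(1)] sf]) (rule f0)
  have "smooth_fun G U (\<lambda>p. lam p * met G p (X p) (Y p) + (real m / f p) * hessian G f p (X p) (Y p) - hessian G \<phi> p (X p) (Y p))"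
    by (rule smooth_fun_diff[OF smooth_fun_add[OF smooth_fun_mult[OF sl met_smooth[OF X Y]]
          smooth_fun_mult[OF h hessian_smooth[OF sf X Y]]] hessian_smooth[OF s\<phi> X Y]])
  then show ?thesis
  proof (rule smooth_fun_cong)
    fix p assume p: "p \<in> U"
    show "lam p * met G p (X p) (Y p) + (real m / f p) * hessian G f p (X p) (Y p) - hessian G \<phi> p (X p) (Y p)
        = ricci G p (X p) (Y p)"
      by (rule ricci_eq[OF smooth_vfield_tangent[OF X p] smooth_vfield_tangent[OF Y p], symmetric])
  qed
qed

lemma ricci_endo_tangent: "v \<in> tangent G p \<Longrightarrow> ricci_endo G p v \<in> tangent G p"
  unfolding ricci_endo_def by (rule sharp_tangent[OF tangent_points ricci_tlinear_right])

lemma met_ricci_endo: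
  "v \<in> tangent G p \<Longrightarrow> w \<in> tangent G p \<Longrightarrow> met G p (ricci_endo G p v) w = ricci G p v w"
  unfolding ricci_endo_def by (rule met_sharp[OF ricci_tlinear_right])

lemma ricci_endo_comb:
  assumes v: "v \<in> tangent G p" and w: "w \<in> tangent G p"
  shows "ricci_endo G p (tplus (tscale a v) (tscale b w))
    = tplus (tscale a (ricci_endo G p v)) (tscale b (ricci_endo G p w))"
proof (rule met_ext)
  note t = tangent_comb[OF v w, of a b]
  note rv = ricci_endo_tangent[OF v] and rw = ricci_endo_tangent[OF w]
  show "ricci_endo G p (tplus (tscale a v) (tscale b w)) \<in> tangent G p"
    by (rule ricci_endo_tangent[OF t])
  show "tplus (tscale a (ricci_endo G p v)) (tscale b (ricci_endo G p w)) \<in> tangent G p"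
    by (rule tangent_comb[OF rv rw])
  fix z assume z: "z \<in> tangent G p"
  show "met G p (ricci_endo G p (tplus (tscale a v) (tscale b w))) z
      = met G p (tplus (tscale a (ricci_endo G p v)) (tscale b (ricci_endo G p w))) z"
    unfolding met_ricci_endo[OF t z] tlinearD[OF met_tlinear_left[OF z] rv rw] met_ricci_endo[OF v z] met_ricci_endo[OF w z]
    by (rule tlinearD[OF ricci_tlinear_left[OF z] v w])
qed

lemma ricci_endo_tlinear: "tlinear p (\<lambda>v. ricci_endo G p v u)"
  unfolding tlinear_def by (simp add: ricci_endo_comb) (simp add: tplus_def tscale_def)

text \<open>\<open>tangent_trace\<close> chooses a chart at each point separately, so that smoothness needs the
  independence of the trace from the chart.\<close>

lemma scalar_curvature_smooth: "smooth_fun G (points G) (scalar_curvature G)"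
proof (rule smooth_fun_local[OF openin_topspace])
  fix p assume "p \<in> points G"
  then obtain c where c: "c \<in> atlas G" "p \<in> fst c" using ex_chart by blast
  have U: "op (fst c)" by (rule op_chart[OF c(1)])
  have E: "smooth_vfield G (fst c) (chart_deriv G c a)" for a by (rule smooth_vfield_chart_deriv[OF c(1)])
  have "smooth_vfield G (fst c) (\<lambda>q. sharp G q (ricci G q (chart_deriv G c (axis i 1) q)))" for i
  proof (rule smooth_sharp[OF c(1) U order_refl])
    show "tlinear q (ricci G q (chart_deriv G c (axis i 1) q))" if "q \<in> fst c" for q
      using ricci_tlinear_right[OF chart_deriv_tangent[OF c(1) that]] .
    show "smooth_fun G (fst c) (\<lambda>q. ricci G q (chart_deriv G c (axis i 1) q) (chart_deriv G c (axis j 1) q))" for j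
      by (rule ricci_smooth[OF E E])
  qed
  then have "smooth_fun G (fst c) (\<lambda>q. sharp G q (ricci G q (chart_deriv G c (axis i 1) q)) (\<lambda>q. snd c q $ i))" for i
    by (rule smooth_vfield_fun[OF _ smooth_fun_coord[OF c(1)]])
  then have "smooth_fun G (fst c) (\<lambda>q. \<Sum>i\<in>UNIV. sharp G q (ricci G q (chart_deriv G c (axis i 1) q)) (\<lambda>q. snd c q $ i))"
    by (rule smooth_fun_sum[OF U])
  then have "smooth_fun G (fst c) (scalar_curvature G)"
  proof (rule smooth_fun_cong)
    fix q assume q: "q \<in> fst c"
    have "tangent_trace G q (ricci_endo G q)
        = (\<Sum>i\<in>UNIV. ricci_endo G q (chart_deriv G c (axis i 1) q) (\<lambda>q. snd c q $ i))"
      by (rule tangent_trace_chart[OF c(1) q]) (rule ricci_endo_tangent ricci_endo_tlinear, assumption?)+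
    then show "(\<Sum>i\<in>UNIV. sharp G q (ricci G q (chart_deriv G c (axis i 1) q)) (\<lambda>q. snd c q $ i)) = scalar_curvature G q"
      unfolding scalar_curvature_def ricci_endo_def by (rule sym)
  qed
  then show "\<exists>V. p \<in> V \<and> smooth_fun G V (scalar_curvature G)" using c(2) by blast
qed

section \<open>The Codazzi equation and its contractions\<close>

definition \<sigma> :: "'a \<Rightarrow> real" where
  "\<sigma> p = lam p - scalar_curvature G p / (2 * (real CARD('n) - 1))"

definition \<rho> :: "'a \<Rightarrow> real" where
  "\<rho> p = real m / f p"

lemma smooth_\<sigma>: "smooth_fun G (points G) \<sigma>"
proof -
  have "smooth_fun G (points G) (\<lambda>p. lam p - scalar_curvature G p / (2 * (real CARD('n) - 1)))"
    using dim by (intro smooth_fun_diff[OF smooth_lam] smooth_fun_divide[OF scalar_curvature_smooth] smooth_fun_const) auto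
  then show ?thesis unfolding \<sigma>_def[abs_def] .
qed

lemma smooth_\<rho>: "smooth_fun G (points G) \<rho>"
proof -
  have "f p \<noteq> 0" if "p \<in> points G" for p using f_pos[OF that] by simp
  then have "smooth_fun G (points G) (\<lambda>p. real m / f p)"
    by (rule smooth_fun_divide[OF smooth_fun_const[OF openin_topspace] smooth_f])
  then show ?thesis unfolding \<rho>_def[abs_def] .
qed

text \<open>Leibniz rule for the constant product \<open>\<rho> f = m\<close>.\<close>

lemma tangent_\<rho>:
  assumes v: "v \<in> tangent G p"
  shows "v \<rho> = - (real m / (f p)\<^sup>2) * v f"
proof -
  have p: "p \<in> points G" by (rule tangent_points[OF v])
  have "v (\<lambda>q. \<rho> q * f q) = v \<rho> * f p + \<rho> p * v f"
    by (rule tangent_mult[OF v smooth_nearI[OF smooth_\<rho> p] smooth_nearI[OF smooth_f p]])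
  moreover have "v (\<lambda>q. \<rho> q * f q) = v (\<lambda>q. real m)"
  proof (rule tangent_cong[OF v openin_topspace p])
    fix q assume "q \<in> points G"
    then show "\<rho> q * f q = real m" using f_pos[of q] by (simp add: \<rho>_def)
  qed
  ultimately have "v \<rho> * f p = - (\<rho> p * v f)" by (simp add: tangent_const[OF v])
  then show ?thesis using f_pos[OF p] by (simp add: \<rho>_def power2_eq_square field_simps)
qed

lemma schouten_eq:
  assumes v: "v \<in> tangent G p" and w: "w \<in> tangent G p"
  shows "schouten G p v w = 1 / (real CARD('n) - 2) *
    (\<sigma> p * met G p v w + \<rho> p * hessian G f p v w - hessian G \<phi> p v w)"
  unfolding schouten_def ricci_eq[OF v w] \<sigma>_def \<rho>_def by (simp add: algebra_simps)

text \<open>The metric is parallel, so its term contributes only the derivative of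
  \<open>\<sigma>\<close>.\<close>

lemma cov_deriv2_schouten:
  assumes X: "smooth_vfield G U X" and Y: "smooth_vfield G U Y" and Z: "smooth_vfield G U Z" and p: "p \<in> U"
  shows "cov_deriv2 G (schouten G) X Y Z p = 1 / (real CARD('n) - 2) *
    (X p \<sigma> * met G p (Y p) (Z p) + X p \<rho> * hessian G f p (Y p) (Z p)
      + \<rho> p * cov_deriv2 G (hessian G f) X Y Z p - cov_deriv2 G (hessian G \<phi>) X Y Z p)"
proof -
  let ?k = "1 / (real CARD('n) - 2)"
  have U: "op U" "U \<subseteq> points G" using smooth_vfield_op[OF X] openin_subset by auto
  note S = smooth_fun_subset[OF _ U]
  note Xp = smooth_vfield_tangent[OF X p] and Yp = smooth_vfield_tangent[OF Y p] and Zp = smooth_vfield_tangent[OF Z p]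
    and XY = smooth_vfield_tangent[OF nabla_smooth[OF X Y] p] and XZ = smooth_vfield_tangent[OF nabla_smooth[OF X Z] p]
  let ?g = "\<lambda>q. met G q (Y q) (Z q)" and ?F = "\<lambda>q. hessian G f q (Y q) (Z q)" and ?P = "\<lambda>q. hessian G \<phi> q (Y q) (Z q)"
  have n\<sigma>: "smooth_near G p \<sigma>" and n\<rho>: "smooth_near G p \<rho>"
    by (rule smooth_nearI[OF S[OF smooth_\<sigma>] p] smooth_nearI[OF S[OF smooth_\<rho>] p])+
  have ng: "smooth_near G p ?g" by (rule smooth_nearI[OF met_smooth[OF Y Z] p])
  have nF: "smooth_near G p ?F" by (rule smooth_nearI[OF hessian_smooth[OF S[OF smooth_f] Y Z] p])
  have nP: "smooth_near G p ?P" by (rule smooth_nearI[OF hessian_smooth[OF S[OF smooth_\<phi>] Y Z] p])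
  note n1 = smooth_near_mult[OF n\<sigma> ng] and n2 = smooth_near_mult[OF n\<rho> nF]
  have "X p (\<lambda>q. schouten G q (Y q) (Z q)) = X p (\<lambda>q. ?k * (\<sigma> q * ?g q + \<rho> q * ?F q - ?P q))"
    by (rule tangent_cong[OF Xp U(1) p]) (rule schouten_eq[OF smooth_vfield_tangent[OF Y] smooth_vfield_tangent[OF Z]])
  also have "\<dots> = ?k * X p (\<lambda>q. \<sigma> q * ?g q + \<rho> q * ?F q - ?P q)"
    by (rule tangent_cmult[OF Xp smooth_near_diff[OF smooth_near_add[OF n1 n2] nP]])
  also have "X p (\<lambda>q. \<sigma> q * ?g q + \<rho> q * ?F q - ?P q) = X p (\<lambda>q. \<sigma> q * ?g q + \<rho> q * ?F q) - X p ?P"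
    by (rule tangent_diff[OF Xp smooth_near_add[OF n1 n2] nP])
  also have "X p (\<lambda>q. \<sigma> q * ?g q + \<rho> q * ?F q) = X p (\<lambda>q. \<sigma> q * ?g q) + X p (\<lambda>q. \<rho> q * ?F q)"
    by (rule tangent_add[OF Xp n1 n2])
  also have "X p (\<lambda>q. \<sigma> q * ?g q) = X p \<sigma> * ?g p + \<sigma> p * X p ?g"
    by (rule tangent_mult[OF Xp n\<sigma> ng])
  also have "X p (\<lambda>q. \<rho> q * ?F q) = X p \<rho> * ?F p + \<rho> p * X p ?F"
    by (rule tangent_mult[OF Xp n\<rho> nF])
  finally show ?thesis
    unfolding cov_deriv2_def schouten_eq[OF XY Zp] schouten_eq[OF Yp XZ] nabla_metric[OF X Y Z p]
    by (simp add: algebra_simps)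
qed

lemma curvature_identity:
  assumes cod: "codazzi G (schouten G)"
    and x: "x \<in> tangent G p" and y: "y \<in> tangent G p" and z: "z \<in> tangent G p"
  shows "met G p (Rm G p x y (grad G \<phi> p)) z = x \<sigma> * met G p y z - y \<sigma> * met G p x z
    + x \<rho> * hessian G f p y z - y \<rho> * hessian G f p x z + \<rho> p * met G p (Rm G p x y (grad G f p)) z"
proof -
  have p: "p \<in> points G" by (rule tangent_points[OF x])
  obtain D where D: "p \<in> D" "op D" "D \<subseteq> points G" "\<And>i. i \<in> {x, y, z} \<Longrightarrow> smooth_vfield G D (extend G p i)"
    using extend_common[of "{x, y, z}" "\<lambda>v. v" p "points G"] x y z p openin_topspace by blast
  let ?X = "extend G p x" and ?Y = "extend G p y" and ?Z = "extend G p z"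
  have X: "smooth_vfield G D ?X" and Y: "smooth_vfield G D ?Y" and Z: "smooth_vfield G D ?Z" using D(4) by simp_all
  have ex: "?X p = x" using extend_props[OF x] .
  have ey: "?Y p = y" using extend_props[OF y] .
  have ez: "?Z p = z" using extend_props[OF z] .
  note sf = smooth_fun_subset[OF smooth_f D(2,3)] and s\<phi> = smooth_fun_subset[OF smooth_\<phi> D(2,3)]
  have "cov_deriv2 G (schouten G) ?X ?Y ?Z p = cov_deriv2 G (schouten G) ?Y ?X ?Z p"
    using cod X Y Z D(1) unfolding codazzi_def by blast
  then have "x \<sigma> * met G p y z + x \<rho> * hessian G f p y z
      + \<rho> p * cov_deriv2 G (hessian G f) ?X ?Y ?Z p - cov_deriv2 G (hessian G \<phi>) ?X ?Y ?Z p
    = y \<sigma> * met G p x z + y \<rho> * hessian G f p x z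
      + \<rho> p * cov_deriv2 G (hessian G f) ?Y ?X ?Z p - cov_deriv2 G (hessian G \<phi>) ?Y ?X ?Z p"
    \<comment> \<open>The common factor \<open>1 / (n - 2)\<close> can be cancelled because
      \<open>n \<ge> 3\<close>.\<close>
    unfolding cov_deriv2_schouten[OF X Y Z D(1)] cov_deriv2_schouten[OF Y X Z D(1)] ex ey ez using dim by simp
  moreover have "cov_deriv2 G (hessian G u) ?X ?Y ?Z p
      = cov_deriv2 G (hessian G u) ?Y ?X ?Z p + met G p (Rm G p x y (grad G u p)) z"
    if u: "smooth_fun G D u" for u
    using hessian_codazzi_defect[OF u X Y Z D(1)]
    unfolding ez Rm_eq[OF x y smooth_grad[OF u] D(1)] by linarith
  ultimately show ?thesis using sf s\<phi> by (simp add: algebra_simps)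
qed

text \<open>\<open>t\<close> is the Laplacian of \<open>f\<close>, the same for all
  \<open>y\<close>. It occurs only as a multiple of \<open>y f\<close>, so the wedge product with df
  removes it and its value may stay hidden.\<close>

lemma ricci_trace_identity:
  assumes cod: "codazzi G (schouten G)" and y: "y \<in> tangent G p"
  shows "\<exists>t. \<forall>y\<in>tangent G p. ricci G p y (grad G \<phi> p) - \<rho> p * ricci G p y (grad G f p)
    = (1 - real CARD('n)) * y \<sigma> - (real m / (f p)\<^sup>2) * (hessian G f p y (grad G f p) - y f * t)"
proof -
  have p: "p \<in> points G" by (rule tangent_points[OF y])
  have gf: "grad G f p \<in> tangent G p" and g\<phi>: "grad G \<phi> p \<in> tangent G p" by (rule grad_tangent[OF p])+
  \<comment> \<open>Exactly the chart chosen in \<open>tangent_trace\<close>: then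
    \<open>ricci\<close> unfolds to a sum over this chart, and no linearity of \<open>Rm\<close> in
    the traced slot is called for.\<close>
  define c where "c = (SOME c. c \<in> atlas G \<and> p \<in> fst c)"
  have c: "c \<in> atlas G" "p \<in> fst c"
    using someI_ex[of "\<lambda>c. c \<in> atlas G \<and> p \<in> fst c"] ex_chart[OF p] unfolding c_def by blast+
  let ?E = "\<lambda>i. chart_deriv G c (axis i 1) p" and ?x = "\<lambda>i q. snd c q $ i"
  have E: "?E i \<in> tangent G p" for i by (rule chart_deriv_tangent[OF c])
  \<comment> \<open>The Hessian of \<open>f\<close> as an endomorphism.\<close>
  define H where "H v = sharp G p (hessian G f p v)" for v
  have H: "H v \<in> tangent G p" and metH: "\<And>w. w \<in> tangent G p \<Longrightarrow> met G p (H v) w = hessian G f p v w"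
    if v: "v \<in> tangent G p" for v
    unfolding H_def using sharp_tangent[OF p hessian_tlinear_right[OF smooth_f p v]]
      met_sharp[OF hessian_tlinear_right[OF smooth_f p v]] by auto
  have contract: "(\<Sum>i\<in>UNIV. ?E i u * v (?x i)) = v u" if v: "v \<in> tangent G p" for u v
    unfolding mult.commute[of "?E _ u"] by (rule tlinear_expand[OF c tlinear_apply v, symmetric])
  show ?thesis
  proof (intro exI ballI)
    fix y assume y: "y \<in> tangent G p"
    \<comment> \<open>A trace evaluates \<open>Rm\<close> on coordinate functions, so the test
      vector \<open>z\<close> of \<open>curvature_identity\<close> is first removed by
      nondegeneracy.\<close>
    have vec: "Rm G p x y (grad G \<phi> p) u = x \<sigma> * y u - y \<sigma> * x u + x \<rho> * H y u - y \<rho> * H x u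
        + \<rho> p * Rm G p x y (grad G f p) u" if x: "x \<in> tangent G p" for x u
    proof -
      let ?A = "tplus (tscale (x \<sigma>) y) (tscale (- y \<sigma>) x)"
      let ?B = "tplus (tscale (x \<rho>) (H y)) (tscale (- y \<rho>) (H x))"
      let ?C = "tscale (\<rho> p) (Rm G p x y (grad G f p))"
      have Rf: "Rm G p x y (grad G f p) \<in> tangent G p" and R\<phi>: "Rm G p x y (grad G \<phi> p) \<in> tangent G p"
        by (rule Rm_skew(1)[OF x y _ x], rule gf g\<phi>)+
      have A: "?A \<in> tangent G p" by (rule tangent_comb[OF y x])
      have B: "?B \<in> tangent G p" by (rule tangent_comb[OF H[OF y] H[OF x]])
      have C: "?C \<in> tangent G p" by (rule tangent_tscale[OF Rf])
      have AB: "tplus ?A ?B \<in> tangent G p" by (rule tangent_tplus[OF A B])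
      have "Rm G p x y (grad G \<phi> p) = tplus (tplus ?A ?B) ?C"
      proof (rule met_ext[OF R\<phi> tangent_tplus[OF AB C]])
        fix z assume z: "z \<in> tangent G p"
        note L = met_tlinear_left[OF z]
        show "met G p (Rm G p x y (grad G \<phi> p)) z = met G p (tplus (tplus ?A ?B) ?C) z"
          unfolding curvature_identity[OF cod x y z] tlinear_tplus[OF L AB C] tlinear_tplus[OF L A B]
            tlinearD[OF L y x] tlinearD[OF L H[OF y] H[OF x]] tlinear_tscale[OF L Rf] metH[OF y z] metH[OF x z]
          by simp
      qed
      then show ?thesis by (simp add: tplus_def tscale_def)
    qed
    have ric: "ricci G p y z = (\<Sum>i\<in>UNIV. Rm G p (?E i) y z (?x i))" for z
      unfolding ricci_def tangent_trace_def Let_def c_def[symmetric] ..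
    have one: "(\<Sum>i\<in>UNIV. ?E i (?x i)) = real CARD('n)"
      by (simp add: chart_deriv_coord[OF c])
    have "ricci G p y (grad G \<phi> p) = (\<Sum>i\<in>UNIV. ?E i \<sigma> * y (?x i)) - y \<sigma> * (\<Sum>i\<in>UNIV. ?E i (?x i))
        + (\<Sum>i\<in>UNIV. ?E i \<rho> * H y (?x i)) - y \<rho> * (\<Sum>i\<in>UNIV. H (?E i) (?x i))
        + \<rho> p * ricci G p y (grad G f p)"
      unfolding ric vec[OF E] by (simp add: sum.distrib sum_subtractf sum_distrib_left)
    \<comment> \<open>Contracting the differential of \<open>\<sigma>\<close> against
      \<open>y\<close> returns one copy of \<open>y \<sigma>\<close>, while the trace of the
      identity counts \<open>n\<close> copies; this is the source of \<open>1 - n\<close>.\<close>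
    also have "\<dots> = y \<sigma> - y \<sigma> * real CARD('n) + H y \<rho> - y \<rho> * (\<Sum>i\<in>UNIV. H (?E i) (?x i))
        + \<rho> p * ricci G p y (grad G f p)"
      unfolding one contract[OF y] contract[OF H[OF y]] ..
    finally have *: "ricci G p y (grad G \<phi> p) = y \<sigma> - y \<sigma> * real CARD('n) + H y \<rho>
        - y \<rho> * (\<Sum>i\<in>UNIV. H (?E i) (?x i)) + \<rho> p * ricci G p y (grad G f p)" .
    have "H y f = hessian G f p y (grad G f p)"
      using met_grad[OF H[OF y], of f] met_sym[OF gf H[OF y]] metH[OF y gf] by simp
    then show "ricci G p y (grad G \<phi> p) - \<rho> p * ricci G p y (grad G f p)
        = (1 - real CARD('n)) * y \<sigma> - (real m / (f p)\<^sup>2) * (hessian G f p y (grad G f p) - y f * (\<Sum>i\<in>UNIV. H (?E i) (?x i)))"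
      unfolding * tangent_\<rho>[OF y] tangent_\<rho>[OF H[OF y]] by (simp add: algebra_simps)
  qed
qed

lemma wedge_identity:
  assumes cod: "codazzi G (schouten G)"
    and v: "v \<in> tangent G p" and w: "w \<in> tangent G p"
  shows "wedge (\<lambda>z. (real m + real CARD('n) - 2) * ricci G p (grad G f p) z
                    - f p * ricci G p (grad G \<phi> p) z
                    + (real CARD('n) - 2) * hessian G \<phi> p (grad G f p) z)
               (differential f p) v w
    = (real CARD('n) - 1) * f p * curvature_form G p (grad G \<phi> p) (grad G f p) v w"
proof -
  have p: "p \<in> points G" by (rule tangent_points[OF v])
  have gf: "grad G f p \<in> tangent G p" and g\<phi>: "grad G \<phi> p \<in> tangent G p" by (rule grad_tangent[OF p])+
  obtain t where t: "\<And>y. y \<in> tangent G p \<Longrightarrow> ricci G p y (grad G \<phi> p) - \<rho> p * ricci G p y (grad G f p)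
    = (1 - real CARD('n)) * y \<sigma> - (real m / (f p)\<^sup>2) * (hessian G f p y (grad G f p) - y f * t)"
    using ricci_trace_identity[OF cod v] by blast
  have a: "ricci G p (grad G f p) y + hessian G \<phi> p (grad G f p) y = lam p * y f + real m / f p * hessian G f p y (grad G f p)"
    if y: "y \<in> tangent G p" for y
    unfolding ricci_eq[OF gf y] met_grad[OF y] hessian_sym[OF smooth_f p y gf] by simp
  have b: "ricci G p (grad G \<phi> p) y - real m / f p * ricci G p (grad G f p) y
      = (1 - real CARD('n)) * y \<sigma> - (real m / (f p)\<^sup>2) * (hessian G f p y (grad G f p) - y f * t)"
    if y: "y \<in> tangent G p" for y
    using t[OF y] unfolding ricci_sym[OF y gf] ricci_sym[OF y g\<phi>] \<rho>_def .
  \<comment> \<open>By skew-symmetry, pairing the curvature identity with grad f kills its term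
    \<open>\<rho> Rm(v, w) grad f\<close>.\<close>
  have "met G p (Rm G p v w (grad G f p)) (grad G f p) = 0"
    using Rm_skew(2)[OF v w gf gf] by simp
  then have \<Omega>: "curvature_form G p (grad G \<phi> p) (grad G f p) v w
      = v \<sigma> * w f - w \<sigma> * v f - (real m / (f p)\<^sup>2) * (v f * hessian G f p w (grad G f p) - w f * hessian G f p v (grad G f p))"
    unfolding curvature_form_def curvature_identity[OF cod v w gf] tangent_\<rho>[OF v] tangent_\<rho>[OF w]
      met_sym[OF v gf] met_sym[OF w gf] met_grad[OF v] met_grad[OF w]
    by (simp add: algebra_simps)
  have f0: "f p \<noteq> 0" using f_pos[OF p] by simp
  show ?thesis
    unfolding wedge_def differential_def \<Omega>
    by (rule wedge_identity_algebra[OF f0 a[OF v] a[OF w] b[OF v] b[OF w]])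
qed

end

section \<open>The eigenvector property\<close>


text \<open>On a segment in direction \<open>a\<close> the image is an interval. If it were
  negligible it would be a point, so \<open>F\<close> would be constant there and its derivative
  along \<open>a\<close> zero.\<close>

lemma nonconstant_image_not_negligible:
  fixes F :: "'a::real_normed_vector \<Rightarrow> real"
  assumes W: "open W" "x \<in> W" and F: "continuous_on W F" "F differentiable (at x)"
    and a: "frechet_derivative F (at x) a \<noteq> 0"
  shows "\<not> negligible (F ` W)"
proof
  assume neg: "negligible (F ` W)"
  let ?l = "\<lambda>t. x + t *\<^sub>R a"
  have "open (?l -` W)"
    by (rule open_vimage[OF W(1)]) (intro continuous_intros)
  moreover have "0 \<in> ?l -` W" using W(2) by simp
  ultimately obtain e where e: "e > 0" "ball 0 e \<subseteq> ?l -` W"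
    using open_contains_ball by metis
  have cont: "continuous_on (ball 0 e) (\<lambda>t. F (?l t))"
    using e(2) by (intro continuous_on_compose2[OF F(1)] continuous_intros) auto
  have const: "F (?l t) = F x" if t: "t \<in> ball 0 e" for t
  proof (rule ccontr)
    assume ne: "F (?l t) \<noteq> F x"
    let ?J = "(\<lambda>t. F (?l t)) ` ball 0 e"
    have J: "connected ?J" by (rule connected_continuous_image[OF cont]) (rule convex_connected[OF convex_ball])
    have x: "F x \<in> ?J" using e(1) by (intro image_eqI[of _ _ 0]) auto
    have y: "F (?l t) \<in> ?J" using t by blast
    have "{min (F x) (F (?l t))..max (F x) (F (?l t))} \<subseteq> ?J"
      by (rule connected_contains_Icc[OF J]) (use x y in \<open>auto simp: min_def max_def\<close>)
    also have "?J \<subseteq> F ` W" using e(2) by auto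
    finally have "negligible (cbox (min (F x) (F (?l t))) (max (F x) (F (?l t))))"
      unfolding cbox_interval by (rule negligible_subset[OF neg])
    then have "box (min (F x) (F (?l t))) (max (F x) (F (?l t))) = {}"
      unfolding negligible_interval .
    then show False using ne by (auto simp: box_real min_def max_def split: if_splits)
  qed
  have "((\<lambda>t. F (?l t)) has_derivative (\<lambda>t. frechet_derivative F (at x) (t *\<^sub>R a))) (at 0)"
  proof (rule has_derivative_compose[of ?l "\<lambda>t. t *\<^sub>R a" 0 UNIV F])
    show "(?l has_derivative (\<lambda>t. t *\<^sub>R a)) (at 0)" by (auto intro!: derivative_eq_intros)
    show "(F has_derivative frechet_derivative F (at x)) (at (x + 0 *\<^sub>R a))"
      using F(2)[unfolded frechet_derivative_works] by simp
  qed
  moreover have "((\<lambda>t. F (?l t)) has_derivative (\<lambda>t. 0)) (at 0)"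
    by (rule has_derivative_transform_within_open[OF has_derivative_const[of "F x"] open_ball[of 0 e]])
       (use e(1) const in auto)
  ultimately have "(\<lambda>t. frechet_derivative F (at x) (t *\<^sub>R a)) = (\<lambda>t. 0)"
    by (rule has_derivative_unique)
  from fun_cong[OF this, of 1] show False using a by simp
qed

section \<open>Critical and regular values on the manifold\<close>

context smooth_mfd
begin

definition critical :: "('a \<Rightarrow> real) \<Rightarrow> 'a set" where
  "critical u = {p \<in> points G. \<forall>v\<in>tangent G p. v u = 0}"

text \<open>Sard's theorem in each chart; second countability selects countably many charts that
  cover the manifold.\<close>

lemma negligible_critical_values:
  assumes u: "smooth_fun G (points G) u"
  shows "negligible (u ` critical u)"
proof -
  have chart: "negligible (u ` (critical u \<inter> fst c))" if c: "c \<in> atlas G" for c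
  proof -
    let ?V = "snd c ` (points G \<inter> fst c)" and ?F = "u \<circ> chart_inv c"
    have V: "open ?V" by (rule open_chart_image[OF c openin_topspace])
    have "negligible (?F ` {x \<in> ?V. \<forall>h. frechet_derivative ?F (at x) h = 0})"
      by (rule sard_real[OF V smooth_fun_chart[OF u c]])
    moreover have "u ` (critical u \<inter> fst c) \<subseteq> ?F ` {x \<in> ?V. \<forall>h. frechet_derivative ?F (at x) h = 0}"
    proof clarify
      fix p assume p: "p \<in> critical u" "p \<in> fst c"
      then have pM: "p \<in> points G" by (simp add: critical_def)
      have "frechet_derivative ?F (at (snd c p)) h = 0" for h
      proof -
        have "chart_deriv G c h p u = 0"
          using p(1) chart_deriv_tangent[OF c p(2)] by (simp add: critical_def)
        then show ?thesis by (simp add: chart_deriv_apply[OF smooth_nearI[OF u pM]])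
      qed
      then show "u p \<in> ?F ` {x \<in> ?V. \<forall>h. frechet_derivative ?F (at x) h = 0}"
        using pM p(2) c by (intro image_eqI[of _ _ "snd c p"]) auto
    qed
    ultimately show ?thesis by (rule negligible_subset)
  qed
  have "Lindelof_space (topol G)"
    by (rule second_countable_imp_Lindelof_space) (use smooth_mfd in \<open>simp add: smooth_manifold_def\<close>)
  moreover have "\<Union> (fst ` atlas G) = points G"
    using smooth_mfd by (simp add: smooth_manifold_def)
  moreover have "op U" if "U \<in> fst ` atlas G" for U using that op_chart by auto
  ultimately obtain \<V> where \<V>: "countable \<V>" "\<V> \<subseteq> fst ` atlas G" "\<Union>\<V> = points G"
    using Lindelof_spaceD[of "topol G" "fst ` atlas G"] by auto
  have "negligible (\<Union>U\<in>\<V>. u ` (critical u \<inter> U))"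
    using \<V>(1,2) chart by (intro negligible_countable_Union) auto
  moreover have "u ` critical u \<subseteq> (\<Union>U\<in>\<V>. u ` (critical u \<inter> U))"
  proof clarify
    fix p assume p: "p \<in> critical u"
    then have "p \<in> \<Union>\<V>" unfolding \<V>(3) by (simp add: critical_def)
    then show "u p \<in> (\<Union>U\<in>\<V>. u ` (critical u \<inter> U))" using p by blast
  qed
  ultimately show ?thesis by (rule negligible_subset)
qed

lemma regular_value_iff: "regular_value G u k \<longleftrightarrow> k \<notin> u ` critical u"
  by (auto simp: regular_value_def critical_def level_set_def differential_def)

text \<open>Otherwise \<open>u\<close> would map all of \<open>V\<close> into its critical values, a
  negligible set, although \<open>u\<close> has nonzero differential at a point of
  \<open>V\<close>.\<close>

lemma regular_values_dense:
  assumes u: "smooth_fun G (points G) u" and V: "op V" "p \<in> V"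
    and v: "v \<in> tangent G p" "v u \<noteq> 0"
  shows "\<exists>q\<in>V. regular_value G u (u q)"
proof (rule ccontr)
  assume "\<not> (\<exists>q\<in>V. regular_value G u (u q))"
  then have *: "u ` V \<subseteq> u ` critical u" by (auto simp: regular_value_iff)
  have p: "p \<in> points G" by (rule tangent_points[OF v(1)])
  obtain c where c: "c \<in> atlas G" "p \<in> fst c" using ex_chart[OF p] by blast
  obtain a where a: "v = chart_deriv G c a p" using v(1) tangent_chart[OF c] by auto
  let ?W = "snd c ` (V \<inter> fst c)" and ?F = "u \<circ> chart_inv c"
  have "V \<subseteq> points G" by (rule openin_subset[OF V(1)])
  then have F: "smooth_on ?F ?W"
    using smooth_fun_chart[OF smooth_fun_subset[OF u V(1)] c(1)] by simp
  have "\<not> negligible (?F ` ?W)"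
  proof (rule nonconstant_image_not_negligible[OF open_chart_image[OF c(1) V(1)] _ smooth_on_imp_continuous_on[OF F]])
    show "snd c p \<in> ?W" using V(2) c(2) by blast
    show "?F differentiable (at (snd c p))"
      by (rule chart_differentiable[OF c smooth_nearI[OF u p]])
    show "frechet_derivative ?F (at (snd c p)) a \<noteq> 0"
      using v(2) unfolding a chart_deriv_apply[OF smooth_nearI[OF u p]] .
  qed
  moreover have "?F ` ?W \<subseteq> u ` V" using c(1) by auto
  then have "negligible (?F ` ?W)"
    by (rule negligible_subset[OF negligible_critical_values[OF u] order_trans[OF _ *]])
  ultimately show False by blast
qed

lemma op_nonzero:
  assumes u: "smooth_fun G U u"
  shows "op {q \<in> U. u q \<noteq> 0}"
proof (subst openin_subopen, clarify)
  fix p assume p: "p \<in> U" "u p \<noteq> 0"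
  have U: "op U" "U \<subseteq> points G" using smooth_fun_op[OF u] openin_subset by auto
  obtain c where c: "c \<in> atlas G" "p \<in> fst c" using ex_chart subsetD[OF U(2) p(1)] by blast
  let ?W = "snd c ` (U \<inter> fst c)" and ?F = "u \<circ> chart_inv c"
  have "open (?W \<inter> ?F -` (- {0}))"
    by (rule continuous_open_preimage[OF smooth_on_imp_continuous_on[OF smooth_fun_chart[OF u c(1)]]
          open_chart_image[OF c(1) U(1)]]) (rule open_Compl[OF closed_singleton])
  then have "op {q \<in> fst c. snd c q \<in> ?W \<inter> ?F -` (- {0})}"
    by (rule op_chart_preimage[OF c(1)])
  moreover have "p \<in> {q \<in> fst c. snd c q \<in> ?W \<inter> ?F -` (- {0})}"
    using p c by auto
  moreover have "{q \<in> fst c. snd c q \<in> ?W \<inter> ?F -` (- {0})} \<subseteq> {q \<in> U. u q \<noteq> 0}"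
  proof (rule subsetI)
    fix q assume "q \<in> {q \<in> fst c. snd c q \<in> ?W \<inter> ?F -` (- {0})}"
    then have q: "q \<in> fst c" "snd c q \<in> ?W" "snd c q \<in> ?F -` (- {0})" by simp_all
    then obtain q' where q': "q' \<in> U" "q' \<in> fst c" "snd c q = snd c q'" by auto
    then have "q = q'" using inj_onD[OF chart_inj[OF c(1)] _ q(1)] by blast
    then show "q \<in> {q \<in> U. u q \<noteq> 0}" using q q' c(1) by simp
  qed
  ultimately show "\<exists>T. op T \<and> p \<in> T \<and> T \<subseteq> {q \<in> U. u q \<noteq> 0}" by blast
qed

end

section \<open>Consequences of normality\<close>

context riem_mfd
begin

text \<open>Cross-multiplied, the proportionality needs no division and is trivial at critical
  points of \<open>f\<close>. Its defect \<open>?E\<close> is smooth; if it were nonzero at a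
  noncritical \<open>p\<close>, it would be so on a neighbourhood, which meets a regular level set,
  where normality makes it 0.\<close>

lemma normal_gradient_proportional:
  assumes f: "smooth_fun G (points G) f" and \<phi>: "smooth_fun G (points G) \<phi>"
    and normal: "normal_on_hypersurfaces G f (grad G \<phi>)"
    and p: "p \<in> points G" and w: "w \<in> tangent G p"
  shows "met G p (grad G f p) (grad G f p) * w \<phi> = met G p (grad G \<phi> p) (grad G f p) * w f"
proof (cases "\<exists>v\<in>tangent G p. v f \<noteq> 0")
  case False
  then have "grad G f p f = 0" "w f = 0" using grad_tangent[OF p, of f] w by blast+
  then show ?thesis unfolding met_grad[OF grad_tangent[OF p]] by simp
next
  case True
  let ?N = "\<lambda>q. met G q (grad G f q) (grad G f q)" and ?M = "\<lambda>q. met G q (grad G \<phi> q) (grad G f q)"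
  obtain v where v: "v \<in> tangent G p" "v f \<noteq> 0" using True by blast
  have regular: "?N q * z \<phi> - ?M q * z f = 0"
    if q: "q \<in> points G" "regular_value G f (f q)" and z: "z \<in> tangent G q" for q z
  proof -
    have gf: "grad G f q \<in> tangent G q" by (rule grad_tangent[OF q(1)])
    have q': "q \<in> level_set G f (f q)" using q(1) by (simp add: level_set_def)
    \<comment> \<open>\<open>?N q\<close> times the part of \<open>z\<close> orthogonal to grad f;
      it lies in the kernel of df.\<close>
    let ?z = "tplus (tscale (?N q) z) (tscale (- z f) (grad G f q))"
    have tz: "?z \<in> tangent G q" by (rule tangent_comb[OF z gf])
    have "differential f q ?z = 0"
      unfolding tlinearD[OF tlinear_differential z gf] met_grad[OF gf] by (simp add: differential_def)
    then have "met G q (grad G \<phi> q) ?z = 0"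
      using normal q(2) q' tz unfolding normal_on_hypersurfaces_def by blast
    then show ?thesis
      unfolding tlinearD[OF met_tlinear_right[OF grad_tangent[OF q(1)]] z gf] met_grad[OF z, of \<phi>] by simp
  qed
  obtain D where D: "p \<in> D" "smooth_vfield G D (extend G p w)" "extend G p w p = w"
    using extend_props[OF w] .
  have opD: "op D" and DM: "D \<subseteq> points G"
    using smooth_vfield_op[OF D(2)] openin_subset by auto
  note fD = smooth_fun_subset[OF f opD DM] and \<phi>D = smooth_fun_subset[OF \<phi> opD DM]
  let ?E = "\<lambda>q. ?N q * extend G p w q \<phi> - ?M q * extend G p w q f"
  have E: "smooth_fun G D ?E"
    by (rule smooth_fun_diff[OF smooth_fun_mult[OF met_smooth[OF smooth_grad[OF fD] smooth_grad[OF fD]] smooth_vfield_fun[OF D(2) \<phi>D]]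
          smooth_fun_mult[OF met_smooth[OF smooth_grad[OF \<phi>D] smooth_grad[OF fD]] smooth_vfield_fun[OF D(2) fD]]])
  have "?E p = 0"
  proof (rule ccontr)
    assume "?E p \<noteq> 0"
    then have "p \<in> {q \<in> D. ?E q \<noteq> 0}" using D(1) by simp
    then obtain q where q: "q \<in> D" "?E q \<noteq> 0" "regular_value G f (f q)"
      using regular_values_dense[OF f op_nonzero[OF E] _ v] by blast
    show False
      using q(2) regular[OF subsetD[OF DM q(1)] q(3) smooth_vfield_tangent[OF D(2) q(1)]] by simp
  qed
  then show ?thesis unfolding D(3) by simp
qed

end

context ricci_hessian_mfd
begin

lemma ricci_grad_normal:
  assumes cod: "codazzi G (schouten G)" and normal: "normal_on_hypersurfaces G f (grad G \<phi>)"
    and p: "p \<in> points G" and w: "w \<in> tangent G p" and wf: "w f = 0"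
  shows "ricci G p (grad G f p) w = 0"
proof (cases "grad G f p = tzero")
  case True
  then show ?thesis using tlinear_tzero[OF ricci_tlinear_left[OF w] p] by simp
next
  case False
  let ?N = "\<lambda>q. met G q (grad G f q) (grad G f q)" and ?M = "\<lambda>q. met G q (grad G \<phi> q) (grad G f q)"
  have gf: "grad G f p \<in> tangent G p" and g\<phi>: "grad G \<phi> p \<in> tangent G p" by (rule grad_tangent[OF p])+
  have Np: "?N p > 0" by (rule met_pos[OF gf False])
  \<comment> \<open>The factor \<open>h\<close> gets differentiated, so
    \<open>grad \<phi> = h grad f\<close> is needed on a neighbourhood of \<open>p\<close> and not
    only at \<open>p\<close>.\<close>
  define D where "D = {q \<in> points G. ?N q \<noteq> 0}"
  have sN: "smooth_fun G (points G) ?N" by (rule met_smooth[OF smooth_grad[OF smooth_f] smooth_grad[OF smooth_f]])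
  have D: "op D" unfolding D_def by (rule op_nonzero[OF sN])
  have pD: "p \<in> D" using Np p by (simp add: D_def)
  obtain V where V: "p \<in> V" "smooth_vfield G V (extend G p w)" "extend G p w p = w"
    using extend_props[OF w] .
  let ?U = "D \<inter> V"
  have U: "op ?U" by (rule openin_Int[OF D smooth_vfield_op[OF V(2)]])
  have UM: "?U \<subseteq> points G" by (auto simp: D_def)
  have pU: "p \<in> ?U" using pD V(1) by simp
  note fU = smooth_fun_subset[OF smooth_f U UM] and \<phi>U = smooth_fun_subset[OF smooth_\<phi> U UM]
  define h where "h q = ?M q / ?N q" for q
  have h: "smooth_fun G ?U h"
    unfolding h_def[abs_def]
    by (rule smooth_fun_divide[OF met_smooth[OF smooth_grad[OF \<phi>U] smooth_grad[OF fU]]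
          met_smooth[OF smooth_grad[OF fU] smooth_grad[OF fU]]]) (simp add: D_def)
  have proportional: "z \<phi> = h q * z f" if q: "q \<in> ?U" and z: "z \<in> tangent G q" for q z
    using normal_gradient_proportional[OF smooth_f smooth_\<phi> normal subsetD[OF UM q] z] q
    by (simp add: h_def D_def field_simps)
  have W: "smooth_vfield G ?U (extend G p w)" by (rule smooth_vfield_subset[OF V(2) U]) simp
  note X = smooth_grad[OF fU]
  note Xp = smooth_vfield_tangent[OF X pU]
  have hess: "hessian G u p (grad G f p) w = grad G f p (\<lambda>q. extend G p w q u) - nabla G (grad G f) (extend G p w) p u"
    if u: "smooth_fun G ?U u" for u
    using hess_formula[OF u X W pU] unfolding V(3) hessian_eq[OF u X pU w] .
  have "grad G f p (\<lambda>q. extend G p w q \<phi>) = grad G f p (\<lambda>q. h q * extend G p w q f)"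
    by (rule tangent_cong[OF Xp U pU]) (rule proportional[OF _ smooth_vfield_tangent[OF W]])
  \<comment> \<open>The derivative of \<open>h\<close> comes multiplied by \<open>w f\<close>, which
    is 0; away from \<open>p\<close> the extension of \<open>w\<close> need not lie in the kernel of
    df.\<close>
  also have "\<dots> = grad G f p h * w f + h p * grad G f p (\<lambda>q. extend G p w q f)"
    using tangent_mult[OF Xp smooth_nearI[OF h pU] smooth_nearI[OF smooth_vfield_fun[OF W fU] pU]] unfolding V(3) .
  finally have hess_\<phi>: "hessian G \<phi> p (grad G f p) w = h p * hessian G f p (grad G f p) w"
    unfolding hess[OF \<phi>U] hess[OF fU] proportional[OF pU smooth_vfield_tangent[OF nabla_smooth[OF X W] pU]] wf
    by (simp add: algebra_simps)
  have grad_\<phi>: "grad G \<phi> p = tscale (h p) (grad G f p)"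
  proof (rule met_ext[OF g\<phi> tangent_tscale[OF gf]])
    fix z assume z: "z \<in> tangent G p"
    show "met G p (grad G \<phi> p) z = met G p (tscale (h p) (grad G f p)) z"
      unfolding tlinear_tscale[OF met_tlinear_left[OF z] gf] met_grad[OF z] by (rule proportional[OF pU z])
  qed
  have ric: "ricci G p (grad G \<phi> p) w = h p * ricci G p (grad G f p) w"
    unfolding grad_\<phi> by (rule tlinear_tscale[OF ricci_tlinear_left[OF w] gf])
  have Rm: "Rm G p w (grad G f p) (grad G f p) \<in> tangent G p" by (rule Rm_skew(1)[OF w gf gf gf])
  have "met G p (Rm G p w (grad G f p) (grad G f p)) (grad G f p) = 0"
    using Rm_skew(2)[OF w gf gf gf] by simp
  \<comment> \<open>Skew-symmetry moves \<open>grad G \<phi> p\<close> into the metric slot, where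
    it is replaced by a multiple of \<open>grad G f p\<close>.\<close>
  then have "curvature_form G p (grad G \<phi> p) (grad G f p) w (grad G f p) = 0"
    unfolding curvature_form_def Rm_skew(2)[OF w gf g\<phi> gf] unfolding grad_\<phi> tlinear_tscale[OF met_tlinear_right[OF Rm] gf]
    by simp
  \<comment> \<open>On the pair \<open>w\<close>, grad f only one product of the wedge survives, as
    \<open>w f = 0\<close>.\<close>
  then have wedge: "((real m + real CARD('n) - 2) * ricci G p (grad G f p) w - f p * (h p * ricci G p (grad G f p) w)
      + (real CARD('n) - 2) * (h p * hessian G f p (grad G f p) w)) * grad G f p f = 0"
    using wedge_identity[OF cod w gf] unfolding wedge_def differential_def wf ric hess_\<phi> by simp
  have "grad G f p f \<noteq> 0" using Np met_grad[OF gf, of f] by simp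
  then have e1: "(real m + real CARD('n) - 2) * ricci G p (grad G f p) w - f p * (h p * ricci G p (grad G f p) w)
      + (real CARD('n) - 2) * (h p * hessian G f p (grad G f p) w) = 0"
    using wedge by simp
  have e2: "ricci G p (grad G f p) w = (real m / f p - h p) * hessian G f p (grad G f p) w"
    unfolding ricci_eq[OF gf w] hess_\<phi> met_grad[OF w] wf by (simp add: algebra_simps)
  have f0: "f p > 0" by (rule f_pos[OF p])
  let ?B = "hessian G f p (grad G f p) w" and ?n = "real CARD('n)"
  \<comment> \<open>Put \<open>e2\<close> into \<open>e1\<close> and multiply by \<open>f\<close>:
    the coefficient \<open>(m + n - 2 - f h) (m - f h) + (n - 2) f h\<close> is the sum on the
    left.\<close>
  have "((real m - f p * h p)\<^sup>2 + (?n - 2) * real m) * ?B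
      = f p * ((real m + ?n - 2) * ricci G p (grad G f p) w - f p * (h p * ricci G p (grad G f p) w) + (?n - 2) * (h p * ?B))"
    unfolding e2 using f0 by (simp add: field_simps power2_eq_square)
  also have "\<dots> = 0" unfolding e1 by simp
  finally have "((real m - f p * h p)\<^sup>2 + (?n - 2) * real m) * ?B = 0" .
  \<comment> \<open>Nothing is known about \<open>h\<close>, so positivity comes from the second
    summand, by \<open>m > 0\<close> and \<open>n \<ge> 3\<close>.\<close>
  moreover have "(real m - f p * h p)\<^sup>2 + (?n - 2) * real m > 0"
    using m_pos dim by (intro add_nonneg_pos zero_le_power2 mult_pos_pos) auto
  ultimately have "?B = 0" by simp
  then show ?thesis unfolding e2 by simp
qed

lemma ricci_grad_eigenvector:
  assumes cod: "codazzi G (schouten G)" and normal: "normal_on_hypersurfaces G f (grad G \<phi>)"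
    and p: "p \<in> points G"
  shows "\<exists>\<mu>. ricci_endo G p (grad G f p) = tscale \<mu> (grad G f p)"
proof (cases "grad G f p = tzero")
  case True
  note gf = grad_tangent[OF p, of f]
  have "met G p (grad G f p) z = ricci G p (grad G f p) z" if z: "z \<in> tangent G p" for z
    unfolding True using tlinear_tzero[OF ricci_tlinear_left[OF z] p] tlinear_tzero[OF met_tlinear_left[OF z] p] by simp
  \<comment> \<open>At a critical point both vectors vanish, so any eigenvalue fits; 1 is
    taken.\<close>
  then have "ricci_endo G p (grad G f p) = grad G f p"
    unfolding ricci_endo_def by (rule sharp_eqI[OF gf])
  then show ?thesis by (intro exI[of _ 1]) (simp add: tscale_def)
next
  case False
  note gf = grad_tangent[OF p, of f]
  let ?N = "met G p (grad G f p) (grad G f p)"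
  have N: "?N > 0" by (rule met_pos[OF gf False])
  \<comment> \<open>The only possible eigenvalue, as pairing the eigenvector equation with grad f
    shows.\<close>
  let ?\<mu> = "ricci G p (grad G f p) (grad G f p) / ?N"
  have "ricci_endo G p (grad G f p) = tscale ?\<mu> (grad G f p)"
    unfolding ricci_endo_def
  proof (rule sharp_eqI[OF tangent_tscale[OF gf]])
    fix w assume w: "w \<in> tangent G p"
    \<comment> \<open>Again a multiple of the part of \<open>w\<close> orthogonal to grad f, to
      which \<open>ricci_grad_normal\<close> applies.\<close>
    let ?z = "tplus (tscale ?N w) (tscale (- w f) (grad G f p))"
    have z: "?z \<in> tangent G p" by (rule tangent_comb[OF w gf])
    have "?z f = 0" unfolding met_grad[OF gf] by (simp add: tplus_def tscale_def)
    then have "ricci G p (grad G f p) ?z = 0" by (rule ricci_grad_normal[OF cod normal p z])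
    then have "?N * ricci G p (grad G f p) w = w f * ricci G p (grad G f p) (grad G f p)"
      unfolding tlinearD[OF ricci_tlinear_right[OF gf] w gf] by simp
    then show "met G p (tscale ?\<mu> (grad G f p)) w = ricci G p (grad G f p) w"
      unfolding tlinear_tscale[OF met_tlinear_left[OF w] gf] met_grad[OF w] using N by (simp add: field_simps)
  qed
  then show ?thesis by blast
qed

end

theorem proposition2:
  fixes G :: "('a, 'n::finite) riem"
    and f \<phi> lam :: "'a \<Rightarrow> real"
    and m :: nat
  assumes "CARD('n) \<ge> 3"
    and "ricci_hessian_type G f \<phi> lam m"
    and "subtopology (topol G) {p \<in> points G. grad G \<phi> p = tzero}
           = discrete_topology {p \<in> points G. grad G \<phi> p = tzero}"
    and "harmonic_weyl G"
  shows "(\<forall>p\<in>points G. \<forall>v\<in>tangent G p. \<forall>w\<in>tangent G p.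
            wedge (\<lambda>z. (real m + real CARD('n) - 2) * ricci G p (grad G f p) z
                       - f p * ricci G p (grad G \<phi> p) z
                       + (real CARD('n) - 2) * hessian G \<phi> p (grad G f p) z)
                  (differential f p) v w
            = (real CARD('n) - 1) * f p * curvature_form G p (grad G \<phi> p) (grad G f p) v w)
       \<and> (normal_on_hypersurfaces G f (grad G \<phi>) \<longrightarrow>
            (\<forall>p\<in>points G. \<exists>\<mu>. ricci_endo G p (grad G f p) = tscale \<mu> (grad G f p)))"
proof -
  interpret ricci_hessian_mfd G f \<phi> lam m
    using assms(1,2) by unfold_locales (simp_all add: ricci_hessian_type_def)
  have "codazzi G (schouten G)" using assms(4) by (simp add: harmonic_weyl_def)
  then show ?thesis using wedge_identity ricci_grad_eigenvector by blast
qed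

end
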